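(* Consider the oscillatory steady state of the perturbed dynamics and let $t>0$ (in (1), $t\ge 0$). (1) For every $v:\mathcal X\to\mathbb R$, $$\partial_{\lambda=0}\mathbb E_{\pi_\lambda}[v(X^\lambda_t)]=\int_0^\infty ds\,\langle e^{s\mathcal L}v,\psi_{t-s}\rangle=\int_0^\infty ds\,\mathbb E_\pi[v(X_s)\psi_{t-s}(X_0)].$$ (2) For every measurable $v:[0,t]\times\mathcal X\to\mathbb R$ such that $\int_0^t|v(s,x)|ds<+\infty$ for all $x\in\mathcal X$, $$\partial_{\lambda=0}\mathbb E_{\pi_\lambda}\Big[\int_0^tv(s,X^\lambda_s)ds\Big]=\int_0^tdu\int_0^\infty ds\,\langle e^{s\mathcal L}v(u,\cdot),\psi_{u-s}\rangle=\int_0^tdu\int_0^\infty ds\,\mathbb E_\pi[v(u,X_s)\psi_{u-s}(X_0)].$$ (3) For every measurable $\alpha:[0,t]\times\mathcal X\times\mathcal X\to\mathbb R$ such that $\int_0^t|\alpha|_r(s,x)ds<+\infty$ for all $x\in\mathcal X$, $$\partial_{\lambda=0}\mathbb E_{\pi_\lambda}\Big[\sum_{s\in(0,t]}\alpha(s,X^\lambda_{s-},X^\lambda_s)\Big]=\int_0^t\mathbb E_\pi[(\alpha g)_r(s,X_s)]ds+\int_0^tds\int_0^\infty du\,\mathbb E_\pi[\alpha_r(s,X_u)\psi_{s-u}(X_0)].$$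
   Context: $\mathcal X$ is a finite set and $(X_s)_{s\ge0}$ is the (unperturbed) continuous-time Markov jump process on $\mathcal X$ with transition rates $r(x,y)\ge0$ ($r(x,x)=0$), assumed irreducible; $\pi$ is its unique invariant distribution. $T\in(0,+\infty)$ and $g:\mathbb R\times\mathcal X\times\mathcal X\to\mathbb R$ is bounded, measurable and $T$-periodic in its first (time) variable. For $\lambda\in\mathbb R$ the perturbed process $(X^\lambda_s)_{s\ge0}$ is the time-inhomogeneous Markov jump process on $\mathcal X$ with transition rates at time $s$ given by $r^\lambda_s(x,y)=e^{\lambda g(s,x,y)}r(x,y)$. The discrete-time chain $(X^\lambda_{nT})_{n\ge0}$ is irreducible and $\pi_\lambda$ denotes its unique invariant distribution; the law of $(X^\lambda_s)_{s\ge0}$ with initial distribution $\pi_\lambda$ is called the oscillatory steady state (OSS). $\mathbb E_{\pi_\lambda}$ is expectation for initial distribution $\pi_\lambda$, and $\mathbb E_\pi$ is expectation for initial distribution $\pi$. $L^2(\pi)$ is the complex Hilbert space of functions on $\mathcal X$ with scalar product $\langle f,h\rangle=\sum_x\pi(x)\overline{f(x)}h(x)$. $\mathcal Lf(x)=\sum_yr(x,y)[f(y)-f(x)]$ is the generator of the unperturbed process. $r^*(x,y):=\pi(y)r(y,x)/\pi(x)$ and $$\psi_s(x):=\sum_{y\in\mathcal X}\big(r^*(x,y)g(s,y,x)-r(x,y)g(s,x,y)\big),\qquad s\in\mathbb R,\ x\in\mathcal X,$$ which is $T$-periodic in $s$. For $\alpha:[0,t]\times\mathcal X\times\mathcal X\to\mathbb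 R$, $\alpha_r(s,x):=\sum_y\alpha(s,x,y)r(x,y)$, and $|\alpha|_r$, $(\alpha g)_r$ are defined in the same way from $|\alpha|$ and $\alpha g$. The sum $\sum_{s\in(0,t]}\alpha(s,X^\lambda_{s-},X^\lambda_s)$ runs over the jump times $s\in(0,t]$ of $X^\lambda$. $\partial_{\lambda=0}$ is the derivative in $\lambda$ at $\lambda=0$. *)

theory Defs
  imports "HOL-Probability.Probability"
begin

section \<open>Jump paths\<close>

text \<open>On a finite (discrete) state space, being right-continuous with left limits means being
  locally constant on both sides; such a path has finitely many jumps in bounded intervals
  (lemma \<open>finite_jump_times\<close>), so the sums over jump times used later are genuine finite sums.\<close>

definition cadlag_path :: "(real \<Rightarrow> 'x) \<Rightarrow> bool" where
  "cadlag_path w \<longleftrightarrow>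
     (\<forall>t\<ge>0. \<forall>\<^sub>F u in at_right t. w u = w t) \<and>
     (\<forall>t>0. \<exists>x. \<forall>\<^sub>F u in at_left t. w u = x)"

definition left_lim :: "(real \<Rightarrow> 'x) \<Rightarrow> real \<Rightarrow> 'x" where
  "left_lim w s = (THE x. \<forall>\<^sub>F u in at_left s. w u = x)"

definition jump_times :: "(real \<Rightarrow> 'x) \<Rightarrow> real \<Rightarrow> real set" where
  "jump_times w t = {s. 0 < s \<and> s \<le> t \<and> left_lim w s \<noteq> w s}"

lemma left_lim_eqI:
  assumes "\<forall>\<^sub>F u in at_left s. w u = x"
  shows "left_lim w s = x"
  unfolding left_lim_def
proof (rule the_equality)
  show "\<forall>\<^sub>F u in at_left s. w u = x" by (rule assms)
next
  fix y assume "\<forall>\<^sub>F u in at_left s. w u = y"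
  with assms have "\<forall>\<^sub>F u in at_left s. x = y"
    by eventually_elim simp
  then show "y = x" by simp
qed

lemma left_lim_eq_const:
  assumes "a < s" "\<And>u. a < u \<Longrightarrow> u \<le> s \<Longrightarrow> w u = x"
  shows "left_lim w s = w s"
proof -
  have "\<forall>\<^sub>F u in at_left s. a < u \<and> u < s"
    using assms(1) by (auto simp: eventually_at_left_field)
  then have "\<forall>\<^sub>F u in at_left s. w u = w s"
    by eventually_elim (use assms in auto)
  then show ?thesis by (rule left_lim_eqI)
qed

lemma finite_jump_times:
  assumes "cadlag_path w"
  shows "finite (jump_times w t)"
proof -
  have *: "\<exists>U. open U \<and> s \<in> U \<and> finite (jump_times w t \<inter> U)" if s: "s \<ge> 0" for s
  proof -
    have "\<forall>\<^sub>F u in at_right s. w u = w s"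
      using assms s by (simp add: cadlag_path_def)
    then obtain b where b: "b > s" "\<And>u. s < u \<Longrightarrow> u < b \<Longrightarrow> w u = w s"
      unfolding eventually_at_right_field by blast
    obtain a x where a: "a < s" "\<And>u. a < u \<Longrightarrow> u < s \<Longrightarrow> 0 < u \<Longrightarrow> w u = x"
    proof (cases "s = 0")
      case True
      then show ?thesis by (intro that[of "-1" undefined]) simp_all
    next
      case False
      with s have "s > 0" by simp
      then obtain x where "\<forall>\<^sub>F u in at_left s. w u = x"
        using assms unfolding cadlag_path_def by blast
      then show ?thesis using that unfolding eventually_at_left_field by blast
    qed
    have "jump_times w t \<inter> {a<..<b} \<subseteq> {s}"
    proof
      fix v assume v: "v \<in> jump_times w t \<inter> {a<..<b}"
      then have v': "0 < v" "a < v" "v < b" "left_lim w v \<noteq> w v"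
        by (auto simp: jump_times_def)
      have "left_lim w v = w v" if "v < s"
        by (rule left_lim_eq_const[of "max a 0" v w x]) (use v' a that in simp_all)
      moreover have "left_lim w v = w v" if "s < v"
        by (rule left_lim_eq_const[of s v w "w s"]) (use v' b that in simp_all)
      ultimately show "v \<in> {s}" using v'(4) by force
    qed
    then have "finite (jump_times w t \<inter> {a<..<b})"
      using finite_subset by blast
    then show ?thesis
      using a(1) b(1) by (intro exI[of _ "{a<..<b}"]) auto
  qed
  then have "\<forall>s\<in>{0..}. \<exists>U. open U \<and> s \<in> U \<and> finite (jump_times w t \<inter> U)"
    by blast
  then obtain U where "\<forall>s\<in>{0..}. open (U s) \<and> s \<in> U s \<and> finite (jump_times w t \<inter> U s)"
    by (rule bchoice[THEN exE])
  then have U: "open (U s)" "s \<in> U s" "finite (jump_times w t \<inter> U s)" if "s \<in> {0..t}" for s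
    using that by simp_all
  have "compact {0..t}" by simp
  moreover have "\<And>c. c \<in> {0..t} \<Longrightarrow> open (U c)" by (rule U(1))
  moreover have "{0..t} \<subseteq> (\<Union>c\<in>{0..t}. U c)" using U(2) by blast
  ultimately obtain C where C: "C \<subseteq> {0..t}" "finite C" "{0..t} \<subseteq> (\<Union>c\<in>C. U c)"
    by (rule compactE_image)
  have "jump_times w t \<subseteq> (\<Union>c\<in>C. jump_times w t \<inter> U c)"
  proof
    fix s assume s: "s \<in> jump_times w t"
    then have "s \<in> {0..t}" by (simp add: jump_times_def)
    with C(3) s show "s \<in> (\<Union>c\<in>C. jump_times w t \<inter> U c)" by blast
  qed
  moreover have "finite (\<Union>c\<in>C. jump_times w t \<inter> U c)"
    using C(1,2) U(3) by blast
  ultimately show ?thesis by (rule finite_subset)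
qed


section \<open>Time-inhomogeneous Markov jump processes\<close>

text \<open>The transition function \<open>P s t x\<close> (only meaningful for \<open>0 \<le> s \<le> t\<close>) generated by the
  rates \<open>q\<close>: the law at time \<open>t\<close> of the process started from \<open>x\<close> at time \<open>s\<close>. As the rates are
  only measurable in time, the Kolmogorov forward equation is required in integrated form;
  its case \<open>t = s\<close> says that \<open>P s s\<close> is the identity.\<close>

definition transition_function ::
  "(real \<Rightarrow> 'x \<Rightarrow> 'x \<Rightarrow> real) \<Rightarrow> (real \<Rightarrow> real \<Rightarrow> 'x::finite \<Rightarrow> 'x pmf) \<Rightarrow> bool" where
  "transition_function q P \<longleftrightarrow>
     (\<forall>s t u x. 0 \<le> s \<and> s \<le> t \<and> t \<le> u \<longrightarrow> P s u x = bind_pmf (P s t x) (P t u)) \<and>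
     (\<forall>s t x y. 0 \<le> s \<and> s \<le> t \<longrightarrow>
        ((\<lambda>u. (\<Sum>z\<in>UNIV. pmf (P s u x) z * q u z y) - pmf (P s u x) y * (\<Sum>z\<in>UNIV. q u y z))
           has_integral (pmf (P s t x) y - of_bool (x = y))) {s..t})"

text \<open>A process \<open>X\<close> on \<open>(M, \<real>\<^sub>+)\<close> with cadlag paths, initial law \<open>\<mu>\<close> and the Markov property with
  transition function \<open>P\<close>.\<close>

definition markov_jump_process ::
  "(real \<Rightarrow> real \<Rightarrow> 'x::finite \<Rightarrow> 'x pmf) \<Rightarrow> 'x pmf \<Rightarrow> 'w measure \<Rightarrow> (real \<Rightarrow> 'w \<Rightarrow> 'x) \<Rightarrow> bool" where
  "markov_jump_process P \<mu> M X \<longleftrightarrow>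
     prob_space M \<and>
     (\<forall>t\<ge>0. X t \<in> measurable M (count_space UNIV)) \<and>
     (\<forall>\<omega>\<in>space M. cadlag_path (\<lambda>t. X t \<omega>)) \<and>
     distr M (count_space UNIV) (X 0) = measure_pmf \<mu> \<and>
     (\<forall>(n::nat) (\<tau>::nat \<Rightarrow> real) (\<xi>::nat \<Rightarrow> 'x).
        0 \<le> \<tau> 0 \<and> (\<forall>i\<le>n. \<tau> i \<le> \<tau> (Suc i)) \<longrightarrow>
        measure M {\<omega> \<in> space M. \<forall>i\<le>Suc n. X (\<tau> i) \<omega> = \<xi> i} =
        measure M {\<omega> \<in> space M. \<forall>i\<le>n. X (\<tau> i) \<omega> = \<xi> i} *
          pmf (P (\<tau> n) (\<tau> (Suc n)) (\<xi> n)) (\<xi> (Suc n)))"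

definition irreducible_rates :: "('x \<Rightarrow> 'x \<Rightarrow> real) \<Rightarrow> bool" where
  "irreducible_rates r \<longleftrightarrow> (\<forall>x y. (\<lambda>a b. r a b > 0)\<^sup>*\<^sup>* x y)"

definition invariant_distribution :: "('x \<Rightarrow> 'x pmf) \<Rightarrow> 'x pmf \<Rightarrow> bool" where
  "invariant_distribution K \<mu> \<longleftrightarrow> bind_pmf \<mu> K = \<mu>"

definition perturbed_rates ::
  "('x \<Rightarrow> 'x \<Rightarrow> real) \<Rightarrow> (real \<Rightarrow> 'x \<Rightarrow> 'x \<Rightarrow> real) \<Rightarrow> real \<Rightarrow> real \<Rightarrow> 'x \<Rightarrow> 'x \<Rightarrow> real" where
  "perturbed_rates r g l s x y = exp (l * g s x y) * r x y"


section \<open>Generator, semigroup and response function\<close>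

definition generator :: "('x::finite \<Rightarrow> 'x \<Rightarrow> real) \<Rightarrow> ('x \<Rightarrow> complex) \<Rightarrow> 'x \<Rightarrow> complex" where
  "generator r f x = (\<Sum>y\<in>UNIV. of_real (r x y) * (f y - f x))"

text \<open>\<open>exp_generator r s f\<close> is \<open>e\<^bsup>s\<L>\<^esup> f\<close>, by the exponential series of the operator \<open>s \<L>\<close>.\<close>

definition exp_generator ::
  "('x::finite \<Rightarrow> 'x \<Rightarrow> real) \<Rightarrow> real \<Rightarrow> ('x \<Rightarrow> complex) \<Rightarrow> 'x \<Rightarrow> complex" where
  "exp_generator r s f x = (\<Sum>n. of_real (s ^ n / fact n) * (generator r ^^ n) f x)"

definition L2_inner :: "'x::finite pmf \<Rightarrow> ('x \<Rightarrow> complex) \<Rightarrow> ('x \<Rightarrow> complex) \<Rightarrow> complex" where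
  "L2_inner \<pi> f h = (\<Sum>x\<in>UNIV. of_real (pmf \<pi> x) * cnj (f x) * h x)"

definition reversed_rates :: "('x \<Rightarrow> 'x \<Rightarrow> real) \<Rightarrow> 'x pmf \<Rightarrow> 'x \<Rightarrow> 'x \<Rightarrow> real" where
  "reversed_rates r \<pi> x y = pmf \<pi> y * r y x / pmf \<pi> x"

definition psi ::
  "('x::finite \<Rightarrow> 'x \<Rightarrow> real) \<Rightarrow> 'x pmf \<Rightarrow> (real \<Rightarrow> 'x \<Rightarrow> 'x \<Rightarrow> real) \<Rightarrow> real \<Rightarrow> 'x \<Rightarrow> real" where
  "psi r \<pi> g s x = (\<Sum>y\<in>UNIV. reversed_rates r \<pi> x y * g s y x - r x y * g s x y)"

text \<open>\<open>rate_contract r \<alpha>\<close> is \<open>\<alpha>\<^sub>r\<close>.\<close>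

definition rate_contract ::
  "('x::finite \<Rightarrow> 'x \<Rightarrow> real) \<Rightarrow> (real \<Rightarrow> 'x \<Rightarrow> 'x \<Rightarrow> real) \<Rightarrow> real \<Rightarrow> 'x \<Rightarrow> real" where
  "rate_contract r \<alpha> s x = (\<Sum>y\<in>UNIV. \<alpha> s x y * r x y)"

end

(* Duhamel's formula for the generator L of the unperturbed process expresses the deviation
   delta_t = law(X_t) - pi in the oscillatory steady state as
     delta_t = delta_0 e^(tL) + int_0^t law(X_u) (L_u - L) e^((t-u)L) du,
   where L_u is the perturbed generator at time u. Invariance of the initial law under the
   period map gives delta_T = delta_0, and e^(TL) contracts mean-zero measures by Doeblin's
   condition, so delta_0 is bounded by the source term. The response D_t, defined as the
   integral over s >= 0 of (pi psi_(t-s)) e^(sL), solves the linearised equation and is periodic.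
   Hence delta_t - lambda D_t solves an equation of the same type with a source of order
   lambda^2, and law(X_t) = pi + lambda D_t + O(lambda^2) uniformly on bounded time intervals.
   Fubini's theorem then gives (2). For (3), the expected sum over jumps is the integral of alpha
   against law(X_s)(x) r^lambda_s(x,y) ds: for intervals this follows by counting jumps along
   finer and finer grids, for measurable alpha by a monotone class argument. *)

theory Submission
  imports Defs
begin

section \<open>Calculus\<close>

text \<open>The rates are only measurable in time, so the forward equation is an integral equation
  and transition probabilities are merely Lipschitz in time. Duhamel's formula therefore cannot come
  from differentiating a product; it rests on an integration by parts whose error over a short
  interval is quadratic. Processes for different \<open>l\<close> live on unrelated probability
  spaces, so every expectation is first reduced to one-time laws and no paths are compared. The
  initial law \<open>\<pi>l l\<close> is known through invariance under \<open>P l 0 T\<close>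
  alone, and even its continuity in \<open>l\<close> at 0 has to be proved: one a priori bound for
  periodic solutions of the integral equation is applied twice, first with a source of order
  \<open>l\<close>, then, with the outcome inserted, with a source of order \<open>l^2\<close>. The
  remainder is uniform in time on bounded intervals, so it may be multiplied by functions that are
  only integrable in time, such as \<open>v\<close> or \<alpha> times a rate, and the derivative
  passes under the time integral.\<close>

lemma has_real_derivative_quadratic_error:
  fixes F :: "real \<Rightarrow> real"
  assumes e: "e > 0"
    and q: "\<And>y. y \<in> S \<Longrightarrow> \<bar>y - x\<bar> \<le> e \<Longrightarrow> \<bar>F y - F x - D * (y - x)\<bar> \<le> C * (y - x)\<^sup>2"
  shows "(F has_real_derivative D) (at x within S)"
proof -
  have "((\<lambda>y. (F y - F x) / (y - x) - D) \<longlongrightarrow> 0) (at x within S)"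
  proof (rule Lim_null_comparison)
    have "\<forall>\<^sub>F y in at x within S. y \<in> S \<and> y \<noteq> x \<and> dist y x < e"
      using e by (auto simp: eventually_at)
    then show "\<forall>\<^sub>F y in at x within S. norm ((F y - F x) / (y - x) - D) \<le> C * \<bar>y - x\<bar>"
    proof eventually_elim
      case (elim y)
      then have "\<bar>F y - F x - D * (y - x)\<bar> \<le> C * (y - x)\<^sup>2"
        by (intro q) (auto simp: dist_real_def)
      moreover have "(F y - F x) / (y - x) - D = (F y - F x - D * (y - x)) / (y - x)"
        using elim by (simp add: field_simps)
      moreover have "C * (y - x)\<^sup>2 = C * \<bar>y - x\<bar> * \<bar>y - x\<bar>"
        by (simp add: power2_eq_square)
      ultimately show ?case
        using elim by (simp add: abs_divide divide_le_eq)
    qed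
    have "((\<lambda>y. C * \<bar>y - x\<bar>) \<longlongrightarrow> C * \<bar>x - x\<bar>) (at x within S)"
      by (intro tendsto_intros)
    then show "((\<lambda>y. C * \<bar>y - x\<bar>) \<longlongrightarrow> 0) (at x within S)" by simp
  qed
  then show ?thesis
    unfolding has_field_derivative_iff by (rule LIM_zero_cancel)
qed

text \<open>Increments of order \<open>(v - u)^2\<close> force the derivative to vanish at every
  point of the interval, one-sidedly at its ends. This replaces summing the errors over finer and
  finer partitions.\<close>

lemma eq_if_quadratic_increments:
  fixes F :: "real \<Rightarrow> real"
  assumes "a \<le> b"
    and q: "\<And>u v. a \<le> u \<Longrightarrow> u \<le> v \<Longrightarrow> v \<le> b \<Longrightarrow> \<bar>F v - F u\<bar> \<le> C * (v - u)\<^sup>2"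
  shows "F b = F a"
proof -
  have "\<bar>F v - F u\<bar> \<le> C * (v - u)\<^sup>2" if "u \<in> {a..b}" "v \<in> {a..b}" for u v
    using q[of u v] q[of v u] that by (cases "u \<le> v") (auto simp: abs_minus_commute power2_commute)
  then have "(F has_real_derivative 0) (at x within {a..b})" if "x \<in> {a..b}" for x
    using that by (intro has_real_derivative_quadratic_error[of 1 _ _ _ _ C]) auto
  then have "\<exists>c. \<forall>x\<in>{a..b}. F x = c"
    by (intro has_field_derivative_zero_constant) auto
  then show ?thesis using \<open>a \<le> b\<close> by auto
qed

text \<open>The factor \<open>p\<close> is only Lipschitz; the defect of the claimed identity over \<open>{u..v}\<close> is of
  order \<open>(v - u)\<^sup>2\<close>, hence zero.\<close>

lemma integration_by_parts_lipschitz: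
  fixes f p h h' :: "real \<Rightarrow> real"
  assumes ab: "a \<le> b"
    and f: "\<And>u. u \<in> {a..b} \<Longrightarrow> (f has_integral (p u - p a)) {a..u}"
    and fK: "\<And>u. u \<in> {a..b} \<Longrightarrow> \<bar>f u\<bar> \<le> K"
    and h: "\<And>u. u \<in> {a..b} \<Longrightarrow> (h has_real_derivative h' u) (at u within {a..b})"
    and h': "continuous_on {a..b} h'"
  shows "((\<lambda>u. f u * h u + p u * h' u) has_integral (p b * h b - p a * h a)) {a..b}"
proof -
  have K0: "K \<ge> 0" using fK[of a] ab by force
  have fint: "f integrable_on {a..b}" using f[of b] ab by (auto simp: integrable_on_def)
  have fuv: "(f has_integral (p v - p u)) {u..v}" if "a \<le> u" "u \<le> v" "v \<le> b" for u v
  proof -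
    have i: "f integrable_on {a..v}" using f[of v] that by (auto simp: integrable_on_def)
    have "integral {a..u} f + integral {u..v} f = integral {a..v} f"
      using that by (intro Henstock_Kurzweil_Integration.integral_combine i) auto
    moreover have "integral {a..u} f = p u - p a" "integral {a..v} f = p v - p a"
      using f[of u] f[of v] that by (auto intro!: integral_unique)
    moreover have "f integrable_on {u..v}"
      by (rule integrable_on_subinterval[OF i]) (use that in auto)
    ultimately show ?thesis by (simp add: has_integral_iff)
  qed
  have pK: "\<bar>p v - p u\<bar> \<le> K * (v - u)" if "a \<le> u" "u \<le> v" "v \<le> b" for u v
    using has_integral_bound_real[OF K0 _ fuv[OF that], of "{}"] fK that by simp
  have hc: "continuous_on {a..b} h"
    unfolding continuous_on_eq_continuous_within using h DERIV_continuous by blast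
  have pc: "continuous_on {a..b} p"
  proof -
    have "continuous_on {a..b} (\<lambda>u. p a + integral {a..u} f)"
      by (intro continuous_intros indefinite_integral_continuous_1 fint)
    then show ?thesis
      by (rule continuous_on_eq) (simp add: integral_unique[OF f])
  qed
  obtain H where H: "\<And>u. u \<in> {a..b} \<Longrightarrow> \<bar>h' u\<bar> \<le> H"
    using compact_imp_bounded[OF compact_continuous_image[OF h' compact_Icc]]
    unfolding bounded_iff by (metis imageI real_norm_def)
  have H0: "H \<ge> 0" using H[of a] ab by force
  have h'uv: "(h' has_integral (h v - h u)) {u..v}" if "a \<le> u" "u \<le> v" "v \<le> b" for u v
  proof (rule fundamental_theorem_of_calculus)
    fix x assume "x \<in> {u..v}"
    then have "(h has_real_derivative h' x) (at x within {u..v})"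
      using that by (intro DERIV_subset[OF h]) auto
    then show "(h has_vector_derivative h' x) (at x within {u..v})"
      by (simp add: has_real_derivative_iff_has_vector_derivative)
  qed (use that in simp)
  have hH: "\<bar>h v - h u\<bar> \<le> H * (v - u)" if "a \<le> u" "u \<le> v" "v \<le> b" for u v
    using has_integral_bound_real[OF H0 _ h'uv[OF that], of "{}"] H that by simp
  have fabs: "f absolutely_integrable_on {a..b}"
    by (rule absolutely_integrable_integrable_bound[OF _ fint, of "\<lambda>_. K"]) (use fK in auto)
  have "(\<lambda>u. h u * f u) absolutely_integrable_on {a..b}"
    by (intro absolutely_integrable_bounded_measurable_product_real fabs
        continuous_imp_measurable_on_sets_lebesgue hc compact_imp_bounded
        compact_continuous_image) auto
  then have fh: "(\<lambda>u. f u * h u) integrable_on {a..b}"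
    by (simp add: mult.commute absolutely_integrable_on_def)
  have ph: "(\<lambda>u. p u * h' u) integrable_on {a..b}"
    by (intro integrable_continuous_real continuous_intros pc h')
  define G where "G = (\<lambda>u. f u * h u + p u * h' u)"
  have G: "G integrable_on {a..b}"
    unfolding G_def by (intro integrable_add fh ph)
  \<comment> \<open>\<open>\<Psi>\<close> is the running defect up to a constant. Over
    \<open>{u..v}\<close> the factor \<open>h\<close> is frozen at \<open>v\<close> and
    \<open>p\<close> at \<open>u\<close>: the two frozen terms account for the change of
    \<open>p * h\<close> exactly, and the remaining integrand is at most
    \<open>2 * K * H * (v - u)\<close>.\<close>
  define \<Psi> where "\<Psi> = (\<lambda>u. integral {a..u} G - p u * h u)"
  have "\<Psi> b = \<Psi> a"
  proof (rule eq_if_quadratic_increments[OF ab, of _ "2 * K * H"])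
    fix u v assume uv: "a \<le> u" "u \<le> v" "v \<le> b"
    have Guv: "G integrable_on {u..v}" "G integrable_on {a..v}"
      by (rule integrable_on_subinterval[OF G]; use uv in auto)+
    have "integral {a..u} G + integral {u..v} G = integral {a..v} G"
      using uv by (intro Henstock_Kurzweil_Integration.integral_combine Guv) auto
    then have "\<Psi> v - \<Psi> u = integral {u..v} G - (p v - p u) * h v - p u * (h v - h u)"
      by (simp add: \<Psi>_def algebra_simps)
    moreover have "((\<lambda>s. G s - f s * h v - p u * h' s) has_integral
        (integral {u..v} G - (p v - p u) * h v - p u * (h v - h u))) {u..v}"
      using uv by (intro has_integral_diff integrable_integral Guv has_integral_mult_left
          has_integral_mult_right fuv h'uv)
    ultimately have "((\<lambda>s. G s - f s * h v - p u * h' s) has_integral (\<Psi> v - \<Psi> u)) {u..v}"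
      by simp
    then have "norm (\<Psi> v - \<Psi> u) \<le> (2 * K * H * (v - u)) * measure lborel {u..v}"
    proof (rule has_integral_bound_real[rotated 2])
      fix s assume s: "s \<in> {u..v} - {}"
      have "G s - f s * h v - p u * h' s = f s * (h s - h v) + (p s - p u) * h' s"
        by (simp add: G_def algebra_simps)
      also have "\<bar>\<dots>\<bar> \<le> \<bar>f s\<bar> * \<bar>h v - h s\<bar> + \<bar>p s - p u\<bar> * \<bar>h' s\<bar>"
        by (rule order_trans[OF abs_triangle_ineq]) (simp add: abs_mult abs_minus_commute)
      also have "\<dots> \<le> K * (H * (v - s)) + K * (s - u) * H"
        using s uv K0 H0 by (intro add_mono mult_mono fK hH pK H) auto
      also have "\<dots> \<le> K * (H * (v - u)) + K * (v - u) * H"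
        using s uv K0 H0 by (intro add_mono mult_mono mult_left_mono) auto
      finally show "norm (G s - f s * h v - p u * h' s) \<le> 2 * K * H * (v - u)"
        by (simp add: algebra_simps)
    qed (use uv K0 H0 in auto)
    then show "\<bar>\<Psi> v - \<Psi> u\<bar> \<le> 2 * K * H * (v - u)\<^sup>2"
      using uv by (simp add: power2_eq_square algebra_simps)
  qed
  then have "integral {a..b} G = p b * h b - p a * h a"
    by (simp add: \<Psi>_def)
  with G show ?thesis unfolding G_def by (simp add: has_integral_iff)
qed

text \<open>For negative \<open>a\<close> the upper bound comes from
  \<open>exp a \<le> 1 / (1 - a)\<close> together with
  \<open>(1 + a + a^2) * (1 - a) = 1 - a^3 \<ge> 1\<close>.\<close>

lemma abs_exp_minus_one_minus_le:
  fixes a :: real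
  assumes "\<bar>a\<bar> \<le> 1"
  shows "\<bar>exp a - 1 - a\<bar> \<le> a\<^sup>2"
proof -
  have "exp a \<le> 1 + a + a\<^sup>2"
  proof (cases "a \<ge> 0")
    case True
    then show ?thesis using assms exp_bound[of a] by simp
  next
    case False
    have "1 + (- a) \<le> exp (- a)" by (rule exp_ge_add_one_self)
    then have "exp a \<le> 1 / (1 - a)"
      using False by (simp add: exp_minus field_simps)
    also have "\<dots> \<le> 1 + a + a\<^sup>2"
    proof -
      have "(1 + a + a\<^sup>2) * (1 - a) = 1 - a ^ 3"
        by (simp add: algebra_simps power2_eq_square power3_eq_cube)
      moreover have "a ^ 3 \<le> 0"
        using False by (simp add: power_le_zero_eq)
      ultimately show ?thesis using False by (simp add: divide_le_eq)
    qed
    finally show ?thesis .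
  qed
  moreover have "1 + a \<le> exp a" by (rule exp_ge_add_one_self)
  ultimately show ?thesis using zero_le_power2[of a] by linarith
qed

section \<open>Integrability over sets of bounded functions, products and finite sums\<close>

lemma set_integrable_bounded_Icc:
  fixes f :: "real \<Rightarrow> real"
  assumes "set_borel_measurable borel {a..b} f" "\<And>u. u \<in> {a..b} \<Longrightarrow> \<bar>f u\<bar> \<le> K"
  shows "set_integrable lborel {a..b} f"
proof -
  have "set_integrable lborel {a..b} (\<lambda>_. K)"
    by (intro borel_integrable_atLeastAtMost' continuous_intros)
  then show ?thesis
    unfolding set_integrable_def
  proof (rule Bochner_Integration.integrable_bound)
    show "(\<lambda>x. indicat_real {a..b} x *\<^sub>R f x) \<in> borel_measurable lborel"
      using assms(1) by (simp add: set_borel_measurable_def)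
    have "norm (indicat_real {a..b} x *\<^sub>R f x) \<le> norm (indicat_real {a..b} x *\<^sub>R K)" for x
      using assms(2)[of x] by (cases "x \<in> {a..b}") (simp_all del: atLeastAtMost_iff)
    then show "AE x in lborel. norm (indicat_real {a..b} x *\<^sub>R f x) \<le> norm (indicat_real {a..b} x *\<^sub>R K)"
      by simp
  qed
qed

lemma set_integrable_mult_bounded:
  fixes f k :: "real \<Rightarrow> real"
  assumes f: "set_integrable lborel S f" and k: "set_borel_measurable borel S k"
    and K: "\<And>s. s \<in> S \<Longrightarrow> \<bar>k s\<bar> \<le> K"
  shows "set_integrable lborel S (\<lambda>s. f s * k s)"
  unfolding set_integrable_def
proof (rule Bochner_Integration.integrable_bound)
  show "integrable lborel (\<lambda>s. K * (indicat_real S s *\<^sub>R f s))"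
    using f by (intro integrable_mult_right) (simp add: set_integrable_def)
  have "(\<lambda>s. indicat_real S s *\<^sub>R f s) \<in> borel_measurable lborel"
    using f by (simp add: set_integrable_def borel_measurable_integrable)
  moreover have "(\<lambda>s. indicat_real S s *\<^sub>R k s) \<in> borel_measurable lborel"
    using k by (simp add: set_borel_measurable_def)
  ultimately have "(\<lambda>s. (indicat_real S s *\<^sub>R f s) * (indicat_real S s *\<^sub>R k s)) \<in> borel_measurable lborel"
    by measurable
  also have "(\<lambda>s. (indicat_real S s *\<^sub>R f s) * (indicat_real S s *\<^sub>R k s)) = (\<lambda>s. indicat_real S s *\<^sub>R (f s * k s))"
    by (auto simp: indicator_def)
  finally show "(\<lambda>s. indicat_real S s *\<^sub>R (f s * k s)) \<in> borel_measurable lborel" .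
  have "norm (indicat_real S s *\<^sub>R (f s * k s)) \<le> norm (K * (indicat_real S s *\<^sub>R f s))" for s
  proof (cases "s \<in> S")
    case True
    have "\<bar>k s\<bar> * \<bar>f s\<bar> \<le> \<bar>K\<bar> * \<bar>f s\<bar>"
      using K[OF True] by (intro mult_right_mono) auto
    then show ?thesis using True by (simp add: abs_mult mult.commute)
  qed simp
  then show "AE s in lborel. norm (indicat_real S s *\<^sub>R (f s * k s)) \<le> norm (K * (indicat_real S s *\<^sub>R f s))"
    by simp
qed

text \<open>The factors \<open>c i\<close> let time-independent weights such as
  \<open>Q t x y\<close> leave the integral; \<open>c i = 1\<close> is the plain interchange of sum
  and integral.\<close>

lemma
  fixes f :: "'i \<Rightarrow> 'a \<Rightarrow> real"
  assumes "\<And>i. i \<in> I \<Longrightarrow> set_integrable M S (f i)"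
  shows set_integrable_sum_mult: "set_integrable M S (\<lambda>s. \<Sum>i\<in>I. f i s * c i)"
    and set_integral_sum_mult: "(LINT s:S|M. (\<Sum>i\<in>I. f i s * c i)) = (\<Sum>i\<in>I. (LINT s:S|M. f i s) * c i)"
proof -
  have i: "integrable M (\<lambda>s. (indicat_real S s *\<^sub>R f i s) * c i)" if "i \<in> I" for i
    using assms[OF that] by (intro integrable_mult_left) (simp add: set_integrable_def)
  have eq: "indicat_real S s *\<^sub>R (\<Sum>i\<in>I. f i s * c i) = (\<Sum>i\<in>I. (indicat_real S s *\<^sub>R f i s) * c i)" for s
    by (simp add: sum_distrib_left mult.assoc)
  show "set_integrable M S (\<lambda>s. \<Sum>i\<in>I. f i s * c i)"
    unfolding set_integrable_def eq by (rule Bochner_Integration.integrable_sum[OF i])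
  show "(LINT s:S|M. (\<Sum>i\<in>I. f i s * c i)) = (\<Sum>i\<in>I. (LINT s:S|M. f i s) * c i)"
    unfolding set_lebesgue_integral_def eq
    by (subst Bochner_Integration.integral_sum[OF i]) simp_all
qed

lemma set_integrable_exp_minus: "c > 0 \<Longrightarrow> set_integrable lborel {0..} (\<lambda>s::real. A * exp (- c * s))"
proof -
  assume c: "c > 0"
  have "(\<lambda>s. exp (- c * s)) absolutely_integrable_on {0..}"
    using integrable_on_exp_minus_to_infinity[OF c, of 0] by (intro nonnegative_absolutely_integrable_1) auto
  then have "set_integrable lborel {0..} (\<lambda>s. exp (- c * s))"
    unfolding set_integrable_def
    by (subst (asm) integrable_completion) (auto intro!: borel_measurable_continuous_on_indicator continuous_intros)
  then show ?thesis by simp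
qed

section \<open>The exponential of a generator\<close>

text \<open>All estimates are carried out over the reals, and the complex semigroup enters only
  through \<open>exp_generator_of_real\<close>. The rates are arbitrary real numbers here, so that
  differences of rates are covered.\<close>

definition real_generator :: "('x::finite \<Rightarrow> 'x \<Rightarrow> real) \<Rightarrow> ('x \<Rightarrow> real) \<Rightarrow> 'x \<Rightarrow> real" where
  "real_generator r f x = (\<Sum>y\<in>UNIV. r x y * (f y - f x))"

definition real_exp_generator ::
  "('x::finite \<Rightarrow> 'x \<Rightarrow> real) \<Rightarrow> real \<Rightarrow> ('x \<Rightarrow> real) \<Rightarrow> 'x \<Rightarrow> real" where
  "real_exp_generator r s f x = (\<Sum>n. (real_generator r ^^ n) f x / fact n * s ^ n)"

text \<open>The \<open>l1\<close> norm dominates every single value, and in this norm the generator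
  is bounded by a crude constant that can be iterated.\<close>

lemma real_generator_power_bound:
  fixes r :: "'x::finite \<Rightarrow> 'x \<Rightarrow> real"
  shows "\<bar>(real_generator r ^^ n) f x\<bar> \<le> (\<Sum>x\<in>UNIV. \<Sum>y\<in>UNIV. 2 * \<bar>r x y\<bar>) ^ n * (\<Sum>x\<in>UNIV. \<bar>f x\<bar>)"
proof -
  define N where "N = (\<lambda>f::'x \<Rightarrow> real. \<Sum>x\<in>UNIV. \<bar>f x\<bar>)"
  define C where "C = (\<Sum>x\<in>UNIV. \<Sum>y\<in>UNIV. 2 * \<bar>r x y\<bar>)"
  have C0: "C \<ge> 0" unfolding C_def by (intro sum_nonneg) auto
  have le: "\<bar>f x\<bar> \<le> N f" for f x
    unfolding N_def by (rule member_le_sum) auto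
  have step: "N (real_generator r f) \<le> C * N f" for f
  proof -
    have "\<bar>real_generator r f x\<bar> \<le> (\<Sum>y\<in>UNIV. 2 * \<bar>r x y\<bar>) * N f" for x
    proof -
      have "\<bar>real_generator r f x\<bar> \<le> (\<Sum>y\<in>UNIV. \<bar>r x y * (f y - f x)\<bar>)"
        unfolding real_generator_def by (rule sum_abs)
      also have "\<dots> \<le> (\<Sum>y\<in>UNIV. \<bar>r x y\<bar> * (2 * N f))"
              proof (intro sum_mono)
          fix y
          have "\<bar>f y - f x\<bar> \<le> 2 * N f"
            using le[of f x] le[of f y] by linarith
          then show "\<bar>r x y * (f y - f x)\<bar> \<le> \<bar>r x y\<bar> * (2 * N f)"
            by (simp add: abs_mult mult_left_mono)
        qed
      finally show ?thesis by (simp add: sum_distrib_left mult_ac)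
    qed
    then have "N (real_generator r f) \<le> (\<Sum>x\<in>UNIV. (\<Sum>y\<in>UNIV. 2 * \<bar>r x y\<bar>) * N f)"
      unfolding N_def by (rule sum_mono)
    then show ?thesis unfolding C_def by (simp only: sum_distrib_right)
  qed
  have "N ((real_generator r ^^ n) f) \<le> C ^ n * N f"
  proof (induction n)
    case (Suc n)
    have "N ((real_generator r ^^ Suc n) f) \<le> C * N ((real_generator r ^^ n) f)"
      using step[of "(real_generator r ^^ n) f"] by simp
    also have "\<dots> \<le> C * (C ^ n * N f)"
      using Suc C0 by (rule mult_left_mono)
    finally show ?case by (simp add: mult.assoc)
  qed simp
  then show ?thesis using le[of "(real_generator r ^^ n) f" x] by (simp add: N_def C_def)
qed

lemma summable_real_exp_generator:
  "summable (\<lambda>n. (real_generator r ^^ n) f x / fact n * s ^ n)"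
proof -
  define C where "C = (\<Sum>x\<in>UNIV. \<Sum>y\<in>UNIV. 2 * \<bar>r x y\<bar>)"
  define N where "N = (\<Sum>x\<in>UNIV. \<bar>f x\<bar>)"
  show ?thesis
  proof (rule summable_comparison_test')
    show "summable (\<lambda>n. N * (inverse (fact n) * (C * \<bar>s\<bar>) ^ n))"
      by (intro summable_mult summable_exp)
    fix n
    have "\<bar>(real_generator r ^^ n) f x\<bar> * \<bar>s\<bar> ^ n \<le> C ^ n * N * \<bar>s\<bar> ^ n"
      using real_generator_power_bound[of n r f x] by (intro mult_right_mono) (auto simp: C_def N_def)
    then show "norm ((real_generator r ^^ n) f x / fact n * s ^ n) \<le> N * (inverse (fact n) * (C * \<bar>s\<bar>) ^ n)"
      by (simp add: abs_mult power_abs power_mult_distrib field_simps)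
  qed
qed

lemma real_exp_generator_0 [simp]: "real_exp_generator r 0 f x = f x"
  using powser_zero[of "\<lambda>n. (real_generator r ^^ n) f x / fact n"]
  by (simp add: real_exp_generator_def)

text \<open>Differentiating the power series shifts its coefficients by one, and
  \<open>(n + 1) / (n + 1)! = 1 / n!\<close> leaves one more application of the generator. As a
  finite sum over states, the generator commutes with the series.\<close>

lemma DERIV_real_exp_generator:
  "((\<lambda>s. real_exp_generator r s f x) has_real_derivative
     real_generator r (real_exp_generator r s f) x) (at s)"
proof -
  have diffs: "diffs (\<lambda>n. (real_generator r ^^ n) f x / fact n) n =
      real_generator r ((real_generator r ^^ n) f) x / fact n" for n
    by (simp add: diffs_def del: of_nat_Suc)
  have "(\<lambda>n. \<Sum>y\<in>UNIV. r x y * ((real_generator r ^^ n) f y / fact n * s ^ n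
           - (real_generator r ^^ n) f x / fact n * s ^ n)) sums
        (\<Sum>y\<in>UNIV. r x y * (real_exp_generator r s f y - real_exp_generator r s f x))"
    unfolding real_exp_generator_def
    by (intro sums_sum sums_mult sums_diff summable_sums summable_real_exp_generator)
  moreover have "(\<Sum>y\<in>UNIV. r x y * ((real_generator r ^^ n) f y / fact n * s ^ n
           - (real_generator r ^^ n) f x / fact n * s ^ n)) =
         real_generator r ((real_generator r ^^ n) f) x / fact n * s ^ n" for n
    unfolding real_generator_def[of r "(real_generator r ^^ n) f"] sum_divide_distrib sum_distrib_right
    by (intro sum.cong) (simp_all add: algebra_simps diff_divide_distrib)
  ultimately have "(\<Sum>n. diffs (\<lambda>n. (real_generator r ^^ n) f x / fact n) n * s ^ n) =
      real_generator r (real_exp_generator r s f) x"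
    unfolding diffs real_generator_def[of r "real_exp_generator r s f"] by (simp add: sums_iff)
  moreover have "((\<lambda>s. real_exp_generator r s f x) has_real_derivative
      (\<Sum>n. diffs (\<lambda>n. (real_generator r ^^ n) f x / fact n) n * s ^ n)) (at s)"
    unfolding real_exp_generator_def
    by (rule termdiffs_strong_converges_everywhere[OF summable_real_exp_generator])
  ultimately show ?thesis by simp
qed

lemma continuous_real_exp_generator:
  "continuous_on S (\<lambda>s. real_exp_generator r s f x)"
  by (intro continuous_at_imp_continuous_on ballI DERIV_isCont[OF DERIV_real_exp_generator])

lemma exp_generator_of_real:
  "exp_generator r s (\<lambda>x. complex_of_real (v x)) x = of_real (real_exp_generator r s v x)"
proof -
  have gen: "(generator r ^^ n) (\<lambda>x. complex_of_real (v x)) = (\<lambda>x. of_real ((real_generator r ^^ n) v x))" for n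
    by (induction n) (auto simp: generator_def real_generator_def)
  have "(\<lambda>n. complex_of_real ((real_generator r ^^ n) v x / fact n * s ^ n)) sums
      of_real (real_exp_generator r s v x)"
    unfolding real_exp_generator_def
    by (intro sums_of_real summable_sums summable_real_exp_generator)
  then show ?thesis
    by (simp add: exp_generator_def gen sums_iff mult_ac)
qed

section \<open>Transition functions with bounded rates\<close>

lemma sum_pmf_UNIV [simp]: "(\<Sum>y\<in>UNIV. pmf p (y :: 'x::finite)) = 1"
  by (rule sum_pmf_eq_1) auto

lemma pmf_bind_finite: "pmf (bind_pmf p K) z = (\<Sum>y\<in>UNIV. pmf p (y :: 'x::finite) * pmf (K y) z)"
  by (subst pmf_bind, subst integral_measure_pmf[of UNIV]) auto

locale jump_kernel =
  fixes q :: "real \<Rightarrow> 'x::finite \<Rightarrow> 'x \<Rightarrow> real" and P :: "real \<Rightarrow> real \<Rightarrow> 'x \<Rightarrow> 'x pmf" and B :: real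
  assumes transition: "transition_function q P"
    and rate_measurable: "\<And>x y. (\<lambda>s. q s x y) \<in> borel_measurable borel"
    and rate_nonneg: "\<And>s x y. 0 \<le> q s x y"
    and rate_le: "\<And>s x y. q s x y \<le> B"
begin

text \<open>The integrand of the forward equation, gain minus loss of probability at
  \<open>y\<close>; it plays the part of the time derivative of
  \<open>pmf (P s u x) y\<close>.\<close>

definition flux :: "real \<Rightarrow> 'x \<Rightarrow> 'x \<Rightarrow> real \<Rightarrow> real" where
  "flux s x y u = (\<Sum>z\<in>UNIV. pmf (P s u x) z * q u z y) - pmf (P s u x) y * (\<Sum>z\<in>UNIV. q u y z)"

text \<open>The gain term of the flux is at most \<open>B\<close>, because transition probabilities
  sum to 1; the loss term is at most \<open>CARD('x) * B\<close>.\<close>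

definition lip :: real where "lip = (real CARD('x) + 1) * B"

lemma B_nonneg: "0 \<le> B"
  using rate_nonneg rate_le order_trans by blast

lemma lip_nonneg: "0 \<le> lip"
  unfolding lip_def using B_nonneg by simp

lemma flux_has_integral:
  assumes "0 \<le> s" "s \<le> t"
  shows "(flux s x y has_integral (pmf (P s t x) y - of_bool (x = y))) {s..t}"
  using transition assms unfolding transition_function_def flux_def by blast

lemma flux_bound: "\<bar>flux s x y u\<bar> \<le> lip"
proof -
  have "(\<Sum>z\<in>UNIV. pmf (P s u x) z * q u z y) \<le> (\<Sum>z\<in>UNIV. pmf (P s u x) z * B)"
    by (intro sum_mono mult_left_mono rate_le) simp
  then have "(\<Sum>z\<in>UNIV. pmf (P s u x) z * q u z y) \<le> B"
    by (simp flip: sum_distrib_right)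
  moreover have "0 \<le> (\<Sum>z\<in>UNIV. pmf (P s u x) z * q u z y)"
    by (intro sum_nonneg mult_nonneg_nonneg rate_nonneg) simp
  moreover have "(\<Sum>z\<in>UNIV. q u y z) \<le> real CARD('x) * B"
    using sum_mono[of UNIV "q u y" "\<lambda>_. B"] rate_le by simp
  then have "pmf (P s u x) y * (\<Sum>z\<in>UNIV. q u y z) \<le> 1 * (real CARD('x) * B)"
    by (intro mult_mono pmf_le_1 sum_nonneg rate_nonneg) auto
  moreover have "0 \<le> pmf (P s u x) y * (\<Sum>z\<in>UNIV. q u y z)"
    by (intro mult_nonneg_nonneg sum_nonneg rate_nonneg) auto
  moreover have "0 \<le> B" "0 \<le> real CARD('x) * B" using B_nonneg by auto
  ultimately show ?thesis
    unfolding flux_def lip_def distrib_right mult_1 by linarith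
qed

lemma pmf_P_refl: "0 \<le> s \<Longrightarrow> pmf (P s s x) y = of_bool (x = y)"
  using flux_has_integral[of s s x y] by (simp add: has_integral_refl has_integral_iff)

lemma flux_has_integral':
  assumes "0 \<le> s" "s \<le> t" "t \<le> t'"
  shows "(flux s x y has_integral (pmf (P s t' x) y - pmf (P s t x) y)) {t..t'}"
proof -
  have i: "flux s x y integrable_on {s..t'}"
    using flux_has_integral[of s t' x y] assms by (auto simp: integrable_on_def)
  have "integral {s..t} (flux s x y) + integral {t..t'} (flux s x y) = integral {s..t'} (flux s x y)"
    using assms by (intro Henstock_Kurzweil_Integration.integral_combine i) auto
  moreover have "flux s x y integrable_on {t..t'}"
    by (rule integrable_on_subinterval[OF i]) (use assms in auto)
  ultimately show ?thesis
    using integral_unique[OF flux_has_integral[of s t x y]]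
      integral_unique[OF flux_has_integral[of s t' x y]] assms
    by (simp add: has_integral_iff)
qed

lemma P_lipschitz:
  assumes "0 \<le> s" "s \<le> t" "t \<le> t'"
  shows "\<bar>pmf (P s t' x) y - pmf (P s t x) y\<bar> \<le> lip * (t' - t)"
  using has_integral_bound_real[OF lip_nonneg _ flux_has_integral'[OF assms], of "{}"]
    flux_bound assms by simp

lemma P_near_refl:
  assumes "0 \<le> s" "s \<le> t"
  shows "\<bar>pmf (P s t x) y - of_bool (x = y)\<bar> \<le> lip * (t - s)"
  using P_lipschitz[of s s t x y] assms by (simp add: pmf_P_refl)

lemma continuous_on_P:
  assumes "0 \<le> s"
  shows "continuous_on {s..} (\<lambda>u. pmf (P s u x) y)"
proof (rule continuous_on_iff[THEN iffD2], intro ballI allI impI)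
  fix u and e :: real
  assume u: "u \<in> {s..}" and e: "e > 0"
  show "\<exists>d>0. \<forall>u'\<in>{s..}. dist u' u < d \<longrightarrow> dist (pmf (P s u' x) y) (pmf (P s u x) y) < e"
  proof (intro exI[of _ "e / (lip + 1)"] conjI ballI impI)
    show "e / (lip + 1) > 0" using e lip_nonneg by simp
    fix u' assume u': "u' \<in> {s..}" "dist u' u < e / (lip + 1)"
    have "\<bar>pmf (P s u' x) y - pmf (P s u x) y\<bar> \<le> lip * \<bar>u' - u\<bar>"
      using P_lipschitz[of s u u' x y] P_lipschitz[of s u' u x y] assms u u'
      by (cases "u \<le> u'") (auto simp: abs_minus_commute)
    also have "\<dots> \<le> (lip + 1) * \<bar>u' - u\<bar>"
      by (intro mult_right_mono) auto
    also have "\<dots> < e"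
      using u'(2) lip_nonneg by (simp add: dist_real_def field_simps)
    finally show "dist (pmf (P s u' x) y) (pmf (P s u x) y) < e"
      by (simp add: dist_real_def)
  qed
qed

lemma rate_set_integrable: "set_integrable lborel {s..t} (\<lambda>u. q u x y)"
proof (rule set_integrable_bounded_Icc)
  show "set_borel_measurable borel {s..t} (\<lambda>u. q u x y)"
    unfolding set_borel_measurable_def using rate_measurable by measurable
  show "\<bar>q u x y\<bar> \<le> B" for u using rate_nonneg rate_le by simp
qed

text \<open>Up to an error of order \<open>t - s\<close> the chain still sits at \<open>x\<close>,
  so the flux into \<open>y\<close> is \<open>q u x y\<close> up to that order, and integration
  gains another factor \<open>t - s\<close>. The 2 counts the errors in the gain and in the loss
  term.\<close>

lemma P_small_time:
  assumes st: "0 \<le> s" "s \<le> t" and xy: "x \<noteq> y"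
  shows "\<bar>pmf (P s t x) y - (LINT u:{s..t}|lborel. q u x y)\<bar> \<le> 2 * real CARD('x) * lip * B * (t - s)\<^sup>2"
proof -
  define c where "c = real CARD('x) * (lip * (t - s) * B)"
  have c0: "c \<ge> 0" unfolding c_def using lip_nonneg B_nonneg st by simp
  have "((\<lambda>u. q u x y) has_integral (LINT u:{s..t}|lborel. q u x y)) {s..t}"
    using rate_set_integrable set_borel_integral_eq_integral
    by (metis has_integral_integrable_integral)
  then have i: "((\<lambda>u. flux s x y u - q u x y) has_integral
      (pmf (P s t x) y - of_bool (x = y) - (LINT u:{s..t}|lborel. q u x y))) {s..t}"
    by (intro has_integral_diff flux_has_integral st)
  have b: "\<bar>flux s x y u - q u x y\<bar> \<le> 2 * c" if u: "u \<in> {s..t}" for u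
  proof -
    have near: "\<bar>pmf (P s u x) z - of_bool (x = z)\<bar> \<le> lip * (t - s)" for z
    proof -
      have "\<bar>pmf (P s u x) z - of_bool (x = z)\<bar> \<le> lip * (u - s)"
        using P_near_refl[of s u x z] u st by simp
      also have "\<dots> \<le> lip * (t - s)"
        using u lip_nonneg by (intro mult_left_mono) auto
      finally show ?thesis .
    qed
    have "(\<Sum>z\<in>UNIV. of_bool (x = z) * q u z y) = q u x y"
      by (simp add: of_bool_def if_distrib[of "\<lambda>c. c * _"] cong: if_cong)
    then have "flux s x y u - q u x y =
        (\<Sum>z\<in>UNIV. (pmf (P s u x) z - of_bool (x = z)) * q u z y) - pmf (P s u x) y * (\<Sum>z\<in>UNIV. q u y z)"
      unfolding flux_def by (simp add: left_diff_distrib sum_subtractf)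
    moreover have "\<bar>\<Sum>z\<in>UNIV. (pmf (P s u x) z - of_bool (x = z)) * q u z y\<bar> \<le> c"
    proof -
      have "\<bar>\<Sum>z\<in>UNIV. (pmf (P s u x) z - of_bool (x = z)) * q u z y\<bar>
          \<le> (\<Sum>z\<in>(UNIV::'x set). lip * (t - s) * B)"
        unfolding abs_mult[symmetric]
      proof (intro order_trans[OF sum_abs] sum_mono)
        fix z
        have "\<bar>pmf (P s u x) z - of_bool (x = z)\<bar> * \<bar>q u z y\<bar> \<le> lip * (t - s) * B"
          using near rate_le rate_nonneg lip_nonneg st by (intro mult_mono) (simp_all del: of_bool_eq_iff)
        then show "\<bar>(pmf (P s u x) z - of_bool (x = z)) * q u z y\<bar> \<le> lip * (t - s) * B"
          by (simp add: abs_mult)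
      qed
      then show ?thesis by (simp add: c_def)
    qed
    moreover have "\<bar>pmf (P s u x) y * (\<Sum>z\<in>UNIV. q u y z)\<bar> \<le> c"
    proof -
      have "0 \<le> (\<Sum>z\<in>UNIV. q u y z)" "(\<Sum>z\<in>UNIV. q u y z) \<le> (\<Sum>z\<in>(UNIV::'x set). B)"
        by (intro sum_nonneg sum_mono rate_nonneg rate_le)+
      then have "pmf (P s u x) y * (\<Sum>z\<in>UNIV. q u y z) \<le> lip * (t - s) * (real CARD('x) * B)"
        using near[of y] xy lip_nonneg st by (intro mult_mono) auto
      with \<open>0 \<le> (\<Sum>z\<in>UNIV. q u y z)\<close> show ?thesis
        by (simp add: c_def abs_mult mult_ac)
    qed
    ultimately show ?thesis by linarith
  qed
  have "norm (pmf (P s t x) y - of_bool (x = y) - (LINT u:{s..t}|lborel. q u x y)) \<le> 2 * c * measure lborel {s..t}"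
    by (rule has_integral_bound_real[OF _ _ i, of _ "{}"]) (use c0 b in auto)
  then show ?thesis
    using xy st by (simp add: c_def power2_eq_square mult_ac)
qed

lemma P_compose:
  assumes "0 \<le> s" "s \<le> t" "t \<le> u"
  shows "pmf (P s u x) z = (\<Sum>y\<in>UNIV. pmf (P s t x) y * pmf (P t u y) z)"
proof -
  have "P s u x = bind_pmf (P s t x) (P t u)"
    using transition assms unfolding transition_function_def by blast
  then show ?thesis by (simp add: pmf_bind_finite)
qed

text \<open>The expectation of \<open>S u\<close> under \<open>P s u x\<close> runs from
  \<open>S s x\<close> at \<open>u = s\<close> to the expectation of \<open>v\<close> at
  \<open>u = t\<close>, since \<open>S t = v\<close>. Integration by parts gives its rate of change:
  the law contributes the generator of \<open>q u\<close>, the semigroup minus the generator of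
  \<open>r\<close>.\<close>

lemma duhamel:
  fixes r :: "'x \<Rightarrow> 'x \<Rightarrow> real" and v :: "'x \<Rightarrow> real"
  assumes st: "0 \<le> s" "s \<le> t"
  defines "S \<equiv> \<lambda>u. real_exp_generator r (t - u) v"
  shows "((\<lambda>u. \<Sum>y\<in>UNIV. pmf (P s u x) y * (real_generator (q u) (S u) y - real_generator r (S u) y))
           has_integral ((\<Sum>y\<in>UNIV. pmf (P s t x) y * v y) - S s x)) {s..t}"
proof -
  have "((\<lambda>u. \<Sum>y\<in>UNIV. flux s x y u * S u y + pmf (P s u x) y * (- real_generator r (S u) y))
      has_integral (\<Sum>y\<in>UNIV. pmf (P s t x) y * S t y - pmf (P s s x) y * S s y)) {s..t}"
  proof (intro has_integral_sum integration_by_parts_lipschitz st(2))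
    fix y u assume u: "u \<in> {s..t}"
    show "(flux s x y has_integral pmf (P s u x) y - pmf (P s s x) y) {s..u}"
      using flux_has_integral[of s u x y] u st by (simp add: pmf_P_refl)
    show "\<bar>flux s x y u\<bar> \<le> lip" by (rule flux_bound)
    have "((\<lambda>u. real_exp_generator r (t - u) v y) has_real_derivative
        real_generator r (real_exp_generator r (t - u) v) y * (- 1)) (at u within {s..t})"
      by (rule DERIV_chain2[OF DERIV_real_exp_generator]) (auto intro!: derivative_eq_intros)
    then show "((\<lambda>u. S u y) has_real_derivative - real_generator r (S u) y) (at u within {s..t})"
      by (simp add: S_def)
  next
    fix y
    have "continuous_on {s..t} (\<lambda>u. real_exp_generator r (t - u) v z)" for z
      by (rule continuous_on_compose2[OF continuous_real_exp_generator[of UNIV]])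
        (auto intro!: continuous_intros)
    then show "continuous_on {s..t} (\<lambda>u. - real_generator r (S u) y)"
      unfolding real_generator_def S_def by (intro continuous_intros)
  qed simp
  \<comment> \<open>Exchanging the two sums in the gain term moves the rates from the law to the
    test function, which turns the flux paired with \<open>S u\<close> into the generator of
    \<open>q u\<close>.\<close>
  moreover have "(\<Sum>y\<in>UNIV. flux s x y u * S u y + pmf (P s u x) y * (- real_generator r (S u) y)) =
      (\<Sum>y\<in>UNIV. pmf (P s u x) y * (real_generator (q u) (S u) y - real_generator r (S u) y))" for u
  proof -
    have "(\<Sum>y\<in>UNIV. (\<Sum>z\<in>UNIV. pmf (P s u x) z * q u z y) * S u y) =
        (\<Sum>y\<in>UNIV. \<Sum>z\<in>UNIV. pmf (P s u x) y * (q u y z * S u z))"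
      unfolding sum_distrib_right by (subst sum.swap) (simp add: mult_ac)
    then have "(\<Sum>y\<in>UNIV. flux s x y u * S u y) = (\<Sum>y\<in>UNIV. pmf (P s u x) y * real_generator (q u) (S u) y)"
      unfolding flux_def real_generator_def
      by (simp add: left_diff_distrib right_diff_distrib sum_subtractf sum_distrib_left sum_distrib_right mult_ac)
    then show ?thesis by (simp add: right_diff_distrib sum.distrib sum_subtractf sum_negf)
  qed
  moreover have "(\<Sum>y\<in>UNIV. pmf (P s t x) y * S t y - pmf (P s s x) y * S s y) =
      (\<Sum>y\<in>UNIV. pmf (P s t x) y * v y) - S s x"
    using st by (simp add: pmf_P_refl sum_subtractf S_def of_bool_def if_distrib[of "\<lambda>c. c * _"] cong: if_cong)
  ultimately show ?thesis by simp
qed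

end

section \<open>The unperturbed chain\<close>

lemma sum_UNIV_of_bool_left [simp]: "(\<Sum>y\<in>UNIV. of_bool (x = y) * f y) = (f (x :: 'x::finite) :: real)"
  by (simp add: of_bool_def if_distrib[of "\<lambda>c. c * _"] cong: if_cong)

lemma sum_UNIV_of_bool_right [simp]: "(\<Sum>y\<in>UNIV. f y * of_bool (y = x)) = (f (x :: 'x::finite) :: real)"
  by (simp add: of_bool_def if_distrib cong: if_cong)

locale stationary_chain =
  fixes r :: "'x::finite \<Rightarrow> 'x \<Rightarrow> real" and P0 :: "real \<Rightarrow> real \<Rightarrow> 'x \<Rightarrow> 'x pmf"
    and \<pi> :: "'x pmf" and T :: real
  assumes r_nonneg: "\<And>x y. r x y \<ge> 0"
    and r_irred: "irreducible_rates r"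
    and T_pos: "T > 0"
    and P0: "transition_function (\<lambda>s. r) P0"
    and \<pi>_inv: "\<And>t. t \<ge> 0 \<Longrightarrow> invariant_distribution (P0 0 t) \<pi>"
begin

definition R :: real where "R = (\<Sum>x\<in>UNIV. \<Sum>y\<in>UNIV. r x y)"

lemma r_le_R: "r x y \<le> R"
proof -
  have "r x y \<le> (\<Sum>y\<in>UNIV. r x y)" by (rule member_le_sum) (auto simp: r_nonneg)
  also have "\<dots> \<le> R" unfolding R_def
    by (rule member_le_sum) (auto simp: r_nonneg intro: sum_nonneg)
  finally show ?thesis .
qed

sublocale kernel0: jump_kernel "\<lambda>_. r" P0 R
  by unfold_locales (simp_all add: P0 r_nonneg r_le_R)

section \<open>The homogeneous kernel of the unperturbed chain and its positivity\<close>

definition Q :: "real \<Rightarrow> 'x \<Rightarrow> 'x \<Rightarrow> real" where "Q s x y = pmf (P0 0 s x) y"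

text \<open>When both sets of rates agree, the Duhamel integrand is identically zero. Hence the
  kernel is the exponential of the generator, and in particular homogeneous in time.\<close>

lemma P0_eq_exp:
  assumes "0 \<le> s" "s \<le> t"
  shows "(\<Sum>y\<in>UNIV. pmf (P0 s t x) y * v y) = real_exp_generator r (t - s) v x"
  using has_integral_unique[OF kernel0.duhamel[OF assms, of x r v]] by simp

lemma pmf_P0:
  assumes "0 \<le> s" "s \<le> t"
  shows "pmf (P0 s t x) y = Q (t - s) x y"
  using P0_eq_exp[of s t x "\<lambda>z. of_bool (z = y)"] P0_eq_exp[of 0 "t - s" x "\<lambda>z. of_bool (z = y)"] assms
  by (simp add: Q_def)

lemma sum_Q: "s \<ge> 0 \<Longrightarrow> (\<Sum>y\<in>UNIV. Q s x y * v y) = real_exp_generator r s v x"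
  using P0_eq_exp[of 0 s x v] by (simp add: Q_def)

lemma Q_nonneg [simp]: "Q s x y \<ge> 0" and Q_le_1: "Q s x y \<le> 1"
  and sum_Q_eq_1 [simp]: "(\<Sum>y\<in>UNIV. Q s x y) = 1"
  by (simp_all add: Q_def pmf_le_1)

lemma Q_0 [simp]: "Q 0 x y = of_bool (x = y)"
  by (simp add: Q_def kernel0.pmf_P_refl)

lemma Q_add: "s \<ge> 0 \<Longrightarrow> t \<ge> 0 \<Longrightarrow> Q (s + t) x z = (\<Sum>y\<in>UNIV. Q s x y * Q t y z)"
  using kernel0.P_compose[of 0 s "s + t" x z] by (simp add: pmf_P0)

lemma Q_add_ge: "s \<ge> 0 \<Longrightarrow> t \<ge> 0 \<Longrightarrow> Q s x y * Q t y z \<le> Q (s + t) x z"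
  unfolding Q_add by (rule member_le_sum) auto

lemma continuous_on_Q: "continuous_on {0..} (\<lambda>s. Q s x y)"
  unfolding Q_def by (rule kernel0.continuous_on_P) simp

text \<open>By the Lipschitz bound the chain is at its starting point after a short time
  \<open>s / n\<close> with positive probability; Chapman-Kolmogorov multiplies \<open>n\<close>
  such steps.\<close>

lemma Q_diag_pos: "s \<ge> 0 \<Longrightarrow> Q s x x > 0"
proof -
  assume s: "s \<ge> 0"
  obtain n :: nat where n: "real n > kernel0.lip * s" "n > 0"
    using reals_Archimedean2[of "max 0 (kernel0.lip * s)"] by auto
  have "\<bar>Q (s / n) x x - 1\<bar> \<le> kernel0.lip * (s / n)"
    using kernel0.P_near_refl[of 0 "s / n" x x] s by (simp add: Q_def)
  also have "\<dots> < 1" using n by (simp add: field_simps)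
  finally have pos: "Q (s / n) x x > 0" by linarith
  have "Q (real k * h) x x > 0" if "h \<ge> 0" "Q h x x > 0" for k h
  proof (induction k)
    case (Suc k)
    have "0 < Q (real k * h) x x * Q h x x"
      using Suc that by simp
    also have "\<dots> \<le> Q (real k * h + h) x x"
      using that by (intro Q_add_ge) auto
    finally show ?case by (simp add: distrib_right add_ac)
  qed simp
  from this[OF _ pos, of n] show "Q s x x > 0" using n s by simp
qed

text \<open>Induction along a chain of positive rates, half of the time being given to the earlier
  edges and half to the last one. The last edge is taken within a short time \<open>e\<close>, after
  which the chain returns to \<open>z\<close> with positive probability.\<close>

lemma Q_pos: "s > 0 \<Longrightarrow> Q s x y > 0"
proof -
  have "(\<lambda>a b. r a b > 0)\<^sup>*\<^sup>* x y"
    using r_irred by (simp add: irreducible_rates_def)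
  then have "\<forall>s>0. Q s x y > 0"
  proof (induction rule: rtranclp_induct)
    case base
    then show ?case by (simp add: Q_diag_pos)
  next
    case (step y z)
    have yz: "Q s y z > 0" if s: "s > 0" for s
    proof (cases "y = z")
      case True
      then show ?thesis using s by (simp add: Q_diag_pos)
    next
      case False
      define c where "c = 2 * real CARD('x) * kernel0.lip * R"
      have c: "c \<ge> 0"
        unfolding c_def using kernel0.lip_nonneg kernel0.B_nonneg by simp
      \<comment> \<open>\<open>e\<close> is so small that the quadratic error \<open>c * e^2\<close>
        of \<open>P_small_time\<close> stays below the leading term \<open>e * r y z\<close>; the
        summand 1 avoids division by zero when \<open>c = 0\<close>.\<close>
      define e where "e = min s (r y z / (2 * (c + 1)))"
      have e: "e > 0" "e \<le> s" "e \<le> r y z / (2 * (c + 1))"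
        using s step(2) c by (auto simp: e_def)
      then have "(c + 1) * e \<le> r y z / 2"
        using c by (simp add: field_simps)
      then have ce: "(c + 1) * e < r y z" using step(2) by simp
      have "(LINT u:{0..e}|lborel. r y z) = e * r y z"
        using e by (simp add: set_lebesgue_integral_def)
      then have "\<bar>Q e y z - e * r y z\<bar> \<le> c * e\<^sup>2"
        using kernel0.P_small_time[of 0 e y z] False e by (simp add: Q_def c_def)
      moreover have "c * e\<^sup>2 < e * r y z"
      proof -
        have "c * e\<^sup>2 \<le> e * ((c + 1) * e)"
          by (simp add: power2_eq_square algebra_simps)
        also have "\<dots> < e * r y z" using e ce by (intro mult_strict_left_mono)
        finally show ?thesis .
      qed
      ultimately have "Q e y z > 0" by linarith
      then have "0 < Q e y z * Q (s - e) z z"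
        using e by (simp add: Q_diag_pos)
      also have "\<dots> \<le> Q (e + (s - e)) y z"
        using e by (intro Q_add_ge) auto
      finally show ?thesis by simp
    qed
    show ?case
    proof (intro allI impI)
      fix s :: real assume s: "s > 0"
      then have "0 < Q (s / 2) x y * Q (s / 2) y z"
        using step(3) yz by simp
      also have "\<dots> \<le> Q (s / 2 + s / 2) x z"
        using s by (intro Q_add_ge) auto
      finally show "Q s x z > 0" by simp
    qed
  qed
  then show "s > 0 \<Longrightarrow> Q s x y > 0" by blast
qed

lemma \<pi>_Q: "s \<ge> 0 \<Longrightarrow> (\<Sum>x\<in>UNIV. pmf \<pi> x * Q s x y) = pmf \<pi> y"
  using \<pi>_inv[of s] by (simp add: invariant_distribution_def Q_def flip: pmf_bind_finite)

lemma \<pi>_pos: "pmf \<pi> x > 0"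
proof -
  obtain z where "pmf \<pi> z > 0"
    using set_pmf_not_empty[of \<pi>] by (auto simp: set_pmf_eq' )
  then have "0 < pmf \<pi> z * Q 1 z x" by (simp add: Q_pos)
  also have "\<dots> \<le> (\<Sum>z\<in>UNIV. pmf \<pi> z * Q 1 z x)"
    by (rule member_le_sum) auto
  finally show ?thesis by (simp add: \<pi>_Q)
qed

text \<open>Doeblin's argument: on mean-zero measures the minimal entry of \<open>Q T\<close> can be subtracted from
  the kernel.\<close>

lemma Q_T_contraction:
  obtains \<rho> where "0 < \<rho>" "\<rho> < 1"
    "\<And>\<mu>. (\<Sum>x\<in>UNIV. \<mu> x) = 0 \<Longrightarrow>
      (\<Sum>y\<in>UNIV. \<bar>\<Sum>x\<in>UNIV. \<mu> x * Q T x y\<bar>) \<le> \<rho> * (\<Sum>x\<in>UNIV. \<bar>\<mu> x\<bar>)"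
proof -
  define m where "m = Min (range (\<lambda>(x, y). Q T x y))"
  have m: "m \<le> Q T x y" for x y
    unfolding m_def by (rule Min_le) (auto intro: rev_image_eqI[of "(x, y)"])
  have "m \<in> range (\<lambda>(x, y). Q T x y)"
    unfolding m_def by (rule Min_in) auto
  then have m0: "m > 0" using Q_pos T_pos by auto
  \<comment> \<open>\<open>1 - CARD('x) * m\<close> can be 0, for instance on a single state. The
    lower bound 1/2 keeps \<open>\<rho>\<close> positive, as \<open>ln \<rho>\<close> and
    \<open>1 / \<rho>\<close> serve as decay rate and prefactor later.\<close>
  define \<rho> where "\<rho> = max (1/2) (1 - real CARD('x) * m)"
  show ?thesis
  proof
    show "0 < \<rho>" "\<rho> < 1" using m0 by (simp_all add: \<rho>_def)
    fix \<mu> :: "'x \<Rightarrow> real"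
    assume \<mu>: "(\<Sum>x\<in>UNIV. \<mu> x) = 0"
    have "\<bar>\<Sum>x\<in>UNIV. \<mu> x * Q T x y\<bar> \<le> (\<Sum>x\<in>UNIV. \<bar>\<mu> x\<bar> * (Q T x y - m))" for y
    proof -
      have "(\<Sum>x\<in>UNIV. \<mu> x * Q T x y) = (\<Sum>x\<in>UNIV. \<mu> x * (Q T x y - m))"
        using \<mu> by (simp add: right_diff_distrib sum_subtractf flip: sum_distrib_right)
      also have "\<bar>\<dots>\<bar> \<le> (\<Sum>x\<in>UNIV. \<bar>\<mu> x\<bar> * (Q T x y - m))"
        using m by (intro order_trans[OF sum_abs] sum_mono) (simp add: abs_mult)
      finally show ?thesis .
    qed
    then have "(\<Sum>y\<in>UNIV. \<bar>\<Sum>x\<in>UNIV. \<mu> x * Q T x y\<bar>)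
        \<le> (\<Sum>y\<in>UNIV. \<Sum>x\<in>UNIV. \<bar>\<mu> x\<bar> * (Q T x y - m))"
      by (rule sum_mono)
    also have "\<dots> = (\<Sum>x\<in>UNIV. \<bar>\<mu> x\<bar> * (1 - real CARD('x) * m))"
      by (subst sum.swap) (simp add: sum_subtractf flip: sum_distrib_left)
    also have "\<dots> \<le> (\<Sum>x\<in>UNIV. \<bar>\<mu> x\<bar> * \<rho>)"
      by (intro sum_mono mult_left_mono) (auto simp: \<rho>_def)
    finally show "(\<Sum>y\<in>UNIV. \<bar>\<Sum>x\<in>UNIV. \<mu> x * Q T x y\<bar>) \<le> \<rho> * (\<Sum>x\<in>UNIV. \<bar>\<mu> x\<bar>)"
      by (simp add: sum_distrib_left mult_ac)
  qed
qed

lemma Q_L1_contraction: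
  "s \<ge> 0 \<Longrightarrow> (\<Sum>y\<in>UNIV. \<bar>\<Sum>x\<in>UNIV. \<mu> x * Q s x y\<bar>) \<le> (\<Sum>x\<in>UNIV. \<bar>\<mu> x\<bar>)"
proof -
  have "(\<Sum>y\<in>UNIV. \<bar>\<Sum>x\<in>UNIV. \<mu> x * Q s x y\<bar>) \<le> (\<Sum>y\<in>UNIV. \<Sum>x\<in>UNIV. \<bar>\<mu> x\<bar> * Q s x y)"
    by (intro sum_mono order_trans[OF sum_abs]) (simp add: abs_mult)
  also have "\<dots> = (\<Sum>x\<in>UNIV. \<bar>\<mu> x\<bar>)"
    by (subst sum.swap) (simp flip: sum_distrib_left)
  finally show ?thesis .
qed

text \<open>The contraction is iterated over the whole periods in \<open>s\<close>, and over the
  remaining time the norm does not grow. The rate \<open>c\<close> is chosen with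
  \<open>\<rho>\<close> to the power \<open>s / T\<close> equal to \<open>exp (- c * s)\<close>; the
  prefactor \<open>1 / \<rho>\<close> pays for rounding \<open>s / T\<close> down.\<close>

lemma Q_decay:
  obtains A c where "0 < A" "0 < c"
    "\<And>\<mu> s. (\<Sum>x\<in>UNIV. \<mu> x) = 0 \<Longrightarrow> s \<ge> 0 \<Longrightarrow>
      (\<Sum>y\<in>UNIV. \<bar>\<Sum>x\<in>UNIV. \<mu> x * Q s x y\<bar>) \<le> A * exp (- c * s) * (\<Sum>x\<in>UNIV. \<bar>\<mu> x\<bar>)"
proof -
  obtain \<rho> where \<rho>: "0 < \<rho>" "\<rho> < 1"
    "\<And>\<mu>. (\<Sum>x\<in>UNIV. \<mu> x) = 0 \<Longrightarrow>
      (\<Sum>y\<in>UNIV. \<bar>\<Sum>x\<in>UNIV. \<mu> x * Q T x y\<bar>) \<le> \<rho> * (\<Sum>x\<in>UNIV. \<bar>\<mu> x\<bar>)"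
    using Q_T_contraction by blast
  have comp: "(\<Sum>x\<in>UNIV. (\<Sum>z\<in>UNIV. \<mu> z * Q s z x) * Q t x y) = (\<Sum>x\<in>UNIV. \<mu> x * Q (s + t) x y)"
    if "s \<ge> 0" "t \<ge> 0" for \<mu> s t y
    unfolding Q_add[OF that] sum_distrib_left sum_distrib_right
    by (subst sum.swap) (simp add: mult_ac)
  have mass: "(\<Sum>y\<in>UNIV. \<Sum>x\<in>UNIV. \<mu> x * Q s x y) = (\<Sum>x\<in>UNIV. \<mu> x)" for \<mu> s
    by (subst sum.swap) (simp flip: sum_distrib_left)
  have iter: "(\<Sum>y\<in>UNIV. \<bar>\<Sum>x\<in>UNIV. \<mu> x * Q (real n * T) x y\<bar>) \<le> \<rho> ^ n * (\<Sum>x\<in>UNIV. \<bar>\<mu> x\<bar>)"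
    if \<mu>: "(\<Sum>x\<in>UNIV. \<mu> x) = 0" for n \<mu>
  proof (induction n)
    case (Suc n)
    have "(\<Sum>y\<in>UNIV. \<bar>\<Sum>x\<in>UNIV. \<mu> x * Q (real (Suc n) * T) x y\<bar>)
      = (\<Sum>y\<in>UNIV. \<bar>\<Sum>x\<in>UNIV. (\<Sum>z\<in>UNIV. \<mu> z * Q (real n * T) z x) * Q T x y\<bar>)"
      using T_pos by (simp add: comp distrib_right add_ac)
    also have "\<dots> \<le> \<rho> * (\<Sum>x\<in>UNIV. \<bar>\<Sum>z\<in>UNIV. \<mu> z * Q (real n * T) z x\<bar>)"
      by (rule \<rho>(3)) (simp add: mass \<mu>)
    also have "\<dots> \<le> \<rho> * (\<rho> ^ n * (\<Sum>x\<in>UNIV. \<bar>\<mu> x\<bar>))"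
      using \<rho> Suc by (intro mult_left_mono) auto
    finally show ?case by (simp add: mult.assoc)
  qed simp
  define c where "c = - ln \<rho> / T"
  show ?thesis
  proof
    show "0 < 1 / \<rho>" "0 < c" using \<rho> T_pos by (simp_all add: c_def divide_neg_pos)
    fix \<mu> :: "'x \<Rightarrow> real" and s :: real
    assume \<mu>: "(\<Sum>x\<in>UNIV. \<mu> x) = 0" and s: "s \<ge> 0"
    define n where "n = nat \<lfloor>s / T\<rfloor>"
    have "real n = of_int \<lfloor>s / T\<rfloor>"
      using s T_pos by (simp add: n_def)
    then have n: "real n \<le> s / T" "s / T < real n + 1" by linarith+
    then have nT: "real n * T \<le> s" using T_pos by (simp add: field_simps)
    have "(\<Sum>y\<in>UNIV. \<bar>\<Sum>x\<in>UNIV. \<mu> x * Q s x y\<bar>) =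
        (\<Sum>y\<in>UNIV. \<bar>\<Sum>x\<in>UNIV. (\<Sum>z\<in>UNIV. \<mu> z * Q (real n * T) z x) * Q (s - real n * T) x y\<bar>)"
      using nT T_pos by (simp add: comp)
    also have "\<dots> \<le> (\<Sum>x\<in>UNIV. \<bar>\<Sum>z\<in>UNIV. \<mu> z * Q (real n * T) z x\<bar>)"
      using nT by (intro Q_L1_contraction) simp
    also have "\<dots> \<le> \<rho> ^ n * (\<Sum>x\<in>UNIV. \<bar>\<mu> x\<bar>)"
      by (rule iter[OF \<mu>])
    also have "\<dots> \<le> 1 / \<rho> * exp (- c * s) * (\<Sum>x\<in>UNIV. \<bar>\<mu> x\<bar>)"
    proof (intro mult_right_mono sum_nonneg)
      have "\<rho> ^ n = exp (real n * ln \<rho>)"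
        using \<rho>(1) by (simp add: exp_of_nat_mult)
      also have "\<dots> \<le> exp ((s / T - 1) * ln \<rho>)"
        using n \<rho> by (simp add: mult_right_mono_neg)
      also have "(s / T - 1) * ln \<rho> = - c * s - ln \<rho>"
        by (simp add: c_def algebra_simps)
      also have "exp (- c * s - ln \<rho>) = 1 / \<rho> * exp (- c * s)"
        using \<rho>(1) by (simp add: exp_diff)
      finally show "\<rho> ^ n \<le> 1 / \<rho> * exp (- c * s)" .
    qed auto
    finally show "(\<Sum>y\<in>UNIV. \<bar>\<Sum>x\<in>UNIV. \<mu> x * Q s x y\<bar>) \<le> 1 / \<rho> * exp (- c * s) * (\<Sum>x\<in>UNIV. \<bar>\<mu> x\<bar>)" .
  qed
qed

end

section \<open>Linear response of the oscillatory steady state\<close>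

text \<open>The adjoint of the generator with rates \<open>m\<close>, applied to \<mu>. Both
  arguments may be signed: \<mu> is also taken as a difference of laws and \<open>m\<close> as a
  difference of rates.\<close>

definition net_flow :: "('x::finite \<Rightarrow> real) \<Rightarrow> ('x \<Rightarrow> 'x \<Rightarrow> real) \<Rightarrow> 'x \<Rightarrow> real" where
  "net_flow \<mu> m z = (\<Sum>x\<in>UNIV. \<mu> x * m x z) - \<mu> z * (\<Sum>x\<in>UNIV. m z x)"

lemma sum_net_flow_mult:
  "(\<Sum>z\<in>UNIV. net_flow \<mu> m z * v z) = (\<Sum>x\<in>UNIV. \<mu> x * real_generator m v x)"
proof -
  have "(\<Sum>z\<in>UNIV. (\<Sum>x\<in>UNIV. \<mu> x * m x z) * v z) = (\<Sum>x\<in>UNIV. \<Sum>z\<in>UNIV. \<mu> x * (m x z * v z))"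
    unfolding sum_distrib_right by (subst sum.swap) (simp add: mult_ac)
  then show ?thesis
    unfolding net_flow_def real_generator_def
    by (simp add: left_diff_distrib right_diff_distrib sum_subtractf sum_distrib_left sum_distrib_right mult_ac)
qed

text \<open>Conservation of mass; it makes the source mean-zero, so that \<open>Q_decay\<close>
  applies to it.\<close>

lemma sum_net_flow [simp]: "(\<Sum>z\<in>UNIV. net_flow \<mu> m z) = 0"
  using sum_net_flow_mult[of \<mu> m "\<lambda>_. 1"] by (simp add: real_generator_def)

lemma net_flow_bound:
  fixes \<mu> :: "'x::finite \<Rightarrow> real"
  assumes "\<And>x y. \<bar>m x y\<bar> \<le> C"
  shows "(\<Sum>z\<in>UNIV. \<bar>net_flow \<mu> m z\<bar>) \<le> 2 * real CARD('x) * C * (\<Sum>x\<in>UNIV. \<bar>\<mu> x\<bar>)"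
proof -
  have "\<bar>net_flow \<mu> m z\<bar> \<le> C * (\<Sum>x\<in>UNIV. \<bar>\<mu> x\<bar>) + \<bar>\<mu> z\<bar> * (real CARD('x) * C)" for z
  proof -
    have "\<bar>\<Sum>x\<in>UNIV. \<mu> x * m x z\<bar> \<le> (\<Sum>x\<in>UNIV. \<bar>\<mu> x\<bar> * C)"
      using assms by (intro order_trans[OF sum_abs] sum_mono) (simp add: abs_mult mult_left_mono)
    moreover have "\<bar>\<Sum>x\<in>UNIV. m z x\<bar> \<le> (\<Sum>x\<in>(UNIV::'x set). C)"
      using assms by (intro order_trans[OF sum_abs] sum_mono)
    then have "\<bar>\<mu> z * (\<Sum>x\<in>UNIV. m z x)\<bar> \<le> \<bar>\<mu> z\<bar> * (real CARD('x) * C)"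
      unfolding abs_mult by (intro mult_left_mono) simp_all
    ultimately show ?thesis
      unfolding net_flow_def by (simp add: sum_distrib_left mult_ac abs_le_iff)
  qed
  then have "(\<Sum>z\<in>UNIV. \<bar>net_flow \<mu> m z\<bar>) \<le>
      (\<Sum>z\<in>UNIV. C * (\<Sum>x\<in>UNIV. \<bar>\<mu> x\<bar>) + \<bar>\<mu> z\<bar> * (real CARD('x) * C))"
    by (rule sum_mono)
  also have "\<dots> = 2 * real CARD('x) * C * (\<Sum>x\<in>UNIV. \<bar>\<mu> x\<bar>)"
    by (simp add: sum.distrib flip: sum_distrib_right)
  finally show ?thesis .
qed

text \<open>Bilinearity, arranged so that both terms on the right are of order \<open>l^2\<close>
  once \<open>m - l * d\<close> is of order \<open>l^2\<close> and \<open>p - \<mu>\<close> is of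
  order \<open>l\<close>.\<close>

lemma net_flow_expand:
  "net_flow p m z - l * net_flow \<mu> d z =
     net_flow p (\<lambda>x y. m x y - l * d x y) z + l * net_flow (\<lambda>x. p x - \<mu> x) d z"
  unfolding net_flow_def
  by (simp add: algebra_simps sum_subtractf sum_distrib_left)

section \<open>A priori bound for periodic solutions of the integral equation\<close>

context stationary_chain begin

text \<open>Mild form of the unperturbed forward equation with source \<open>m\<close>, which asks
  for no differentiability of \<eta>. The horizon \<open>T'\<close> is separate from the period
  \<open>T\<close>, since the bound is wanted on arbitrary bounded time intervals.\<close>

definition periodic_solution :: "real \<Rightarrow> (real \<Rightarrow> 'x \<Rightarrow> real) \<Rightarrow> (real \<Rightarrow> 'x \<Rightarrow> real) \<Rightarrow> bool" where
  "periodic_solution T' \<eta> m \<longleftrightarrow>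
     (\<forall>t\<in>{0..T'}. \<forall>y. ((\<lambda>u. \<Sum>z\<in>UNIV. m u z * Q (t - u) z y) has_integral
        (\<eta> t y - (\<Sum>x\<in>UNIV. \<eta> 0 x * Q t x y))) {0..t}) \<and>
     (\<forall>y. \<eta> T y = \<eta> 0 y) \<and> (\<Sum>x\<in>UNIV. \<eta> 0 x) = 0"

text \<open>Since \<open>\<eta> T = \<eta> 0\<close>, the integral equation at \<open>t = T\<close> gives
  \<open>\<parallel>\<eta> 0\<parallel> \<le> \<rho> * \<parallel>\<eta> 0\<parallel> + O(K)\<close> with the contraction constant \<open>\<rho> < 1\<close>.\<close>

lemma periodic_solution_bound:
  assumes T': "T \<le> T'"
  obtains C where "C \<ge> 0"
    "\<And>\<eta> m K t y. periodic_solution T' \<eta> m \<Longrightarrow> (\<And>u. u \<in> {0..T'} \<Longrightarrow> (\<Sum>z\<in>UNIV. \<bar>m u z\<bar>) \<le> K) \<Longrightarrow>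
      t \<in> {0..T'} \<Longrightarrow> \<bar>\<eta> t y\<bar> \<le> C * K"
proof -
  obtain \<rho> where \<rho>: "0 < \<rho>" "\<rho> < 1"
    "\<And>\<mu>. (\<Sum>x\<in>UNIV. \<mu> x) = 0 \<Longrightarrow>
      (\<Sum>y\<in>UNIV. \<bar>\<Sum>x\<in>UNIV. \<mu> x * Q T x y\<bar>) \<le> \<rho> * (\<Sum>x\<in>UNIV. \<bar>\<mu> x\<bar>)"
    using Q_T_contraction by blast
  \<comment> \<open>The first summand is the bound on the initial value, obtained by solving
    \<open>E \<le> CARD('x) * K * T + \<rho> * E\<close> for \<open>E\<close>; the second bounds the
    integral of the source up to the horizon.\<close>
  define C where "C = real CARD('x) * T / (1 - \<rho>) + T'"
  show ?thesis
  proof (rule that[of C])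
    show "C \<ge> 0" unfolding C_def using \<rho> T_pos T' by (auto intro!: add_nonneg_nonneg divide_nonneg_nonneg)
    fix \<eta> m :: "real \<Rightarrow> 'x \<Rightarrow> real" and K t y
    assume sol: "periodic_solution T' \<eta> m"
      and K: "\<And>u. u \<in> {0..T'} \<Longrightarrow> (\<Sum>z\<in>UNIV. \<bar>m u z\<bar>) \<le> K" and t: "t \<in> {0..T'}"
    have I: "((\<lambda>u. \<Sum>z\<in>UNIV. m u z * Q (t - u) z y) has_integral
        (\<eta> t y - (\<Sum>x\<in>UNIV. \<eta> 0 x * Q t x y))) {0..t}" if "t \<in> {0..T'}" for t y
      using sol that unfolding periodic_solution_def by blast
    have per: "\<eta> T y = \<eta> 0 y" for y using sol by (simp add: periodic_solution_def)
    have mean: "(\<Sum>x\<in>UNIV. \<eta> 0 x) = 0" using sol by (simp add: periodic_solution_def)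
    have K0: "K \<ge> 0"
      using K[of 0] T_pos T' by (auto intro: order_trans[OF sum_nonneg])
    have b: "\<bar>\<eta> t y - (\<Sum>x\<in>UNIV. \<eta> 0 x * Q t x y)\<bar> \<le> K * t" if t: "t \<in> {0..T'}" for t y
    proof -
      have "norm (\<eta> t y - (\<Sum>x\<in>UNIV. \<eta> 0 x * Q t x y)) \<le> K * measure lborel {0..t}"
      proof (rule has_integral_bound_real[OF K0 _ I[OF t], of "{}"])
        fix u assume u: "u \<in> {0..t} - {}"
        have "\<bar>\<Sum>z\<in>UNIV. m u z * Q (t - u) z y\<bar> \<le> (\<Sum>z\<in>UNIV. \<bar>m u z\<bar> * 1)"
          by (intro order_trans[OF sum_abs] sum_mono) (simp add: abs_mult mult_left_le Q_le_1)
        also have "\<dots> \<le> K" using K[of u] u t by simp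
        finally show "norm (\<Sum>z\<in>UNIV. m u z * Q (t - u) z y) \<le> K" by simp
      qed simp
      then show ?thesis using t by simp
    qed
    define E where "E = (\<Sum>x\<in>UNIV. \<bar>\<eta> 0 x\<bar>)"
    have "E \<le> (\<Sum>y\<in>UNIV. K * T + \<bar>\<Sum>x\<in>UNIV. \<eta> 0 x * Q T x y\<bar>)"
      unfolding E_def
    proof (rule sum_mono)
      fix y
      show "\<bar>\<eta> 0 y\<bar> \<le> K * T + \<bar>\<Sum>x\<in>UNIV. \<eta> 0 x * Q T x y\<bar>"
        using b[of T y] T_pos T' per[of y] by simp
    qed
    also have "\<dots> \<le> real CARD('x) * (K * T) + \<rho> * E"
      using \<rho>(3)[OF mean] by (simp add: sum.distrib E_def)
    finally have E: "E \<le> real CARD('x) * T / (1 - \<rho>) * K"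
      using \<rho> by (simp add: field_simps)
    have "\<bar>\<Sum>x\<in>UNIV. \<eta> 0 x * Q t x y\<bar> \<le> E"
      unfolding E_def by (intro order_trans[OF sum_abs] sum_mono) (simp add: abs_mult mult_left_le Q_le_1)
    moreover have "K * t \<le> K * T'" using t K0 by (intro mult_left_mono) auto
    ultimately show "\<bar>\<eta> t y\<bar> \<le> C * K"
      using b[OF t, of y] E unfolding C_def distrib_right by (simp add: mult.commute)
  qed
qed

end

section \<open>The perturbed chain, its source and its response\<close>

locale perturbed_chain = stationary_chain r P0 \<pi> T
  for r :: "'x::finite \<Rightarrow> 'x \<Rightarrow> real" and P0 \<pi> T +
  fixes g :: "real \<Rightarrow> 'x \<Rightarrow> 'x \<Rightarrow> real" and G :: real
    and P :: "real \<Rightarrow> real \<Rightarrow> real \<Rightarrow> 'x \<Rightarrow> 'x pmf" and \<pi>l :: "real \<Rightarrow> 'x pmf"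
  assumes g_le: "\<And>s x y. \<bar>g s x y\<bar> \<le> G"
    and g_measurable: "\<And>x y. (\<lambda>s. g s x y) \<in> borel_measurable borel"
    and g_periodic: "\<And>s x y. g (s + T) x y = g s x y"
    and P: "\<And>l. transition_function (perturbed_rates r g l) (P l)"
    and \<pi>l_inv: "\<And>l. invariant_distribution (P l 0 T) (\<pi>l l)"
begin

lemma G_nonneg: "G \<ge> 0"
  using order_trans[OF abs_ge_zero g_le] .

sublocale kernel: jump_kernel "perturbed_rates r g l" "P l" "exp (\<bar>l\<bar> * G) * R" for l
proof
  show "transition_function (perturbed_rates r g l) (P l)" by (rule P)
  fix s x y
  show "(\<lambda>s. perturbed_rates r g l s x y) \<in> borel_measurable borel"
    unfolding perturbed_rates_def using g_measurable by measurable
  show "0 \<le> perturbed_rates r g l s x y"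
    unfolding perturbed_rates_def using r_nonneg by simp
  have "\<bar>l * g s x y\<bar> \<le> \<bar>l\<bar> * G"
    unfolding abs_mult by (intro mult_left_mono g_le) simp
  then have "l * g s x y \<le> \<bar>l\<bar> * G"
    by linarith
  then show "perturbed_rates r g l s x y \<le> exp (\<bar>l\<bar> * G) * R"
    unfolding perturbed_rates_def using r_nonneg r_le_R by (intro mult_mono) auto
qed

definition law :: "real \<Rightarrow> real \<Rightarrow> 'x pmf" where "law l t = bind_pmf (\<pi>l l) (P l 0 t)"

lemma pmf_law: "pmf (law l t) y = (\<Sum>x\<in>UNIV. pmf (\<pi>l l) x * pmf (P l 0 t x) y)"
  by (simp add: law_def pmf_bind_finite)

lemma pmf_law_0: "pmf (law l 0) y = pmf (\<pi>l l) y"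
  by (simp add: pmf_law kernel.pmf_P_refl)

lemma law_T: "law l T = law l 0"
proof -
  have "law l T = \<pi>l l"
    using \<pi>l_inv[of l] by (simp add: invariant_distribution_def law_def)
  then show ?thesis by (intro pmf_eqI) (simp add: pmf_law_0)
qed

text \<open>Duhamel's formula for the indicator of \<open>y\<close>, averaged over
  \<open>\<pi>l l\<close>. Passing from the difference of generators to the adjoint net flow makes
  it an equation for the law itself.\<close>

lemma law_duhamel:
  assumes t: "t \<ge> 0"
  shows "((\<lambda>u. \<Sum>z\<in>UNIV. net_flow (pmf (law l u)) (\<lambda>x y. perturbed_rates r g l u x y - r x y) z * Q (t - u) z y)
    has_integral (pmf (law l t) y - (\<Sum>x\<in>UNIV. pmf (law l 0) x * Q t x y))) {0..t}"
proof -
  define v where "v = (\<lambda>z. of_bool (z = y) :: real)"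
  define S where "S = (\<lambda>u. real_exp_generator r (t - u) v)"
  have S: "S u x = Q (t - u) x y" if "u \<le> t" for u x
    using sum_Q[of "t - u" x v] that by (simp add: S_def v_def)
  have "((\<lambda>u. \<Sum>x\<in>UNIV. pmf (\<pi>l l) x * (\<Sum>y\<in>UNIV. pmf (P l 0 u x) y *
         (real_generator (perturbed_rates r g l u) (S u) y - real_generator r (S u) y))) has_integral
       (\<Sum>x\<in>UNIV. pmf (\<pi>l l) x * ((\<Sum>y\<in>UNIV. pmf (P l 0 t x) y * v y) - S 0 x))) {0..t}"
    unfolding S_def
    by (intro has_integral_sum has_integral_mult_right kernel.duhamel) (use t in auto)
  also have "(\<Sum>x\<in>UNIV. pmf (\<pi>l l) x * ((\<Sum>y\<in>UNIV. pmf (P l 0 t x) y * v y) - S 0 x)) =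
      pmf (law l t) y - (\<Sum>x\<in>UNIV. pmf (law l 0) x * Q t x y)"
    using t by (simp add: v_def S pmf_law_0 pmf_law[of l t] right_diff_distrib sum_subtractf)
  finally show ?thesis
  proof (rule has_integral_eq[rotated])
    fix u assume u: "u \<in> {0..t}"
    have "(\<Sum>z\<in>UNIV. net_flow (pmf (law l u)) (\<lambda>x y. perturbed_rates r g l u x y - r x y) z * Q (t - u) z y)
      = (\<Sum>z\<in>UNIV. pmf (law l u) z * real_generator (\<lambda>x y. perturbed_rates r g l u x y - r x y) (S u) z)"
      using u by (subst sum_net_flow_mult[symmetric]) (simp add: S)
    also have "\<dots> = (\<Sum>z\<in>UNIV. pmf (law l u) z *
        (real_generator (perturbed_rates r g l u) (S u) z - real_generator r (S u) z))"
      by (simp add: real_generator_def left_diff_distrib sum_subtractf)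
    also have "\<dots> = (\<Sum>x\<in>UNIV. pmf (\<pi>l l) x * (\<Sum>y\<in>UNIV. pmf (P l 0 u x) y *
         (real_generator (perturbed_rates r g l u) (S u) y - real_generator r (S u) y)))"
      unfolding pmf_law sum_distrib_right sum_distrib_left by (subst sum.swap) (simp add: mult_ac)
    finally show "(\<Sum>x\<in>UNIV. pmf (\<pi>l l) x * (\<Sum>y\<in>UNIV. pmf (P l 0 u x) y *
         (real_generator (perturbed_rates r g l u) (S u) y - real_generator r (S u) y))) =
      (\<Sum>z\<in>UNIV. net_flow (pmf (law l u)) (\<lambda>x y. perturbed_rates r g l u x y - r x y) z * Q (t - u) z y)"
      by simp
  qed
qed

text \<open>The coefficient of \<open>l\<close> in the net flow out of \<pi>: to first order,
  \<open>perturbed_rates r g l\<close> minus \<open>r\<close> is \<open>l * r * g\<close>.\<close>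

definition source :: "real \<Rightarrow> 'x \<Rightarrow> real" where
  "source u = net_flow (pmf \<pi>) (\<lambda>x y. r x y * g u x y)"

text \<open>The weight \<open>pmf \<pi> x\<close> cancels the denominator of
  \<open>reversed_rates\<close>, and what is left of the reversed term is the inflow into
  \<open>x\<close>.\<close>

lemma source_eq_psi: "source u x = pmf \<pi> x * psi r \<pi> g u x"
proof -
  have "pmf \<pi> x * (reversed_rates r \<pi> x y * g u y x - r x y * g u x y) =
      pmf \<pi> y * (r y x * g u y x) - pmf \<pi> x * (r x y * g u x y)" for y
    using \<pi>_pos[of x] by (simp add: reversed_rates_def right_diff_distrib)
  then show ?thesis
    unfolding source_def net_flow_def psi_def sum_distrib_left sum_subtractf[symmetric] by simp
qed

lemma sum_source [simp]: "(\<Sum>z\<in>UNIV. source u z) = 0"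
  by (simp add: source_def)

lemma rg_le: "\<bar>r x y * g u x y\<bar> \<le> R * G"
  using r_nonneg r_le_R g_le kernel0.B_nonneg unfolding abs_mult by (intro mult_mono) auto

lemma sum_abs_source_le: "(\<Sum>z\<in>UNIV. \<bar>source u z\<bar>) \<le> 2 * real CARD('x) * (R * G)"
  using net_flow_bound[of "\<lambda>x y. r x y * g u x y" "R * G" "pmf \<pi>"] rg_le
  by (simp add: source_def)

lemma source_periodic: "source (u + T) z = source u z"
  by (simp add: source_def g_periodic)

lemma source_measurable [measurable]: "(\<lambda>u. source u z) \<in> borel_measurable borel"
  unfolding source_def net_flow_def using g_measurable by measurable

text \<open>\<open>s\<close> is the age of a contribution: what the source emitted at time
  \<open>t - s\<close> has been transported by \<open>Q s\<close>. Integrating over the infinite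
  past instead of starting at time 0 builds in periodicity, as no initial value has to be
  chosen.\<close>

definition response :: "real \<Rightarrow> 'x \<Rightarrow> real" where
  "response t y = (LINT s:{0..}|lborel. (\<Sum>x\<in>UNIV. source (t - s) x * Q s x y))"

text \<open>At negative times \<open>Q\<close> carries no information, hence the cut-off.\<close>

lemma Q_measurable [measurable]: "(\<lambda>s. indicat_real {0..} s * Q s x y) \<in> borel_measurable borel"
  using borel_measurable_continuous_on_indicator[OF _ continuous_on_Q[of x y]] by simp

lemma response_integrand_measurable [measurable]:
  "(\<lambda>(t, s). indicat_real {0..} s *\<^sub>R (\<Sum>x\<in>UNIV. source (t - s) x * Q s x y))
     \<in> borel_measurable (borel \<Otimes>\<^sub>M borel)"
proof -
  have "(\<lambda>(t, s). \<Sum>x\<in>UNIV. source (t - s) x * (indicat_real {0..} s * Q s x y))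
      \<in> borel_measurable (borel \<Otimes>\<^sub>M borel)"
    by measurable
  then show ?thesis by (simp add: sum_distrib_left mult_ac split_beta')
qed

text \<open>The source is mean-zero with an \<open>l1\<close> norm bounded uniformly in time, so
  \<open>Q_decay\<close> gives constants that do not depend on \<open>t\<close>.\<close>

lemma response_integrand_bound:
  obtains A c where "0 < A" "0 < c"
    "\<And>t s y. s \<ge> 0 \<Longrightarrow> \<bar>\<Sum>x\<in>UNIV. source (t - s) x * Q s x y\<bar> \<le> A * exp (- c * s)"
proof -
  obtain A c where Ac: "0 < A" "0 < c"
    "\<And>\<mu> s. (\<Sum>x\<in>UNIV. \<mu> x) = 0 \<Longrightarrow> s \<ge> 0 \<Longrightarrow>
      (\<Sum>y\<in>UNIV. \<bar>\<Sum>x\<in>UNIV. \<mu> x * Q s x y\<bar>) \<le> A * exp (- c * s) * (\<Sum>x\<in>UNIV. \<bar>\<mu> x\<bar>)"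
    using Q_decay by blast
  define W where "W = 2 * real CARD('x) * (R * G) + 1"
  have "R * G \<ge> 0" using kernel0.B_nonneg G_nonneg by simp
  then have "W > 0" unfolding W_def by (intro add_nonneg_pos) auto
  show ?thesis
  proof (rule that[of "A * W" c])
    show "0 < A * W" "0 < c" using Ac \<open>W > 0\<close> by auto
    fix t s :: real and y
    assume s: "s \<ge> 0"
    have "\<bar>\<Sum>x\<in>UNIV. source (t - s) x * Q s x y\<bar> \<le>
        (\<Sum>y\<in>UNIV. \<bar>\<Sum>x\<in>UNIV. source (t - s) x * Q s x y\<bar>)"
      by (rule member_le_sum) auto
    also have "\<dots> \<le> A * exp (- c * s) * (\<Sum>x\<in>UNIV. \<bar>source (t - s) x\<bar>)"
      by (intro Ac(3) s) simp
    also have "\<dots> \<le> A * exp (- c * s) * W"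
      using sum_abs_source_le[of "t - s"] Ac by (intro mult_left_mono) (auto simp: W_def)
    finally show "\<bar>\<Sum>x\<in>UNIV. source (t - s) x * Q s x y\<bar> \<le> A * W * exp (- c * s)"
      by (simp add: mult_ac)
  qed
qed

lemma response_integrable:
  "set_integrable lborel {0..} (\<lambda>s. \<Sum>x\<in>UNIV. source (t - s) x * Q s x y)"
proof -
  obtain A c where Ac: "0 < A" "0 < c"
    "\<And>t s y. s \<ge> 0 \<Longrightarrow> \<bar>\<Sum>x\<in>UNIV. source (t - s) x * Q s x y\<bar> \<le> A * exp (- c * s)"
    using response_integrand_bound by metis
  show ?thesis
    unfolding set_integrable_def
  proof (rule Bochner_Integration.integrable_bound[OF set_integrable_exp_minus[OF Ac(2), of A, unfolded set_integrable_def]])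
    show "(\<lambda>s. indicat_real {0..} s *\<^sub>R (\<Sum>x\<in>UNIV. source (t - s) x * Q s x y)) \<in> borel_measurable lborel"
      using measurable_compose[OF measurable_Pair1'[of t borel borel] response_integrand_measurable[of y]]
      by simp
    show "AE s in lborel. norm (indicat_real {0..} s *\<^sub>R (\<Sum>x\<in>UNIV. source (t - s) x * Q s x y))
        \<le> norm (indicat_real {0..} s *\<^sub>R (A * exp (- c * s)))"
      using Ac by (intro AE_I2) (auto simp: indicator_def intro: order_trans[OF _ abs_ge_self])
  qed
qed

lemma response_measurable [measurable]: "(\<lambda>t. response t y) \<in> borel_measurable borel"
  unfolding response_def set_lebesgue_integral_def
  by (rule sigma_finite_measure.borel_measurable_lebesgue_integral[OF sigma_finite_lborel])
    (use response_integrand_measurable in simp)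

lemma response_bounded: obtains C where "\<And>t y. \<bar>response t y\<bar> \<le> C"
proof -
  obtain A c where Ac: "0 < A" "0 < c"
    "\<And>t s y. s \<ge> 0 \<Longrightarrow> \<bar>\<Sum>x\<in>UNIV. source (t - s) x * Q s x y\<bar> \<le> A * exp (- c * s)"
    using response_integrand_bound by metis
  have "norm (response t y) \<le> (LINT s:{0..}|lborel. A * exp (- c * s))" for t y
    unfolding response_def set_lebesgue_integral_def
    by (rule Bochner_Integration.integral_norm_bound_integral)
      (use response_integrable[of t y] set_integrable_exp_minus[OF Ac(2), of A] Ac in
        \<open>auto simp: set_integrable_def indicator_def\<close>)
  then show ?thesis using that by auto
qed

lemma response_T: "response T y = response 0 y"
  using source_periodic[of "- _"] by (simp add: response_def)

lemma sum_response: "(\<Sum>y\<in>UNIV. response t y) = 0"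
proof -
  have "(\<Sum>y\<in>UNIV. response t y) = (LINT s:{0..}|lborel. (\<Sum>y\<in>UNIV. \<Sum>x\<in>UNIV. source (t - s) x * Q s x y))"
    unfolding response_def
    using set_integral_sum_mult[of UNIV lborel "{0..}" "\<lambda>y s. \<Sum>x\<in>UNIV. source (t - s) x * Q s x y" "\<lambda>_. 1"]
      response_integrable by simp
  also have "\<dots> = 0"
    by (subst sum.swap) (simp flip: sum_distrib_left)
  finally show ?thesis .
qed

text \<open>The integral over ages is split at \<open>s = t\<close>. Ages beyond \<open>t\<close>
  belong to sources emitted before time 0 and add up to \<open>response 0\<close> transported by
  \<open>Q t\<close>; for ages up to \<open>t\<close> the reflection \<open>u = t - s\<close> gives
  the integral on the left.\<close>

lemma response_duhamel:
  assumes t: "t \<ge> 0"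
  shows "((\<lambda>u. \<Sum>z\<in>UNIV. source u z * Q (t - u) z y) has_integral
    (response t y - (\<Sum>x\<in>UNIV. response 0 x * Q t x y))) {0..t}"
proof -
  define k where "k = (\<lambda>s. \<Sum>x\<in>UNIV. source (t - s) x * Q s x y)"
  define f where "f = (\<lambda>u. \<Sum>z\<in>UNIV. source u z * Q (t - u) z y)"
  have k: "set_integrable lborel {0..} k"
    unfolding k_def by (rule response_integrable)
  have k1: "set_integrable lborel {0..t} k" and k2: "set_integrable lborel {t..} k"
    by (rule set_integrable_subset[OF k]; use t in auto)+
  have "(LINT s:{t..}|lborel. k s) = (LINT s|lborel. indicator {t..} (t + 1 * s) *\<^sub>R k (t + 1 * s))"
    unfolding set_lebesgue_integral_def by (subst lborel_integral_real_affine[of 1 _ t]) auto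
  also have "\<dots> = (LINT s:{0..}|lborel. \<Sum>x\<in>UNIV. (\<Sum>z\<in>UNIV. source (0 - s) z * Q s z x) * Q t x y)"
    unfolding set_lebesgue_integral_def
  proof (intro Bochner_Integration.integral_cong refl)
    fix s :: real
    have "k (t + s) = (\<Sum>x\<in>UNIV. (\<Sum>z\<in>UNIV. source (0 - s) z * Q s z x) * Q t x y)" if "s \<ge> 0"
      unfolding k_def add.commute[of t s] Q_add[OF that t] sum_distrib_left sum_distrib_right
      by (subst sum.swap) (simp add: mult_ac)
    then show "indicator {t..} (t + 1 * s) *\<^sub>R k (t + 1 * s) =
      indicator {0..} s *\<^sub>R (\<Sum>x\<in>UNIV. (\<Sum>z\<in>UNIV. source (0 - s) z * Q s z x) * Q t x y)"
      by (auto simp: indicator_def)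
  qed
  also have "\<dots> = (\<Sum>x\<in>UNIV. response 0 x * Q t x y)"
    unfolding response_def by (rule set_integral_sum_mult) (rule response_integrable)
  finally have tail: "(LINT s:{t..}|lborel. k s) = (\<Sum>x\<in>UNIV. response 0 x * Q t x y)" .
  have refl_int: "set_integrable lborel {0..t} f \<and> (LINT s:{0..t}|lborel. k s) = (LINT u:{0..t}|lborel. f u)"
  proof -
    have eq: "indicator {0..t} (t + (- 1) * u) *\<^sub>R k (t + (- 1) * u) = indicator {0..t} u *\<^sub>R f u" for u
      using t by (auto simp: indicator_def k_def f_def)
    have "set_integrable lborel {0..t} f"
      using lborel_integrable_real_affine[OF k1[unfolded set_integrable_def], of "- 1" t]
      unfolding eq by (simp add: set_integrable_def)
    moreover have "(LINT s:{0..t}|lborel. k s) = (LINT u:{0..t}|lborel. f u)"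
      unfolding set_lebesgue_integral_def
      by (subst lborel_integral_real_affine[of "- 1" _ t]) (simp_all only: eq, simp_all)
    ultimately show ?thesis by simp
  qed
  have "response t y = (LINT s:{0..t} \<union> {t..}|lborel. k s)"
    unfolding response_def k_def using t by (intro arg_cong2[where f = "\<lambda>A. set_lebesgue_integral lborel A"]) auto
  also have "\<dots> = (LINT s:{0..t}|lborel. k s) + (LINT s:{t..}|lborel. k s)"
  proof (rule set_integral_Un_AE[OF _ _ _ k1 k2])
    show "AE s in lborel. \<not> (s \<in> {0..t} \<and> s \<in> {t..})"
      using AE_lborel_singleton[of t] by eventually_elim auto
  qed auto
  finally have "(LINT u:{0..t}|lborel. f u) = response t y - (\<Sum>x\<in>UNIV. response 0 x * Q t x y)"
    using tail refl_int by simp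
  with refl_int show ?thesis
    using set_borel_integral_eq_integral[of "{0..t}" f] by (simp add: has_integral_iff f_def)
qed

lemma law_expansion:
  obtains e C where "e > 0"
    "\<And>l t y. \<bar>l\<bar> \<le> e \<Longrightarrow> t \<in> {0..t1} \<Longrightarrow> \<bar>pmf (law l t) y - pmf \<pi> y - l * response t y\<bar> \<le> C * l\<^sup>2"
proof -
  define N where "N = real CARD('x)"
  \<comment> \<open>The a priori bound needs a horizon that contains a full period, even when
    \<open>t1 < T\<close>.\<close>
  define T' where "T' = max T t1"
  obtain C where C: "C \<ge> 0"
    "\<And>\<eta> m K t y. periodic_solution T' \<eta> m \<Longrightarrow> (\<And>u. u \<in> {0..T'} \<Longrightarrow> (\<Sum>z\<in>UNIV. \<bar>m u z\<bar>) \<le> K) \<Longrightarrow>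
      t \<in> {0..T'} \<Longrightarrow> \<bar>\<eta> t y\<bar> \<le> C * K"
  proof (rule periodic_solution_bound[of T'])
    show "T \<le> T'" by (simp add: T'_def)
  qed blast
  \<comment> \<open>For \<open>l\<close> in this range \<open>l * g\<close> stays within
    \<open>[-1, 1]\<close>, where the quadratic estimate of the exponential holds.\<close>
  define e where "e = 1 / (G + 1)"
  have e: "e > 0" using G_nonneg by (simp add: e_def)
  have small: "\<bar>l * g u x y\<bar> \<le> \<bar>l\<bar> * G \<and> \<bar>l * g u x y\<bar> \<le> 1" if "\<bar>l\<bar> \<le> e" for l u x y
  proof -
    have a: "\<bar>l * g u x y\<bar> \<le> \<bar>l\<bar> * G"
      unfolding abs_mult by (intro mult_left_mono g_le) simp
    also have "\<bar>l\<bar> * G \<le> e * G" using that G_nonneg by (rule mult_right_mono)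
    also have "\<dots> \<le> 1" using G_nonneg by (simp add: e_def)
    finally show ?thesis using a by simp
  qed
  define q where "q = perturbed_rates r g"
  have q2: "\<bar>q l u x y - r x y - l * (r x y * g u x y)\<bar> \<le> R * G\<^sup>2 * l\<^sup>2" if "\<bar>l\<bar> \<le> e" for l u x y
  proof -
    have "q l u x y - r x y - l * (r x y * g u x y) = r x y * (exp (l * g u x y) - 1 - l * g u x y)"
      by (simp add: q_def perturbed_rates_def algebra_simps)
    also have "\<bar>\<dots>\<bar> \<le> R * (l * g u x y)\<^sup>2"
      unfolding abs_mult using small[OF that, of u x y] r_nonneg r_le_R kernel0.B_nonneg
      by (intro mult_mono abs_exp_minus_one_minus_le) auto
    also have "\<dots> \<le> R * (\<bar>l\<bar> * G)\<^sup>2"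
      using small[OF that, of u x y] kernel0.B_nonneg
      by (intro mult_left_mono) (auto simp: abs_le_square_iff[symmetric])
    finally show ?thesis by (simp add: power_mult_distrib mult_ac)
  qed
  have q1: "\<bar>q l u x y - r x y\<bar> \<le> 2 * R * G * \<bar>l\<bar>" if l: "\<bar>l\<bar> \<le> e" for l u x y
  proof -
    define a where "a = l * g u x y"
    have a: "\<bar>a\<bar> \<le> \<bar>l\<bar> * G" "\<bar>a\<bar> \<le> 1" using small[OF l] by (auto simp: a_def)
    have "a\<^sup>2 \<le> \<bar>a\<bar>"
      using a(2) mult_left_le[of "\<bar>a\<bar>" "\<bar>a\<bar>"] by (simp add: power2_eq_square flip: abs_mult)
    then have "\<bar>exp a - 1\<bar> \<le> 2 * \<bar>l\<bar> * G"
      using abs_exp_minus_one_minus_le[OF a(2)] a(1) by linarith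
    then have "r x y * \<bar>exp a - 1\<bar> \<le> R * (2 * \<bar>l\<bar> * G)"
      using r_nonneg r_le_R kernel0.B_nonneg by (intro mult_mono) auto
    moreover have "q l u x y - r x y = r x y * (exp a - 1)"
      by (simp add: q_def perturbed_rates_def a_def algebra_simps)
    ultimately show ?thesis using r_nonneg by (simp add: abs_mult mult_ac)
  qed
  define C1 where "C1 = C * (4 * N * R * G)"
  \<comment> \<open>Since \<pi> is invariant under \<open>Q\<close>, subtracting it preserves the
    integral equation and makes the initial value mean-zero. The source contains the unknown law,
    but only as a probability vector of norm 1, so it is of order \<open>l\<close> without prior
    knowledge.\<close>
  have first: "\<bar>pmf (law l t) y - pmf \<pi> y\<bar> \<le> C1 * \<bar>l\<bar>" if l: "\<bar>l\<bar> \<le> e" and t: "t \<in> {0..T'}" for l t y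
  proof -
    have "\<bar>pmf (law l t) y - pmf \<pi> y\<bar> \<le> C * (2 * N * (2 * R * G * \<bar>l\<bar>))"
    proof (rule C(2)[OF _ _ t, where m = "\<lambda>u. net_flow (pmf (law l u)) (\<lambda>x y. q l u x y - r x y)"],
        unfold periodic_solution_def, intro conjI ballI allI)
      fix t y assume t: "t \<in> {0..T'}"
      have "pmf (law l t) y - (\<Sum>x\<in>UNIV. pmf (law l 0) x * Q t x y) =
        pmf (law l t) y - pmf \<pi> y - (\<Sum>x\<in>UNIV. (pmf (law l 0) x - pmf \<pi> x) * Q t x y)"
        using t by (simp add: left_diff_distrib sum_subtractf \<pi>_Q)
      then show "((\<lambda>u. \<Sum>z\<in>UNIV. net_flow (pmf (law l u)) (\<lambda>x y. q l u x y - r x y) z * Q (t - u) z y) has_integral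
        (pmf (law l t) y - pmf \<pi> y - (\<Sum>x\<in>UNIV. (pmf (law l 0) x - pmf \<pi> x) * Q t x y))) {0..t}"
        using law_duhamel[of t l y] t by (simp only: q_def) simp
    next
      fix u
      show "(\<Sum>z\<in>UNIV. \<bar>net_flow (pmf (law l u)) (\<lambda>x y. q l u x y - r x y) z\<bar>) \<le> 2 * N * (2 * R * G * \<bar>l\<bar>)"
        using net_flow_bound[OF q1[OF l, of u], of "pmf (law l u)"] by (simp add: N_def)
    qed (simp_all add: law_T sum_subtractf)
    then show ?thesis by (simp add: C1_def mult_ac)
  qed
  have "C1 \<ge> 0" unfolding C1_def N_def using C(1) G_nonneg kernel0.B_nonneg by simp
  \<comment> \<open>Two contributions to the source that is left: the second-order error of the
    rates against the actual law, and the first-order rates against the deviation of the law from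
    \<pi>, which is at most \<open>C1 * \<bar>l\<bar>\<close> at each of the \<open>N\<close>
    states.\<close>
  define C2 where "C2 = C * (2 * N * (R * G\<^sup>2) + 2 * N * (R * G) * (N * C1))"
  have second: "\<bar>pmf (law l t) y - pmf \<pi> y - l * response t y\<bar> \<le> C2 * l\<^sup>2"
    if l: "\<bar>l\<bar> \<le> e" and t: "t \<in> {0..T'}" for l t y
  proof -
    define m where "m = (\<lambda>u z. net_flow (pmf (law l u)) (\<lambda>x y. q l u x y - r x y) z - l * source u z)"
    have "\<bar>pmf (law l t) y - pmf \<pi> y - l * response t y\<bar> \<le>
        C * ((2 * N * (R * G\<^sup>2) + 2 * N * (R * G) * (N * C1)) * l\<^sup>2)"
    proof (rule C(2)[OF _ _ t, where m = m], unfold periodic_solution_def, intro conjI ballI allI)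
      fix t y assume t: "t \<in> {0..T'}"
      have e1: "pmf (law l t) y - (\<Sum>x\<in>UNIV. pmf (law l 0) x * Q t x y) -
          l * (response t y - (\<Sum>x\<in>UNIV. response 0 x * Q t x y)) =
        pmf (law l t) y - pmf \<pi> y - l * response t y -
          (\<Sum>x\<in>UNIV. (pmf (law l 0) x - pmf \<pi> x - l * response 0 x) * Q t x y)"
        using t by (simp add: left_diff_distrib right_diff_distrib sum_subtractf \<pi>_Q sum_distrib_left mult_ac)
      have hi: "((\<lambda>u. (\<Sum>z\<in>UNIV. net_flow (pmf (law l u)) (\<lambda>x y. q l u x y - r x y) z * Q (t - u) z y) -
          l * (\<Sum>z\<in>UNIV. source u z * Q (t - u) z y)) has_integral
        (pmf (law l t) y - (\<Sum>x\<in>UNIV. pmf (law l 0) x * Q t x y) -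
          l * (response t y - (\<Sum>x\<in>UNIV. response 0 x * Q t x y)))) {0..t}"
        unfolding q_def
        by (intro has_integral_diff has_integral_mult_right law_duhamel response_duhamel) (use t in auto)
      have e2: "(\<Sum>z\<in>UNIV. m u z * Q (t - u) z y) =
          (\<Sum>z\<in>UNIV. net_flow (pmf (law l u)) (\<lambda>x y. q l u x y - r x y) z * Q (t - u) z y) -
          l * (\<Sum>z\<in>UNIV. source u z * Q (t - u) z y)" for u
        by (simp add: m_def left_diff_distrib sum_subtractf sum_distrib_left mult.assoc)
      show "((\<lambda>u. \<Sum>z\<in>UNIV. m u z * Q (t - u) z y) has_integral
        (pmf (law l t) y - pmf \<pi> y - l * response t y -
          (\<Sum>x\<in>UNIV. (pmf (law l 0) x - pmf \<pi> x - l * response 0 x) * Q t x y))) {0..t}"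
        unfolding e2 e1[symmetric] by (rule hi)
    next
      show "pmf (law l T) y - pmf \<pi> y - l * response T y = pmf (law l 0) y - pmf \<pi> y - l * response 0 y" for y
        by (simp add: law_T response_T)
      show "(\<Sum>x\<in>UNIV. pmf (law l 0) x - pmf \<pi> x - l * response 0 x) = 0"
        by (simp add: sum_subtractf sum_response flip: sum_distrib_left)
    next
      fix u assume u: "u \<in> {0..T'}"
      define A where "A = net_flow (pmf (law l u)) (\<lambda>x y. q l u x y - r x y - l * (r x y * g u x y))"
      define D where "D = net_flow (\<lambda>x. pmf (law l u) x - pmf \<pi> x) (\<lambda>x y. r x y * g u x y)"
      have "m u z = A z + l * D z" for z
        unfolding m_def source_def net_flow_expand A_def D_def ..
      then have "(\<Sum>z\<in>UNIV. \<bar>m u z\<bar>) \<le> (\<Sum>z\<in>UNIV. \<bar>A z\<bar> + \<bar>l\<bar> * \<bar>D z\<bar>)"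
        by (intro sum_mono) (simp add: abs_mult[symmetric])
      also have "\<dots> = (\<Sum>z\<in>UNIV. \<bar>A z\<bar>) + \<bar>l\<bar> * (\<Sum>z\<in>UNIV. \<bar>D z\<bar>)"
        by (simp add: sum.distrib sum_distrib_left)
      also have "\<dots> \<le> 2 * N * (R * G\<^sup>2 * l\<^sup>2) + \<bar>l\<bar> * (2 * N * (R * G) * (N * C1 * \<bar>l\<bar>))"
      proof (intro add_mono mult_left_mono)
        show "(\<Sum>z\<in>UNIV. \<bar>A z\<bar>) \<le> 2 * N * (R * G\<^sup>2 * l\<^sup>2)"
          unfolding A_def using net_flow_bound[OF q2[OF l, of u], of "pmf (law l u)"] by (simp add: N_def)
        have "(\<Sum>z\<in>UNIV. \<bar>D z\<bar>) \<le> 2 * N * (R * G) * (\<Sum>x\<in>UNIV. \<bar>pmf (law l u) x - pmf \<pi> x\<bar>)"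
          unfolding D_def N_def by (rule net_flow_bound) (rule rg_le)
        also have "\<dots> \<le> 2 * N * (R * G) * (\<Sum>x\<in>(UNIV::'x set). C1 * \<bar>l\<bar>)"
          using kernel0.B_nonneg G_nonneg
          by (intro mult_left_mono sum_mono first l u) (auto simp: N_def)
        finally show "(\<Sum>z\<in>UNIV. \<bar>D z\<bar>) \<le> 2 * N * (R * G) * (N * C1 * \<bar>l\<bar>)"
          by (simp add: N_def mult_ac)
      qed simp
      also have "\<dots> = (2 * N * (R * G\<^sup>2) + 2 * N * (R * G) * (N * C1)) * l\<^sup>2"
      proof -
        have l2: "l\<^sup>2 = \<bar>l\<bar> * \<bar>l\<bar>" by (simp add: power2_eq_square)
        show ?thesis unfolding l2 by (simp add: algebra_simps del: abs_mult_self_eq)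
      qed
      finally show "(\<Sum>z\<in>UNIV. \<bar>m u z\<bar>) \<le> (2 * N * (R * G\<^sup>2) + 2 * N * (R * G) * (N * C1)) * l\<^sup>2" .
    qed
    then show ?thesis by (simp add: C2_def mult_ac)
  qed
  show ?thesis
  proof (rule that[of e C2])
    fix l t y assume l: "\<bar>l\<bar> \<le> e" and "t \<in> {0..t1}"
    then have t: "t \<in> {0..T'}" by (simp add: T'_def le_max_iff_disj)
    show "\<bar>pmf (law l t) y - pmf \<pi> y - l * response t y\<bar> \<le> C2 * l\<^sup>2"
      by (rule second[OF l t])
  qed (rule e)
qed

end

section \<open>Jump counts of cadlag paths\<close>

lemma cadlag_right_nbhd:
  assumes "cadlag_path w" "0 \<le> s"
  obtains b where "s < b" "\<And>u. s < u \<Longrightarrow> u < b \<Longrightarrow> w u = w s"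
  using assms unfolding cadlag_path_def eventually_at_right_field by blast

lemma cadlag_left_nbhd:
  assumes "cadlag_path w" "0 < s"
  obtains a where "a < s" "\<And>u. a < u \<Longrightarrow> u < s \<Longrightarrow> w u = left_lim w s"
proof -
  obtain x where x: "\<forall>\<^sub>F u in at_left s. w u = x"
    using assms unfolding cadlag_path_def by blast
  then have "left_lim w s = x" by (rule left_lim_eqI)
  with x obtain a where "a < s" "\<forall>u>a. u < s \<longrightarrow> w u = left_lim w s"
    unfolding eventually_at_left_field by auto
  then show ?thesis by (intro that[of a]) auto
qed

text \<open>The indicator of \<open>w u = w c\<close> is continuous wherever there is no jump and
  has only the values 0 and 1, so it is constant on the connected interval.\<close>

lemma cadlag_no_jump:
  assumes w: "cadlag_path w" and c: "0 \<le> c" "c \<le> d"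
    and nj: "\<And>s. c < s \<Longrightarrow> s \<le> d \<Longrightarrow> left_lim w s = w s"
  shows "w d = w c"
proof -
  define f where "f = (\<lambda>u. of_bool (w u = w c) :: real)"
  have "continuous_on {c..d} f"
    unfolding continuous_on_eq_continuous_within
  proof
    fix u assume u: "u \<in> {c..d}"
    obtain b where b: "u < b" "\<And>v. u < v \<Longrightarrow> v < b \<Longrightarrow> w v = w u"
      using cadlag_right_nbhd[OF w, of u] u c by auto
    \<comment> \<open>At \<open>u = c\<close> no point of the interval lies to the left, so a jump
      at \<open>c\<close> itself does no harm.\<close>
    obtain a where a: "a < u" "\<And>v. a < v \<Longrightarrow> v < u \<Longrightarrow> c \<le> v \<Longrightarrow> w v = w u"
    proof (cases "u = c")
      case True
      then show ?thesis by (intro that[of "c - 1"]) auto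
    next
      case False
      with u c have "u > 0" "c < u" by auto
      obtain a where "a < u" "\<And>v. a < v \<Longrightarrow> v < u \<Longrightarrow> w v = left_lim w u"
        by (rule cadlag_left_nbhd[OF w \<open>u > 0\<close>]) blast
      moreover have "left_lim w u = w u" using \<open>c < u\<close> u by (intro nj) auto
      ultimately show ?thesis by (intro that[of a]) simp_all
    qed
    have "\<forall>\<^sub>F v in at u within {c..d}. f v = f u"
      unfolding eventually_at_topological
    proof (intro exI[of _ "{a<..<b}"] conjI ballI impI)
      fix v assume "v \<in> {a<..<b}" "v \<noteq> u" "v \<in> {c..d}"
      then show "f v = f u" using a(2)[of v] b(2)[of v] by (cases "v < u") (auto simp: f_def)
    qed (use a b in auto)
    then show "continuous (at u within {c..d}) f"
      unfolding continuous_within by (rule tendsto_eventually)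
  qed
  moreover have "finite (f ` {c..d})"
    by (rule finite_subset[of _ "{0, 1}"]) (auto simp: f_def)
  ultimately have "f constant_on {c..d}"
    by (intro continuous_finite_range_constant) auto
  then have "f d = f c" using c by (auto simp: constant_on_def)
  then show ?thesis by (auto simp: f_def of_bool_def split: if_splits)
qed

lemma finite_jumps_Ioc:
  assumes "cadlag_path w" "0 \<le> c"
  shows "finite {s. c < s \<and> s \<le> d \<and> left_lim w s \<noteq> w s}"
  by (rule finite_subset[OF _ finite_jump_times[OF assms(1), of d]])
    (use assms(2) in \<open>auto simp: jump_times_def\<close>)

lemma cadlag_one_jump:
  assumes w: "cadlag_path w" and c: "0 \<le> c"
    and s: "{s. c < s \<and> s \<le> d \<and> left_lim w s \<noteq> w s} = {s}"
  shows "w c = left_lim w s" "w d = w s"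
proof -
  have s': "c < s" "s \<le> d" using s by auto
  have only: "u = s" if "c < u" "u \<le> d" "left_lim w u \<noteq> w u" for u
    using s that by auto
  have const: "w u = w c" if "c \<le> u" "u < s" for u
  proof (rule cadlag_no_jump[OF w c that(1)])
    fix v assume "c < v" "v \<le> u"
    then show "left_lim w v = w v" using only[of v] that(2) s'(2) by linarith
  qed
  have "\<forall>\<^sub>F u in at_left s. w u = w c"
    unfolding eventually_at_left_field
    by (intro exI[of _ c] conjI allI impI const s') simp_all
  then show "w c = left_lim w s" by (rule left_lim_eqI[symmetric])
  show "w d = w s"
  proof (rule cadlag_no_jump[OF w])
    fix v assume "s < v" "v \<le> d"
    then show "left_lim w v = w v" using only[of v] s'(1) by linarith
  qed (use c s' in auto)
qed

lemma jump_count_le: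
  assumes w: "cadlag_path w" and c: "0 \<le> c" "c \<le> d" and A: "\<And>x. (x, x) \<notin> A"
  shows "of_bool ((w c, w d) \<in> A) \<le> card {s. c < s \<and> s \<le> d \<and> left_lim w s \<noteq> w s}"
proof (cases "{s. c < s \<and> s \<le> d \<and> left_lim w s \<noteq> w s} = {}")
  case True
  have "w d = w c" by (rule cadlag_no_jump[OF w c]) (use True in auto)
  then show ?thesis using A by simp
next
  case False
  then have "card {s. c < s \<and> s \<le> d \<and> left_lim w s \<noteq> w s} \<ge> 1"
    using finite_jumps_Ioc[OF w c(1), of d] by (simp add: Suc_le_eq card_gt_0_iff)
  then show ?thesis by simp
qed

text \<open>With a single jump the values at the two ends are the left limit and the value at that
  jump; without one they agree, and \<open>A\<close> avoids the diagonal.\<close>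

lemma jump_count_eq:
  assumes w: "cadlag_path w" and c: "0 \<le> c" "c \<le> d" and A: "\<And>x. (x, x) \<notin> A"
    and one: "card {s. c < s \<and> s \<le> d \<and> left_lim w s \<noteq> w s} \<le> 1"
  shows "of_bool ((w c, w d) \<in> A) = card {s. c < s \<and> s \<le> d \<and> (left_lim w s, w s) \<in> A}"
proof -
  let ?J = "{s. c < s \<and> s \<le> d \<and> left_lim w s \<noteq> w s}"
  have sub: "{s. c < s \<and> s \<le> d \<and> (left_lim w s, w s) \<in> A} \<subseteq> ?J"
    using A by auto
  show ?thesis
  proof (cases "?J = {}")
    case True
    have "w d = w c" by (rule cadlag_no_jump[OF w c]) (use True in auto)
    moreover have "{s. c < s \<and> s \<le> d \<and> (left_lim w s, w s) \<in> A} = {}" using True sub by auto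
    ultimately show ?thesis using A by (simp only: of_bool_eq card.empty)
  next
    case False
    then have "card ?J = 1"
      using one finite_jumps_Ioc[OF w c(1), of d] by (metis card_0_eq le_neq_implies_less less_one)
    then obtain s where s: "?J = {s}" by (auto simp: card_1_singleton_iff)
    have "{s. c < s \<and> s \<le> d \<and> (left_lim w s, w s) \<in> A} = (if (left_lim w s, w s) \<in> A then {s} else {})"
      using s sub by auto
    then show ?thesis using cadlag_one_jump[OF w c(1) s] by simp
  qed
qed

lemma card_Ioc_partition:
  fixes t :: "nat \<Rightarrow> real"
  assumes t: "\<And>k. t k \<le> t (Suc k)" and fin: "finite {s. t 0 < s \<and> s \<le> t m \<and> Q s}"
  shows "card {s. t 0 < s \<and> s \<le> t m \<and> Q s} = (\<Sum>k<m. card {s. t k < s \<and> s \<le> t (Suc k) \<and> Q s})"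
  using fin
proof (induction m)
  case (Suc m)
  have le: "t 0 \<le> t m" using lift_Suc_mono_le[of t, OF t] by simp
  have eq: "{s. t 0 < s \<and> s \<le> t (Suc m) \<and> Q s} =
      {s. t 0 < s \<and> s \<le> t m \<and> Q s} \<union> {s. t m < s \<and> s \<le> t (Suc m) \<and> Q s}"
    using le t[of m] by force
  have "finite {s. t 0 < s \<and> s \<le> t m \<and> Q s}" "finite {s. t m < s \<and> s \<le> t (Suc m) \<and> Q s}"
    using Suc.prems unfolding eq by auto
  then show ?case
    unfolding eq using Suc.IH by (subst card_Un_disjoint) auto
qed (auto intro: card_0_eq[THEN iffD2])

section \<open>Counting jumps along equidistant grids\<close>

definition grid :: "real \<Rightarrow> real \<Rightarrow> nat \<Rightarrow> nat \<Rightarrow> real" where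
  "grid a b n k = a + real k * ((b - a) / real n)"

lemma grid_0 [simp]: "grid a b n 0 = a"
  and grid_n [simp]: "n > 0 \<Longrightarrow> grid a b n n = b"
  and grid_Suc_diff: "grid a b n (Suc k) - grid a b n k = (b - a) / real n"
  by (simp_all add: grid_def distrib_right add_divide_distrib)

lemma grid_mono: "a \<le> b \<Longrightarrow> grid a b n k \<le> grid a b n (Suc k)"
  using grid_Suc_diff[of a b n k] by (metis diff_ge_0_iff_ge divide_nonneg_nonneg of_nat_0_le_iff)

lemma grid_ge: "a \<le> b \<Longrightarrow> a \<le> grid a b n k"
  by (simp add: grid_def)

lemma integral_grid:
  assumes f: "f integrable_on {a..b}" and ab: "a \<le> b" and n: "n > 0"
  shows "integral {a..b} f = (\<Sum>k<n. integral {grid a b n k..grid a b n (Suc k)} (f :: real \<Rightarrow> real))"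
proof -
  have "integral {a..grid a b n m} f = (\<Sum>k<m. integral {grid a b n k..grid a b n (Suc k)} f)" if "m \<le> n" for m
    using that
  proof (induction m)
    case (Suc m)
    have "grid a b n (Suc m) \<le> grid a b n n"
      using Suc.prems by (intro lift_Suc_mono_le[of "grid a b n", OF grid_mono[OF ab]])
    then have "f integrable_on {a..grid a b n (Suc m)}"
      using n by (intro integrable_on_subinterval[OF f]) auto
    then have "integral {a..grid a b n (Suc m)} f =
        integral {a..grid a b n m} f + integral {grid a b n m..grid a b n (Suc m)} f"
      by (intro Henstock_Kurzweil_Integration.integral_combine[symmetric] grid_ge grid_mono ab)
    then show ?case using Suc by simp
  qed simp
  from this[of n] show ?thesis using n by simp
qed

text \<open>Unlike the number of jumps, this depends on the path at finitely many times only, so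
  two-time laws determine its expectation.\<close>

definition grid_count :: "(real \<Rightarrow> 'x) \<Rightarrow> ('x \<times> 'x) set \<Rightarrow> real \<Rightarrow> real \<Rightarrow> nat \<Rightarrow> nat" where
  "grid_count w A a b n = (\<Sum>k<n. of_bool ((w (grid a b n k), w (grid a b n (Suc k))) \<in> A))"

text \<open>A majorant that does not depend on \<open>n\<close>, for dominated convergence.\<close>

lemma grid_count_le:
  assumes w: "cadlag_path w" and a: "0 \<le> a" "a \<le> b" and A: "\<And>x. (x, x) \<notin> A" and n: "n > 0"
  shows "grid_count w A a b n \<le> card {s. a < s \<and> s \<le> b \<and> left_lim w s \<noteq> w s}"
proof -
  have "grid_count w A a b n \<le>
      (\<Sum>k<n. card {s. grid a b n k < s \<and> s \<le> grid a b n (Suc k) \<and> left_lim w s \<noteq> w s})"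
    unfolding grid_count_def
    by (intro sum_mono jump_count_le w A grid_mono a order_trans[OF a(1) grid_ge])
  also have "\<dots> = card {s. grid a b n 0 < s \<and> s \<le> grid a b n n \<and> left_lim w s \<noteq> w s}"
    using finite_jumps_Ioc[OF w a(1), of b] n
    by (intro card_Ioc_partition[symmetric] grid_mono a) simp
  finally show ?thesis using n by simp
qed

lemma finite_separated:
  fixes F :: "real set"
  assumes "finite F"
  obtains \<delta> where "\<delta> > 0" "\<And>x y. x \<in> F \<Longrightarrow> y \<in> F \<Longrightarrow> x \<noteq> y \<Longrightarrow> \<delta> \<le> \<bar>x - y\<bar>"
proof -
  \<comment> \<open>The inserted 1 keeps the minimum meaningful when \<open>F\<close> has at most
    one point.\<close>
  define D where "D = insert 1 ((\<lambda>(x, y). \<bar>x - y\<bar>) ` {p \<in> F \<times> F. fst p \<noteq> snd p})"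
  have D: "finite D" "D \<noteq> {}" using assms by (auto simp: D_def)
  show ?thesis
  proof (rule that[of "Min D"])
    show "Min D > 0" using D by (auto simp: D_def)
    show "Min D \<le> \<bar>x - y\<bar>" if "x \<in> F" "y \<in> F" "x \<noteq> y" for x y
      unfolding D_def using that
      by (intro Min_le D(1)[unfolded D_def] insertI2 rev_image_eqI[of "(x, y)"]) auto
  qed
qed

text \<open>The finitely many jump times in the interval are separated by some
  \<open>\<delta>\<close>; once the mesh is below \<open>\<delta>\<close>, each cell has at most one
  jump and is counted correctly.\<close>

lemma eventually_grid_count_eq:
  assumes w: "cadlag_path w" and a: "0 \<le> a" "a \<le> b" and A: "\<And>x. (x, x) \<notin> A"
  shows "\<forall>\<^sub>F n in sequentially. grid_count w A a b n = card {s. a < s \<and> s \<le> b \<and> (left_lim w s, w s) \<in> A}"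
proof -
  let ?J = "{s. a < s \<and> s \<le> b \<and> left_lim w s \<noteq> w s}"
  obtain \<delta> where \<delta>: "\<delta> > 0" "\<And>x y. x \<in> ?J \<Longrightarrow> y \<in> ?J \<Longrightarrow> x \<noteq> y \<Longrightarrow> \<delta> \<le> \<bar>x - y\<bar>"
    using finite_separated[OF finite_jumps_Ioc[OF w a(1), of b]] by blast
  have "(\<lambda>n. (b - a) / real n) \<longlonglongrightarrow> 0" by (rule lim_const_over_n)
  then have "\<forall>\<^sub>F n in sequentially. (b - a) / real n < \<delta>"
    using \<delta>(1) by (rule order_tendstoD)
  then show ?thesis using eventually_gt_at_top[of 0]
  proof eventually_elim
    case (elim n)
    have "grid_count w A a b n =
      (\<Sum>k<n. card {s. grid a b n k < s \<and> s \<le> grid a b n (Suc k) \<and> (left_lim w s, w s) \<in> A})"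
      unfolding grid_count_def
    proof (intro sum.cong refl)
      fix k assume k: "k \<in> {..<n}"
      let ?K = "{s. grid a b n k < s \<and> s \<le> grid a b n (Suc k) \<and> left_lim w s \<noteq> w s}"
      have "grid a b n (Suc k) \<le> grid a b n n"
        using k by (intro lift_Suc_mono_le[of "grid a b n", OF grid_mono[OF a(2)]]) simp
      then have sub: "?K \<subseteq> ?J" using grid_ge[OF a(2), of n k] elim by auto
      have "card ?K \<le> 1"
      proof (rule ccontr)
        assume "\<not> card ?K \<le> 1"
        moreover from this have "finite ?K" by (intro card_ge_0_finite) linarith
        ultimately obtain x y where xy: "x \<in> ?K" "y \<in> ?K" "x \<noteq> y"
          using card_le_Suc0_iff_eq[of ?K] unfolding One_nat_def by blast
        then have "\<delta> \<le> \<bar>x - y\<bar>" using sub by (intro \<delta>(2)) auto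
        also have "\<dots> \<le> grid a b n (Suc k) - grid a b n k" using xy by auto
        also have "\<dots> < \<delta>" using elim by (simp add: grid_Suc_diff)
        finally show False by simp
      qed
      then show "of_bool ((w (grid a b n k), w (grid a b n (Suc k))) \<in> A) =
        card {s. grid a b n k < s \<and> s \<le> grid a b n (Suc k) \<and> (left_lim w s, w s) \<in> A}"
        by (intro jump_count_eq w A grid_mono a order_trans[OF a(1) grid_ge])
    qed
    also have "\<dots> = card {s. grid a b n 0 < s \<and> s \<le> grid a b n n \<and> (left_lim w s, w s) \<in> A}"
    proof (intro card_Ioc_partition[symmetric] grid_mono a)
      show "finite {s. grid a b n 0 < s \<and> s \<le> grid a b n n \<and> (left_lim w s, w s) \<in> A}"
        by (rule finite_subset[OF _ finite_jumps_Ioc[OF w a(1), of b]]) (use A elim in auto)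
    qed
    finally show ?case using elim by simp
  qed
qed

section \<open>Markov jump processes\<close>

lemma measurable_count_space_finite:
  fixes Z :: "'w \<Rightarrow> 'z::finite"
  shows "Z \<in> measurable M (count_space UNIV) \<longleftrightarrow> (\<forall>z. {\<omega> \<in> space M. Z \<omega> = z} \<in> sets M)"
  by (subst measurable_count_space_eq2) (auto simp: vimage_def Int_def conj_commute)

section \<open>One-time and two-time laws of a Markov jump process\<close>

locale jump_process = jump_kernel q P B
  for q :: "real \<Rightarrow> 'x::finite \<Rightarrow> 'x \<Rightarrow> real" and P B +
  fixes \<mu> :: "'x pmf" and M :: "'w measure" and X :: "real \<Rightarrow> 'w \<Rightarrow> 'x"
  assumes process: "markov_jump_process P \<mu> M X"
begin

sublocale prob_space M
  using process by (simp add: markov_jump_process_def)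

lemma X_measurable [measurable]: "t \<ge> 0 \<Longrightarrow> X t \<in> measurable M (count_space UNIV)"
  using process by (simp add: markov_jump_process_def)

lemma X_cadlag: "\<omega> \<in> space M \<Longrightarrow> cadlag_path (\<lambda>t. X t \<omega>)"
  using process by (simp add: markov_jump_process_def)

definition marginal :: "real \<Rightarrow> 'x pmf" where "marginal t = bind_pmf \<mu> (P 0 t)"

lemma prob_X_0: "prob {\<omega> \<in> space M. X 0 \<omega> = x} = pmf \<mu> x"
proof -
  have "pmf \<mu> x = measure (distr M (count_space UNIV) (X 0)) {x}"
    using process by (simp add: markov_jump_process_def measure_pmf_single)
  also have "\<dots> = prob {\<omega> \<in> space M. X 0 \<omega> = x}"
    by (subst measure_distr) (auto intro!: arg_cong[where f = prob])
  finally show ?thesis by simp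
qed

lemma prob_X_X:
  assumes "0 \<le> s" "s \<le> t"
  shows "prob {\<omega> \<in> space M. X s \<omega> = x \<and> X t \<omega> = y} = prob {\<omega> \<in> space M. X s \<omega> = x} * pmf (P s t x) y"
proof -
  define \<tau> where "\<tau> = (\<lambda>i::nat. if i = 0 then s else t)"
  define \<xi> where "\<xi> = (\<lambda>i::nat. if i = 0 then x else y)"
  have "prob {\<omega> \<in> space M. \<forall>i\<le>Suc 0. X (\<tau> i) \<omega> = \<xi> i} =
        prob {\<omega> \<in> space M. \<forall>i\<le>0. X (\<tau> i) \<omega> = \<xi> i} * pmf (P (\<tau> 0) (\<tau> (Suc 0)) (\<xi> 0)) (\<xi> (Suc 0))"
    using process unfolding markov_jump_process_def
    by (elim conjE allE[of _ 0] allE[of _ \<tau>] allE[of _ \<xi>]) (use assms in \<open>auto simp: \<tau>_def\<close>)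
  moreover have "(\<forall>i\<le>Suc 0. X (\<tau> i) \<omega> = \<xi> i) \<longleftrightarrow> X s \<omega> = x \<and> X t \<omega> = y" for \<omega>
    by (auto simp: \<tau>_def \<xi>_def le_Suc_eq)
  ultimately show ?thesis by (simp add: \<tau>_def \<xi>_def)
qed

lemma prob_X:
  assumes "0 \<le> t"
  shows "prob {\<omega> \<in> space M. X t \<omega> = y} = pmf (marginal t) y"
proof -
  have "prob {\<omega> \<in> space M. X t \<omega> = y} = prob (\<Union>x\<in>UNIV. {\<omega> \<in> space M. X 0 \<omega> = x \<and> X t \<omega> = y})"
    by (intro arg_cong[where f = prob]) auto
  also have "\<dots> = (\<Sum>x\<in>UNIV. prob {\<omega> \<in> space M. X 0 \<omega> = x \<and> X t \<omega> = y})"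
    using assms by (intro finite_measure_finite_Union) (auto simp: disjoint_family_on_def)
  finally show ?thesis
    using assms by (simp add: prob_X_X prob_X_0 marginal_def pmf_bind_finite)
qed

lemma has_bochner_integral_finite:
  fixes Z :: "'w \<Rightarrow> 'z::finite" and f :: "'z \<Rightarrow> real"
  assumes "Z \<in> measurable M (count_space UNIV)"
  shows "has_bochner_integral M (\<lambda>\<omega>. f (Z \<omega>)) (\<Sum>z\<in>UNIV. f z * prob {\<omega> \<in> space M. Z \<omega> = z})"
proof -
  have meas: "{\<omega> \<in> space M. Z \<omega> = z} \<in> sets M" for z
    using assms by (simp add: measurable_count_space_finite)
  have "has_bochner_integral M (\<lambda>\<omega>. \<Sum>z\<in>UNIV. indicat_real {\<omega> \<in> space M. Z \<omega> = z} \<omega> *\<^sub>R f z)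
      (\<Sum>z\<in>UNIV. prob {\<omega> \<in> space M. Z \<omega> = z} *\<^sub>R f z)"
    by (intro has_bochner_integral_sum has_bochner_integral_indicator meas) (simp add: emeasure_eq_measure)
  moreover have "(\<Sum>z\<in>UNIV. indicat_real {\<omega> \<in> space M. Z \<omega> = z} \<omega> *\<^sub>R f z) = f (Z \<omega>)"
    if "\<omega> \<in> space M" for \<omega>
    using that by (simp add: indicator_def if_distrib[of "\<lambda>c. c * _"] cong: if_cong)
  ultimately show ?thesis
    by (subst has_bochner_integral_cong[where N = M]) (auto simp: mult.commute)
qed

lemma has_bochner_integral_X:
  assumes "0 \<le> t"
  shows "has_bochner_integral M (\<lambda>\<omega>. f (X t \<omega>)) (\<Sum>y\<in>UNIV. f y * pmf (marginal t) y)"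
  using has_bochner_integral_finite[OF X_measurable[OF assms], of f] by (simp add: prob_X assms)

lemma has_bochner_integral_X_X:
  assumes "0 \<le> s" "s \<le> t"
  shows "has_bochner_integral M (\<lambda>\<omega>. f (X s \<omega>) (X t \<omega>))
    (\<Sum>x\<in>UNIV. \<Sum>y\<in>UNIV. f x y * (pmf (marginal s) x * pmf (P s t x) y))"
proof -
  have "(\<lambda>\<omega>. (X s \<omega>, X t \<omega>)) \<in> measurable M (count_space UNIV)"
    unfolding measurable_count_space_finite using assms by auto
  from has_bochner_integral_finite[OF this, of "\<lambda>(x, y). f x y"] show ?thesis
    using assms by (simp add: prob_X_X prob_X sum.cartesian_product UNIV_Times_UNIV split_beta' prod_eq_iff)
qed

lemma marginal_lipschitz:
  assumes "0 \<le> s" "s \<le> t"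
  shows "\<bar>pmf (marginal t) y - pmf (marginal s) y\<bar> \<le> lip * (t - s)"
proof -
  have "\<bar>pmf (marginal t) y - pmf (marginal s) y\<bar> =
      \<bar>\<Sum>x\<in>UNIV. pmf \<mu> x * (pmf (P 0 t x) y - pmf (P 0 s x) y)\<bar>"
    by (simp add: marginal_def pmf_bind_finite right_diff_distrib sum_subtractf)
  also have "\<dots> \<le> (\<Sum>x\<in>UNIV. pmf \<mu> x * (lip * (t - s)))"
    using assms by (intro order_trans[OF sum_abs] sum_mono) (auto simp: abs_mult intro!: mult_left_mono P_lipschitz)
  finally show ?thesis by (simp flip: sum_distrib_right)
qed

lemma continuous_on_marginal: "continuous_on {0..} (\<lambda>t. pmf (marginal t) y)"
  unfolding marginal_def pmf_bind_finite by (intro continuous_intros continuous_on_P) auto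

text \<open>The truncation to positive times makes \<open>intensity\<close> measurable on the whole line.\<close>

definition intensity :: "'x \<Rightarrow> 'x \<Rightarrow> real \<Rightarrow> real" where
  "intensity x y s = indicat_real {0..} s * pmf (marginal s) x * q s x y"

lemma intensity_measurable [measurable]: "intensity x y \<in> borel_measurable borel"
proof -
  have "(\<lambda>s. indicat_real {0..} s * pmf (marginal s) x) \<in> borel_measurable borel"
    using borel_measurable_continuous_on_indicator[OF _ continuous_on_marginal[of x]] by simp
  then show ?thesis
    unfolding intensity_def using rate_measurable by measurable
qed

lemma intensity_nonneg: "0 \<le> intensity x y s"
  unfolding intensity_def using rate_nonneg by simp

lemma intensity_le: "intensity x y s \<le> B"
  unfolding intensity_def using mult_mono[of "indicat_real {0..} s * pmf (marginal s) x" 1 "q s x y" B] rate_le rate_nonneg B_nonneg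
  by (simp add: pmf_le_1 indicator_def)

lemma intensity_set_integrable: "set_integrable lborel {a..b} (intensity x y)"
proof (rule set_integrable_bounded_Icc)
  show "set_borel_measurable borel {a..b} (intensity x y)"
    unfolding set_borel_measurable_def by measurable
  show "\<bar>intensity x y u\<bar> \<le> B" for u
    using intensity_nonneg[of x y u] intensity_le[of x y u] by simp
qed

text \<open>Two second-order errors: \<open>P_small_time\<close> for the transition probability, and
  freezing the marginal at the left end \<open>s\<close>, which adds the extra 1 to the
  constant.\<close>

lemma jump_step_estimate:
  assumes st: "0 \<le> s" "s \<le> t" and xy: "x \<noteq> y"
  shows "\<bar>pmf (marginal s) x * pmf (P s t x) y - integral {s..t} (intensity x y)\<bar>
    \<le> (2 * real CARD('x) + 1) * lip * B * (t - s)\<^sup>2"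
proof -
  let ?p = "pmf (marginal s) x"
  have q: "(\<lambda>u. q u x y) integrable_on {s..t}" "(LINT u:{s..t}|lborel. q u x y) = integral {s..t} (\<lambda>u. q u x y)"
    using set_borel_integral_eq_integral[OF rate_set_integrable] by blast+
  have i: "((\<lambda>u. ?p * q u x y - intensity x y u) has_integral
      (?p * integral {s..t} (\<lambda>u. q u x y) - integral {s..t} (intensity x y))) {s..t}"
    by (intro has_integral_diff has_integral_mult_right integrable_integral q
        set_borel_integral_eq_integral(1)[OF intensity_set_integrable])
  have "norm (?p * integral {s..t} (\<lambda>u. q u x y) - integral {s..t} (intensity x y)) \<le>
      (lip * (t - s) * B) * measure lborel {s..t}"
  proof (rule has_integral_bound_real[OF _ _ i, of _ "{}"])
    fix u assume u: "u \<in> {s..t} - {}"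
    have "\<bar>?p * q u x y - intensity x y u\<bar> = \<bar>pmf (marginal u) x - ?p\<bar> * q u x y"
      using u st rate_nonneg[of u x y]
      by (simp add: intensity_def abs_mult[symmetric] abs_minus_commute flip: left_diff_distrib)
        (simp add: abs_mult abs_minus_commute)
    also have "\<dots> \<le> lip * (t - s) * B"
    proof (intro mult_mono)
      have "\<bar>pmf (marginal u) x - ?p\<bar> \<le> lip * (u - s)"
        using u st by (intro marginal_lipschitz) auto
      also have "\<dots> \<le> lip * (t - s)" using u lip_nonneg by (intro mult_left_mono) auto
      finally show "\<bar>pmf (marginal u) x - ?p\<bar> \<le> lip * (t - s)" .
    qed (use rate_le rate_nonneg lip_nonneg st in auto)
    finally show "norm (?p * q u x y - intensity x y u) \<le> lip * (t - s) * B" by simp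
  qed (use lip_nonneg B_nonneg st in auto)
  then have "\<bar>?p * integral {s..t} (\<lambda>u. q u x y) - integral {s..t} (intensity x y)\<bar> \<le> lip * B * (t - s)\<^sup>2"
    using st by (simp add: power2_eq_square mult_ac)
  moreover have "\<bar>?p * pmf (P s t x) y - ?p * integral {s..t} (\<lambda>u. q u x y)\<bar> \<le> 2 * real CARD('x) * lip * B * (t - s)\<^sup>2"
  proof -
    have "\<bar>?p * pmf (P s t x) y - ?p * integral {s..t} (\<lambda>u. q u x y)\<bar> =
        ?p * \<bar>pmf (P s t x) y - integral {s..t} (\<lambda>u. q u x y)\<bar>"
      by (simp add: abs_mult flip: right_diff_distrib)
    also have "\<dots> \<le> 1 * (2 * real CARD('x) * lip * B * (t - s)\<^sup>2)"
      using P_small_time[OF st xy] q(2) by (intro mult_mono pmf_le_1) auto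
    finally show ?thesis by simp
  qed
  ultimately show ?thesis
    by (simp add: distrib_right)
qed

section \<open>Expected numbers of jumps\<close>

lemma has_bochner_integral_grid_count:
  assumes ab: "0 \<le> a" "a \<le> b"
  shows "has_bochner_integral M (\<lambda>\<omega>. real (grid_count (\<lambda>t. X t \<omega>) A a b n))
    (\<Sum>k<n. \<Sum>x\<in>UNIV. \<Sum>y\<in>UNIV. of_bool ((x, y) \<in> A) *
        (pmf (marginal (grid a b n k)) x * pmf (P (grid a b n k) (grid a b n (Suc k)) x) y))"
proof -
  have "has_bochner_integral M (\<lambda>\<omega>. \<Sum>k<n. of_bool ((X (grid a b n k) \<omega>, X (grid a b n (Suc k)) \<omega>) \<in> A))
    (\<Sum>k<n. \<Sum>x\<in>UNIV. \<Sum>y\<in>UNIV. of_bool ((x, y) \<in> A) *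
        (pmf (marginal (grid a b n k)) x * pmf (P (grid a b n k) (grid a b n (Suc k)) x) y))"
    by (intro has_bochner_integral_sum has_bochner_integral_X_X grid_mono ab order_trans[OF ab(1) grid_ge])
  then show ?thesis by (simp add: grid_count_def)
qed

text \<open>In each of the \<open>n\<close> cells the end points differ with probability at most
  \<open>lip\<close> times the mesh, so the total is bounded uniformly in \<open>n\<close>.\<close>

lemma expectation_grid_count_offdiag_le:
  assumes ab: "0 \<le> a" "a \<le> b"
  shows "expectation (\<lambda>\<omega>. real (grid_count (\<lambda>t. X t \<omega>) {(x, y). x \<noteq> y} a b n)) \<le> lip * (b - a)"
proof (cases "n = 0")
  case True
  then show ?thesis using ab lip_nonneg by (simp add: grid_count_def)
next
  case False
  have "expectation (\<lambda>\<omega>. real (grid_count (\<lambda>t. X t \<omega>) {(x, y). x \<noteq> y} a b n)) =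
    (\<Sum>k<n. \<Sum>x\<in>UNIV. \<Sum>y\<in>UNIV. of_bool (x \<noteq> y) *
        (pmf (marginal (grid a b n k)) x * pmf (P (grid a b n k) (grid a b n (Suc k)) x) y))"
    using has_bochner_integral_integral_eq[OF has_bochner_integral_grid_count[OF ab]] by simp
  also have "\<dots> \<le> (\<Sum>k<n. lip * ((b - a) / n))"
  proof (rule sum_mono)
    fix k
    let ?s = "grid a b n k" and ?t = "grid a b n (Suc k)"
    have st: "0 \<le> ?s" "?s \<le> ?t" using ab grid_ge[OF ab(2), of n k] grid_mono[OF ab(2)] by auto
    have "(\<Sum>y\<in>UNIV. of_bool (x \<noteq> y) * (pmf (marginal ?s) x * pmf (P ?s ?t x) y)) \<le>
        pmf (marginal ?s) x * (lip * ((b - a) / n))" for x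
    proof -
      have "(\<Sum>y\<in>UNIV. of_bool (x \<noteq> y) * (pmf (marginal ?s) x * pmf (P ?s ?t x) y)) =
          (\<Sum>y\<in>UNIV. pmf (marginal ?s) x * (pmf (P ?s ?t x) y - of_bool (x = y) * pmf (P ?s ?t x) y))"
        by (intro sum.cong) auto
      also have "\<dots> = pmf (marginal ?s) x * (1 - pmf (P ?s ?t x) x)"
        by (simp add: sum_subtractf flip: sum_distrib_left)
      also have "\<dots> \<le> pmf (marginal ?s) x * (lip * (?t - ?s))"
        using P_near_refl[OF st, of x x] by (intro mult_left_mono) (auto simp: abs_le_iff)
      finally show ?thesis by (simp only: grid_Suc_diff)
    qed
    then have "(\<Sum>x\<in>UNIV. \<Sum>y\<in>UNIV. of_bool (x \<noteq> y) * (pmf (marginal ?s) x * pmf (P ?s ?t x) y)) \<le>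
        (\<Sum>x\<in>UNIV. pmf (marginal ?s) x * (lip * ((b - a) / n)))"
      by (rule sum_mono)
    also have "\<dots> = lip * ((b - a) / n)"
      by (simp add: sum_distrib_right[symmetric] del: times_divide_eq_right)
    finally show "(\<Sum>x\<in>UNIV. \<Sum>y\<in>UNIV. of_bool (x \<noteq> y) * (pmf (marginal ?s) x * pmf (P ?s ?t x) y)) \<le>
        lip * ((b - a) / n)" .
  qed
  also have "\<dots> = lip * (b - a)" using False by simp
  finally show ?thesis .
qed

definition jump_count :: "('x \<times> 'x) set \<Rightarrow> real \<Rightarrow> real \<Rightarrow> 'w \<Rightarrow> nat" where
  "jump_count A a b \<omega> = card {s. a < s \<and> s \<le> b \<and> (left_lim (\<lambda>t. X t \<omega>) s, X s \<omega>) \<in> A}"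

lemma grid_count_tendsto_jump_count:
  assumes "0 \<le> a" "a \<le> b" "\<And>x. (x, x) \<notin> A" "\<omega> \<in> space M"
  shows "(\<lambda>n. real (grid_count (\<lambda>t. X t \<omega>) A a b n)) \<longlonglongrightarrow> real (jump_count A a b \<omega>)"
  using eventually_grid_count_eq[OF X_cadlag[OF assms(4)] assms(1-3)]
  by (intro tendsto_eventually) (auto simp: jump_count_def elim: eventually_mono)

lemma jump_count_measurable:
  assumes "0 \<le> a" "a \<le> b" "\<And>x. (x, x) \<notin> A"
  shows "(\<lambda>\<omega>. real (jump_count A a b \<omega>)) \<in> borel_measurable M"
  by (rule borel_measurable_LIMSEQ_real[OF grid_count_tendsto_jump_count[OF assms]])
    (use has_bochner_integral_grid_count[OF assms(1,2)] in \<open>auto simp: has_bochner_integral_iff\<close>)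

text \<open>Fatou's lemma along the grid counts, since no majorant is available yet. The total
  number of jumps then is the majorant for the single transitions.\<close>

lemma integrable_jump_count_offdiag:
  assumes ab: "0 \<le> a" "a \<le> b"
  shows "integrable M (\<lambda>\<omega>. real (jump_count {(x, y). x \<noteq> y} a b \<omega>))"
proof (rule integrableI_nonneg)
  let ?A = "{(x, y). x \<noteq> y} :: ('x \<times> 'x) set"
  let ?D = "\<lambda>n \<omega>. real (grid_count (\<lambda>t. X t \<omega>) ?A a b n)"
  have int: "integrable M (?D n)" for n
    using has_bochner_integral_grid_count[OF ab, of ?A n] by (simp add: has_bochner_integral_iff)
  have "(\<integral>\<^sup>+ \<omega>. ennreal (real (jump_count ?A a b \<omega>)) \<partial>M) = (\<integral>\<^sup>+ \<omega>. liminf (\<lambda>n. ennreal (?D n \<omega>)) \<partial>M)"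
  proof (rule nn_integral_cong)
    fix \<omega> assume "\<omega> \<in> space M"
    then have "(\<lambda>n. ennreal (?D n \<omega>)) \<longlonglongrightarrow> ennreal (real (jump_count ?A a b \<omega>))"
      by (intro tendsto_ennrealI grid_count_tendsto_jump_count ab) auto
    then show "ennreal (real (jump_count ?A a b \<omega>)) = liminf (\<lambda>n. ennreal (?D n \<omega>))"
      by (rule lim_imp_Liminf[OF sequentially_bot, symmetric])
  qed
  also have "\<dots> \<le> liminf (\<lambda>n. \<integral>\<^sup>+ \<omega>. ennreal (?D n \<omega>) \<partial>M)"
    using int by (intro nn_integral_liminf) auto
  also have "\<dots> \<le> liminf (\<lambda>n::nat. ennreal (lip * (b - a)))"
  proof (intro Liminf_mono always_eventually allI)
    fix n
    show "(\<integral>\<^sup>+ \<omega>. ennreal (?D n \<omega>) \<partial>M) \<le> ennreal (lip * (b - a))"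
      using expectation_grid_count_offdiag_le[OF ab, of n]
      by (subst nn_integral_eq_integral[OF int]) (auto intro: ennreal_leI)
  qed
  also have "\<dots> < \<infinity>" by (simp add: Liminf_const)
  finally show "(\<integral>\<^sup>+ \<omega>. ennreal (real (jump_count ?A a b \<omega>)) \<partial>M) < \<infinity>" .
qed (use jump_count_measurable[OF ab] in auto)

text \<open>The grid counts converge to the jump count under the majorant of all jumps, while their
  expectations differ from the integral by at most \<open>n\<close> errors of order
  \<open>1 / n^2\<close>.\<close>

lemma has_bochner_integral_jump_count:
  assumes ab: "0 \<le> a" "a \<le> b" and xy: "x \<noteq> y"
  shows "has_bochner_integral M (\<lambda>\<omega>. real (jump_count {(x, y)} a b \<omega>)) (integral {a..b} (intensity x y))"
proof -
  let ?A = "{(x, y). x \<noteq> y} :: ('x \<times> 'x) set"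
  let ?D = "\<lambda>n \<omega>. real (grid_count (\<lambda>t. X t \<omega>) {(x, y)} a b n)"
  have diag: "(z, z) \<notin> {(x, y)}" for z using xy by auto
  have int: "has_bochner_integral M (?D n) (\<Sum>k<n. pmf (marginal (grid a b n k)) x * pmf (P (grid a b n k) (grid a b n (Suc k)) x) y)" for n
  proof -
    have "of_bool ((x', y') \<in> {(x, y)}) * c = of_bool (x = x') * (of_bool (y = y') * c)" for x' y' and c :: real
      by auto
    then show ?thesis
      using has_bochner_integral_grid_count[OF ab, of "{(x, y)}" n]
      by (simp only: sum_distrib_left[symmetric] sum_UNIV_of_bool_left)
  qed
  \<comment> \<open>\<open>Suc n\<close>, because the majorant is stated for nonempty grids.\<close>
  have dom: "AE \<omega> in M. norm (?D (Suc n) \<omega>) \<le> real (jump_count ?A a b \<omega>)" for n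
  proof (rule AE_I2)
    fix \<omega> assume "\<omega> \<in> space M"
    then have "grid_count (\<lambda>t. X t \<omega>) {(x, y)} a b (Suc n) \<le>
        card {s. a < s \<and> s \<le> b \<and> left_lim (\<lambda>t. X t \<omega>) s \<noteq> X s \<omega>}"
      by (intro grid_count_le X_cadlag ab diag) auto
    then show "norm (?D (Suc n) \<omega>) \<le> real (jump_count ?A a b \<omega>)"
      by (simp add: jump_count_def)
  qed
  have lim: "AE \<omega> in M. (\<lambda>n. ?D (Suc n) \<omega>) \<longlonglongrightarrow> real (jump_count {(x, y)} a b \<omega>)"
    by (intro AE_I2 LIMSEQ_Suc grid_count_tendsto_jump_count ab diag)
  note dc = jump_count_measurable[OF ab diag] borel_measurable_has_bochner_integral[OF int]
    integrable_jump_count_offdiag[OF ab] lim dom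
  have "integrable M (\<lambda>\<omega>. real (jump_count {(x, y)} a b \<omega>))"
    by (rule integrable_dominated_convergence[OF dc])
  moreover have "(\<lambda>n. expectation (?D (Suc n))) \<longlonglongrightarrow> expectation (\<lambda>\<omega>. real (jump_count {(x, y)} a b \<omega>))"
    by (rule integral_dominated_convergence[OF dc])
  moreover have "(\<lambda>n. expectation (?D (Suc n))) \<longlonglongrightarrow> integral {a..b} (intensity x y)"
  proof (rule LIMSEQ_Suc, rule LIM_zero_cancel, rule Lim_null_comparison)
    define C where "C = (2 * real CARD('x) + 1) * lip * B"
    show "\<forall>\<^sub>F n in sequentially. norm (expectation (?D n) - integral {a..b} (intensity x y)) \<le> (C * (b - a)\<^sup>2) / real n"
      using eventually_gt_at_top[of 0]
    proof eventually_elim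
      case (elim n)
      let ?s = "grid a b n"
      have eq: "expectation (?D n) - integral {a..b} (intensity x y) =
        (\<Sum>k<n. pmf (marginal (?s k)) x * pmf (P (?s k) (?s (Suc k)) x) y - integral {?s k..?s (Suc k)} (intensity x y))"
        using integral_grid[OF set_borel_integral_eq_integral(1)[OF intensity_set_integrable] ab(2) elim]
        by (simp add: has_bochner_integral_integral_eq[OF int] sum_subtractf)
      have "norm (expectation (?D n) - integral {a..b} (intensity x y)) \<le> (\<Sum>k<n. C * (?s (Suc k) - ?s k)\<^sup>2)"
        unfolding C_def eq
        by (rule sum_norm_le) (auto intro!: jump_step_estimate xy grid_mono ab order_trans[OF ab(1) grid_ge])
      also have "\<dots> = (C * (b - a)\<^sup>2) / real n"
        using elim by (simp add: grid_Suc_diff power_divide power2_eq_square)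
      finally show ?case .
    qed
    show "(\<lambda>n. (C * (b - a)\<^sup>2) / real n) \<longlonglongrightarrow> 0" by (rule lim_const_over_n)
  qed
  ultimately show ?thesis
    by (simp add: has_bochner_integral_iff LIMSEQ_unique)
qed

end

context jump_process begin

section \<open>Sums over jumps\<close>

definition jumps :: "'x \<Rightarrow> 'x \<Rightarrow> real \<Rightarrow> 'w \<Rightarrow> real set" where
  "jumps x y t \<omega> = {s. 0 < s \<and> s \<le> t \<and> left_lim (\<lambda>t. X t \<omega>) s = x \<and> X s \<omega> = y}"

lemma finite_jumps:
  assumes "\<omega> \<in> space M" "x \<noteq> y"
  shows "finite (jumps x y t \<omega>)"
  by (rule finite_subset[OF _ finite_jump_times[OF X_cadlag[OF assms(1)], of t]])
    (use assms in \<open>auto simp: jumps_def jump_times_def\<close>)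

lemma sum_jumps_Ioc:
  assumes "\<omega> \<in> space M" "x \<noteq> y"
  shows "(\<Sum>s\<in>jumps x y t \<omega>. indicat_real {a<..b} s) = real (jump_count {(x, y)} (max a 0) (min b t) \<omega>)"
proof -
  have "(\<Sum>s\<in>jumps x y t \<omega>. indicat_real {a<..b} s) = real (card (jumps x y t \<omega> \<inter> {a<..b}))"
    using sum.inter_restrict[OF finite_jumps[OF assms, of t], of "\<lambda>_. 1 :: real" "{a<..b}"]
    by (simp add: indicator_def of_bool_def)
  also have "jumps x y t \<omega> \<inter> {a<..b} =
      {s. max a 0 < s \<and> s \<le> min b t \<and> (left_lim (\<lambda>t. X t \<omega>) s, X s \<omega>) \<in> {(x, y)}}"
    by (auto simp: jumps_def)
  finally show ?thesis by (simp add: jump_count_def)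
qed

text \<open>The compensator formula for one transition with time weight \<open>h\<close>. It
  contains integrability of the left side only; a divergent integral on the right would be 0 by
  convention, so its integrability is assumed separately where \<open>h\<close> is general.\<close>

definition jump_sum :: "'x \<Rightarrow> 'x \<Rightarrow> real \<Rightarrow> (real \<Rightarrow> real) \<Rightarrow> bool" where
  "jump_sum x y t h \<longleftrightarrow> has_bochner_integral M (\<lambda>\<omega>. \<Sum>s\<in>jumps x y t \<omega>. h s)
     (LINT s:{0..t}|lborel. h s * intensity x y s)"

lemma intensity_indicator_integrable:
  assumes "A \<in> sets borel"
  shows "set_integrable lborel {0..t} (\<lambda>s. indicat_real A s * intensity x y s)"
  unfolding mult.commute[of "indicat_real A _"]
  by (rule set_integrable_mult_bounded[OF intensity_set_integrable, where K = 1])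
    (use assms in \<open>auto simp: set_borel_measurable_def indicator_def\<close>)

text \<open>After clipping to times in \<open>(0, t]\<close> this is the expected jump count; the
  end points that the two integrals treat differently are null sets.\<close>

lemma jump_sum_Ioc:
  assumes xy: "x \<noteq> y"
  shows "jump_sum x y t (indicator {a<..b})"
proof -
  define c d where "c = max a 0" and "d = min b t"
  have eq: "(LINT s:{0..t}|lborel. indicat_real {a<..b} s * intensity x y s) = (LINT s:{c..d}|lborel. intensity x y s)"
    unfolding set_lebesgue_integral_def
  proof (rule integral_cong_AE)
    show "AE s in lborel. indicat_real {0..t} s *\<^sub>R (indicat_real {a<..b} s * intensity x y s) =
        indicat_real {c..d} s *\<^sub>R intensity x y s"
      using AE_lborel_singleton[of 0] AE_lborel_singleton[of a]
      by eventually_elim (auto simp: indicator_def c_def d_def)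
  qed (measurable; simp)+
  have "has_bochner_integral M (\<lambda>\<omega>. real (jump_count {(x, y)} c d \<omega>)) (LINT s:{c..d}|lborel. intensity x y s)"
  proof (cases "c \<le> d")
    case True
    then show ?thesis
      using has_bochner_integral_jump_count[of c d x y] xy set_borel_integral_eq_integral(2)[OF intensity_set_integrable, of c d x y]
      by (simp add: c_def)
  next
    case False
    then have "jump_count {(x, y)} c d \<omega> = 0" for \<omega>
      unfolding jump_count_def by (intro card_eq_0_iff[THEN iffD2] disjI1) auto
    then show ?thesis using False by (simp add: set_lebesgue_integral_def has_bochner_integral_zero)
  qed
  then show ?thesis
    unfolding jump_sum_def eq
    by (subst has_bochner_integral_cong[OF refl sum_jumps_Ioc[OF _ xy] refl]) (simp_all add: c_def d_def)
qed

text \<open>Half-open intervals generate the Borel sets and are stable under intersection, so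
  complements and disjoint unions suffice. The case \<open>UNIV\<close> comes first: complements are
  differences from it, and its jump sum is the integrable majorant for unions.\<close>

lemma jump_sum_indicator:
  assumes xy: "x \<noteq> y" and A: "A \<in> sets borel"
  shows "jump_sum x y t (indicator A)"
proof -
  have UNIV: "jump_sum x y t (indicator UNIV)"
  proof -
    have "(\<Sum>s\<in>jumps x y t \<omega>. indicat_real UNIV s) = (\<Sum>s\<in>jumps x y t \<omega>. indicat_real {0<..t} s)" for \<omega>
      by (intro sum.cong refl) (auto simp: jumps_def indicator_def)
    moreover have "(LINT s:{0..t}|lborel. indicat_real UNIV s * intensity x y s) =
        (LINT s:{0..t}|lborel. indicat_real {0<..t} s * intensity x y s)"
      unfolding set_lebesgue_integral_def
    proof (rule integral_cong_AE)
      show "AE s in lborel. indicat_real {0..t} s *\<^sub>R (indicat_real UNIV s * intensity x y s) =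
          indicat_real {0..t} s *\<^sub>R (indicat_real {0<..t} s * intensity x y s)"
        using AE_lborel_singleton[of 0] by eventually_elim (auto simp: indicator_def)
    qed (measurable; simp)+
    ultimately show ?thesis using jump_sum_Ioc[OF xy, of t 0 t] by (simp only: jump_sum_def)
  qed
  have borel: "sets borel = sigma_sets UNIV (range (\<lambda>(a, b). {a<..b :: real}))"
    by (subst borel_sigma_sets_Ioc) simp
  have Int_stable: "Int_stable (range (\<lambda>(a, b). {a<..b :: real}))"
    by (auto simp: Int_stable_def)
  have "A \<in> sigma_sets UNIV (range (\<lambda>(a, b). {a<..b}))"
    using A by (simp add: borel)
  from Int_stable subset_UNIV[of "range (\<lambda>(a, b). {a<..b})", folded Pow_UNIV] this show ?thesis
  proof (induction rule: sigma_sets_induct_disjoint)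
    case (basic A)
    then show ?case using jump_sum_Ioc[OF xy] by auto
  next
    case empty
    then show ?case by (simp add: jump_sum_def set_lebesgue_integral_def has_bochner_integral_zero)
  next
    case (compl A)
    then have A: "A \<in> sets borel" by (simp add: borel)
    have split: "indicator (UNIV - A) s = (indicat_real UNIV s - indicator A s)" for s
      by (auto simp: indicator_def)
    have "(LINT s:{0..t}|lborel. (indicat_real UNIV s - indicat_real A s) * intensity x y s) =
      (LINT s:{0..t}|lborel. indicat_real UNIV s * intensity x y s) - (LINT s:{0..t}|lborel. indicat_real A s * intensity x y s)"
      unfolding left_diff_distrib using A by (intro set_integral_diff intensity_indicator_integrable) auto
    then show ?case
      using has_bochner_integral_diff[OF UNIV[unfolded jump_sum_def] compl(2)[unfolded jump_sum_def]]
      unfolding jump_sum_def split sum_subtractf by simp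
  next
    case (union A)
    then have A: "A i \<in> sets borel" for i by (auto simp: borel)
    have disj: "A i \<inter> A j = {}" if "i \<noteq> j" for i j
      using union(1) that by (auto simp: disjoint_family_on_def)
    have UA: "\<Union> (range A) \<in> sets borel" using A by auto
    let ?S = "\<lambda>n s. \<Sum>i<n. indicat_real (A i) s"
    have S: "(\<lambda>n. ?S n s) \<longlonglongrightarrow> indicator (\<Union> (range A)) s" for s
      using indicator_sums[of A s] disj by (simp add: sums_def)
    have S_le: "0 \<le> ?S n s" "?S n s \<le> 1" for n s
    proof -
      show "0 \<le> ?S n s" by (intro sum_nonneg) auto
      have "(\<lambda>i. indicat_real (A i) s) sums indicator (\<Union> (range A)) s"
        using indicator_sums[of A s] disj by simp
      then have "?S n s \<le> indicator (\<Union> (range A)) s"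
        using sum_le_suminf[of "\<lambda>i. indicat_real (A i) s" "{..<n}"] by (simp add: sums_iff)
      also have "\<dots> \<le> 1" by (rule indicator_le_1)
      finally show "?S n s \<le> 1" .
    qed
    have partial: "jump_sum x y t (?S n)" for n
    proof -
      have "(LINT s:{0..t}|lborel. ?S n s * intensity x y s) = (\<Sum>i<n. LINT s:{0..t}|lborel. indicat_real (A i) s * intensity x y s)"
        unfolding sum_distrib_right
        using set_integral_sum_mult[of "{..<n}" lborel "{0..t}" "\<lambda>i s. indicat_real (A i) s * intensity x y s" "\<lambda>_. 1"]
          intensity_indicator_integrable[OF A] by simp
      then show ?thesis
        using has_bochner_integral_sum[of "{..<n}" M, OF union(3)[unfolded jump_sum_def]]
        unfolding jump_sum_def by (subst sum.swap) simp
    qed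
    have dom: "integrable M (\<lambda>\<omega>. \<Sum>s\<in>jumps x y t \<omega>. indicat_real UNIV s)"
      using UNIV by (simp add: jump_sum_def has_bochner_integral_iff)
    have lim: "AE \<omega> in M. (\<lambda>n. \<Sum>s\<in>jumps x y t \<omega>. ?S n s) \<longlonglongrightarrow> (\<Sum>s\<in>jumps x y t \<omega>. indicator (\<Union> (range A)) s)"
      by (intro AE_I2 tendsto_sum S)
    have bd: "AE \<omega> in M. norm (\<Sum>s\<in>jumps x y t \<omega>. ?S n s) \<le> (\<Sum>s\<in>jumps x y t \<omega>. indicat_real UNIV s)" for n
      using S_le by (intro AE_I2 order_trans[OF norm_sum] sum_mono) simp
    have meas_n: "(\<lambda>\<omega>. \<Sum>s\<in>jumps x y t \<omega>. ?S n s) \<in> borel_measurable M" for n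
      using partial[of n] by (auto simp: jump_sum_def has_bochner_integral_iff)
    have meas: "(\<lambda>\<omega>. \<Sum>s\<in>jumps x y t \<omega>. indicat_real (\<Union> (range A)) s) \<in> borel_measurable M"
    proof (rule borel_measurable_LIMSEQ_real[OF _ meas_n])
      show "(\<lambda>n. \<Sum>s\<in>jumps x y t \<omega>. ?S n s) \<longlonglongrightarrow> (\<Sum>s\<in>jumps x y t \<omega>. indicat_real (\<Union> (range A)) s)" for \<omega>
        by (intro tendsto_sum S)
    qed
    note dc = meas meas_n dom lim bd
    have "(\<lambda>n. expectation (\<lambda>\<omega>. \<Sum>s\<in>jumps x y t \<omega>. ?S n s)) \<longlonglongrightarrow>
        expectation (\<lambda>\<omega>. \<Sum>s\<in>jumps x y t \<omega>. indicator (\<Union> (range A)) s)"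
      by (rule integral_dominated_convergence[OF dc])
    moreover have "expectation (\<lambda>\<omega>. \<Sum>s\<in>jumps x y t \<omega>. ?S n s) = (LINT s:{0..t}|lborel. ?S n s * intensity x y s)" for n
      using partial[of n] unfolding jump_sum_def by (rule has_bochner_integral_integral_eq)
    moreover have "(\<lambda>n. LINT s:{0..t}|lborel. ?S n s * intensity x y s) \<longlonglongrightarrow>
        (LINT s:{0..t}|lborel. indicator (\<Union> (range A)) s * intensity x y s)"
      unfolding set_lebesgue_integral_def
    proof (rule integral_dominated_convergence)
      show "integrable lborel (\<lambda>s. indicat_real {0..t} s *\<^sub>R intensity x y s)"
        using intensity_set_integrable by (simp add: set_integrable_def)
      show "AE s in lborel. (\<lambda>n. indicat_real {0..t} s *\<^sub>R (?S n s * intensity x y s)) \<longlonglongrightarrow>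
          indicat_real {0..t} s *\<^sub>R (indicat_real (\<Union> (range A)) s * intensity x y s)"
        by (intro AE_I2 tendsto_intros S)
      show "AE s in lborel. norm (indicat_real {0..t} s *\<^sub>R (?S n s * intensity x y s)) \<le>
          indicat_real {0..t} s *\<^sub>R intensity x y s" for n
        using S_le intensity_nonneg[of x y]
        by (intro AE_I2) (auto simp: abs_mult intro!: mult_left_mono mult_left_le_one_le)
    qed (use A UA in measurable)
    ultimately show ?case
      unfolding jump_sum_def has_bochner_integral_iff
      using integrable_dominated_convergence[OF dc] LIMSEQ_unique by auto
  qed
qed

text \<open>Approximation by simple functions. Integrability against \<open>intensity\<close>
  belongs to the induction; it passes down to summands and approximants because these are smaller
  and \<open>intensity\<close> is nonnegative.\<close>

lemma jump_sum_nonneg: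
  assumes xy: "x \<noteq> y" and h: "h \<in> borel_measurable borel" "\<And>s. 0 \<le> h s"
    and int: "set_integrable lborel {0..t} (\<lambda>s. h s * intensity x y s)"
  shows "jump_sum x y t h"
  using h int
proof (induction rule: borel_measurable_induct_real)
  case (set A)
  then show ?case by (intro jump_sum_indicator xy) simp
next
  case (mult u c)
  show ?case
  \<comment> \<open>For \<open>c = 0\<close> integrability of the multiple says nothing about
    \<open>u\<close>, so the induction hypothesis cannot be invoked.\<close>
  proof (cases "c = 0")
    case True
    then show ?thesis by (simp add: jump_sum_def set_lebesgue_integral_def has_bochner_integral_zero)
  next
    case False
    have "jump_sum x y t u"
      using mult False by (intro mult.IH) (simp_all add: mult.assoc)
    then show ?thesis
      using has_bochner_integral_mult_right[of c M "\<lambda>\<omega>. \<Sum>s\<in>jumps x y t \<omega>. u s"]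
      by (simp add: jump_sum_def sum_distrib_left mult.assoc)
  qed
next
  case (add u v)
  have sub: "set_integrable lborel {0..t} (\<lambda>s. k s * intensity x y s)"
    if "k \<in> borel_measurable borel" "\<And>s. 0 \<le> k s" "\<And>s. k s \<le> v s + u s" for k
    unfolding set_integrable_def
  proof (rule Bochner_Integration.integrable_bound[OF add.prems[unfolded set_integrable_def]])
    show "(\<lambda>s. indicat_real {0..t} s *\<^sub>R (k s * intensity x y s)) \<in> borel_measurable lborel"
      using that(1) by measurable
    show "AE s in lborel. norm (indicat_real {0..t} s *\<^sub>R (k s * intensity x y s)) \<le>
        norm (indicat_real {0..t} s *\<^sub>R ((v s + u s) * intensity x y s))"
      using that intensity_nonneg
      by (intro AE_I2) (auto simp: abs_mult intro!: mult_left_mono mult_right_mono order_trans[OF that(3)])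
  qed
  have i: "set_integrable lborel {0..t} (\<lambda>s. v s * intensity x y s)"
      "set_integrable lborel {0..t} (\<lambda>s. u s * intensity x y s)"
    by (rule sub; use add in simp)+
  then have "jump_sum x y t u" "jump_sum x y t v" using add.IH by auto
  with i show ?case
    using has_bochner_integral_add[of M "\<lambda>\<omega>. \<Sum>s\<in>jumps x y t \<omega>. v s" _ "\<lambda>\<omega>. \<Sum>s\<in>jumps x y t \<omega>. u s"]
    by (simp add: jump_sum_def sum.distrib distrib_right set_integral_add)
next
  case (seq U)
  have Uh: "U i s \<le> h s" for i s
    using incseq_le[of "\<lambda>i. U i s" "h s" i] seq.hyps(3,4) by (auto simp: incseq_def le_fun_def)
  have Ui: "set_integrable lborel {0..t} (\<lambda>s. U i s * intensity x y s)" for i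
    unfolding set_integrable_def
  proof (rule Bochner_Integration.integrable_bound[OF seq.prems[unfolded set_integrable_def]])
    show "(\<lambda>s. indicat_real {0..t} s *\<^sub>R (U i s * intensity x y s)) \<in> borel_measurable lborel"
      using seq.hyps(1)[of i] by measurable
    have "norm (indicat_real {0..t} s *\<^sub>R (U i s * intensity x y s)) \<le>
        norm (indicat_real {0..t} s *\<^sub>R (h s * intensity x y s))" for s
      using Uh[of i s] seq.hyps(2)[of i s] intensity_nonneg[of x y s]
      by (auto simp: abs_mult intro!: mult_left_mono mult_right_mono)
    then show "AE s in lborel. norm (indicat_real {0..t} s *\<^sub>R (U i s * intensity x y s)) \<le>
        norm (indicat_real {0..t} s *\<^sub>R (h s * intensity x y s))" by simp
  qed
  have IH: "jump_sum x y t (U i)" for i by (rule seq.IH[OF Ui])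
  have lim: "(\<lambda>i. \<Sum>s\<in>jumps x y t \<omega>. U i s) \<longlonglongrightarrow> (\<Sum>s\<in>jumps x y t \<omega>. h s)" for \<omega>
    by (intro tendsto_sum seq.hyps(4)) simp
  have meas: "(\<lambda>\<omega>. \<Sum>s\<in>jumps x y t \<omega>. U i s) \<in> borel_measurable M" for i
    using IH[of i] by (auto simp: jump_sum_def has_bochner_integral_iff)
  show ?case
    unfolding jump_sum_def
  proof (rule has_bochner_integral_monotone_convergence)
    show "integrable M (\<lambda>\<omega>. \<Sum>s\<in>jumps x y t \<omega>. U i s)" for i
      using IH[of i] by (simp add: jump_sum_def has_bochner_integral_iff)
    show "AE \<omega> in M. mono (\<lambda>i. \<Sum>s\<in>jumps x y t \<omega>. U i s)"
      using seq.hyps(3) by (intro AE_I2 monoI sum_mono) (auto simp: incseq_def le_fun_def)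
    show "AE \<omega> in M. (\<lambda>i. \<Sum>s\<in>jumps x y t \<omega>. U i s) \<longlonglongrightarrow> (\<Sum>s\<in>jumps x y t \<omega>. h s)"
      by (intro AE_I2 lim)
    show "(\<lambda>\<omega>. \<Sum>s\<in>jumps x y t \<omega>. h s) \<in> borel_measurable M"
      by (rule borel_measurable_LIMSEQ_real[OF lim meas])
    have "(\<lambda>i. LINT s:{0..t}|lborel. U i s * intensity x y s) \<longlonglongrightarrow> (LINT s:{0..t}|lborel. h s * intensity x y s)"
      unfolding set_lebesgue_integral_def
    proof (rule integral_dominated_convergence)
      show "integrable lborel (\<lambda>s. indicat_real {0..t} s *\<^sub>R (h s * intensity x y s))"
        using seq.prems by (simp add: set_integrable_def)
      then show "(\<lambda>s. indicat_real {0..t} s *\<^sub>R (h s * intensity x y s)) \<in> borel_measurable lborel"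
        by simp
      show "(\<lambda>s. indicat_real {0..t} s *\<^sub>R (U i s * intensity x y s)) \<in> borel_measurable lborel" for i
        using Ui[of i] by (simp add: set_integrable_def borel_measurable_integrable)
      show "AE s in lborel. (\<lambda>n. indicat_real {0..t} s *\<^sub>R (U n s * intensity x y s)) \<longlonglongrightarrow>
          indicat_real {0..t} s *\<^sub>R (h s * intensity x y s)"
        by (intro AE_I2 tendsto_intros seq.hyps(4)) simp
      have "norm (indicat_real {0..t} s *\<^sub>R (U i s * intensity x y s)) \<le>
          indicat_real {0..t} s *\<^sub>R (h s * intensity x y s)" for i s
        using Uh[of i s] seq.hyps(2)[of i s] intensity_nonneg[of x y s]
        by (auto simp: abs_mult intro!: mult_left_mono mult_right_mono)
      then show "AE s in lborel. norm (indicat_real {0..t} s *\<^sub>R (U i s * intensity x y s)) \<le>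
          indicat_real {0..t} s *\<^sub>R (h s * intensity x y s)" for i by simp
    qed
    moreover have "expectation (\<lambda>\<omega>. \<Sum>s\<in>jumps x y t \<omega>. U i s) = (LINT s:{0..t}|lborel. U i s * intensity x y s)" for i
      using IH[of i] unfolding jump_sum_def by (rule has_bochner_integral_integral_eq)
    ultimately show "(\<lambda>i. expectation (\<lambda>\<omega>. \<Sum>s\<in>jumps x y t \<omega>. U i s)) \<longlonglongrightarrow>
        (LINT s:{0..t}|lborel. h s * intensity x y s)" by simp
  qed
qed

text \<open>Splitting into positive and negative parts. As \<open>h\<close> is measurable on
  \<open>{0..t}\<close> only, it is first cut off there, which neither side of the formula
  notices.\<close>

lemma jump_sum_integrable:
  assumes xy: "x \<noteq> y" and h: "set_borel_measurable borel {0..t} h"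
    and int: "set_integrable lborel {0..t} (\<lambda>s. h s * intensity x y s)"
  shows "jump_sum x y t h"
proof -
  define k where "k = (\<lambda>s. indicat_real {0..t} s * h s)"
  have k [measurable]: "k \<in> borel_measurable borel"
    using h by (simp add: set_borel_measurable_def k_def)
  define u v where "u = (\<lambda>s. max (k s) 0)" and "v = (\<lambda>s. max (- k s) 0)"
  have [measurable]: "u \<in> borel_measurable borel" "v \<in> borel_measurable borel"
    unfolding u_def v_def by measurable
  have part: "set_integrable lborel {0..t} (\<lambda>s. w s * intensity x y s)"
    if "w \<in> borel_measurable borel" "\<And>s. \<bar>w s\<bar> \<le> \<bar>k s\<bar>" for w
    unfolding set_integrable_def
  proof (rule Bochner_Integration.integrable_bound[OF int[unfolded set_integrable_def]])
    show "(\<lambda>s. indicat_real {0..t} s *\<^sub>R (w s * intensity x y s)) \<in> borel_measurable lborel"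
      using that(1) by measurable
    have "norm (indicat_real {0..t} s *\<^sub>R (w s * intensity x y s)) \<le>
        norm (indicat_real {0..t} s *\<^sub>R (h s * intensity x y s))" for s
      using that(2)[of s] by (auto simp: abs_mult k_def indicator_def intro!: mult_right_mono)
    then show "AE s in lborel. norm (indicat_real {0..t} s *\<^sub>R (w s * intensity x y s)) \<le>
        norm (indicat_real {0..t} s *\<^sub>R (h s * intensity x y s))" by simp
  qed
  have u: "set_integrable lborel {0..t} (\<lambda>s. u s * intensity x y s)"
    by (rule part) (auto simp: u_def)
  have v: "set_integrable lborel {0..t} (\<lambda>s. v s * intensity x y s)"
    by (rule part) (auto simp: v_def)
  have uv: "h s = u s - v s" if "s \<in> {0..t}" for s
    using that by (auto simp: u_def v_def k_def)
  have "has_bochner_integral M (\<lambda>\<omega>. (\<Sum>s\<in>jumps x y t \<omega>. u s) - (\<Sum>s\<in>jumps x y t \<omega>. v s))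
      ((LINT s:{0..t}|lborel. u s * intensity x y s) - (LINT s:{0..t}|lborel. v s * intensity x y s))"
    using jump_sum_nonneg[OF xy _ _ u] jump_sum_nonneg[OF xy _ _ v]
    by (intro has_bochner_integral_diff) (auto simp: jump_sum_def u_def v_def)
  also have "(LINT s:{0..t}|lborel. u s * intensity x y s) - (LINT s:{0..t}|lborel. v s * intensity x y s) =
      (LINT s:{0..t}|lborel. u s * intensity x y s - v s * intensity x y s)"
    by (rule set_integral_diff(2)[OF u v, symmetric])
  also have "\<dots> = (LINT s:{0..t}|lborel. h s * intensity x y s)"
    by (rule set_lebesgue_integral_cong) (simp_all add: uv left_diff_distrib)
  also have "(\<lambda>\<omega>. (\<Sum>s\<in>jumps x y t \<omega>. u s) - (\<Sum>s\<in>jumps x y t \<omega>. v s)) = (\<lambda>\<omega>. \<Sum>s\<in>jumps x y t \<omega>. h s)"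
    unfolding sum_subtractf[symmetric] by (intro ext sum.cong refl uv[symmetric]) (auto simp: jumps_def)
  finally show ?thesis unfolding jump_sum_def .
qed

lemma set_integrable_mult_marginal:
  assumes "set_integrable lborel {0..t} f"
  shows "set_integrable lborel {0..t} (\<lambda>s. f s * pmf (marginal s) x)"
proof (rule set_integrable_mult_bounded[OF assms, where K = 1])
  show "set_borel_measurable borel {0..t} (\<lambda>s. pmf (marginal s) x)"
    unfolding set_borel_measurable_def
    by (rule borel_measurable_continuous_on_indicator)
      (auto intro: continuous_on_subset[OF continuous_on_marginal])
qed (simp add: pmf_le_1)

text \<open>The jump times are sorted by the states before and after the jump; these finitely many
  classes are disjoint and finite.\<close>

lemma has_bochner_integral_sum_jumps:
  assumes \<alpha>: "\<And>x y. set_borel_measurable borel {0..t} (\<lambda>s. \<alpha> s x y)"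
    and int: "\<And>x y. x \<noteq> y \<Longrightarrow> set_integrable lborel {0..t} (\<lambda>s. \<alpha> s x y * q s x y)"
  shows "has_bochner_integral M
    (\<lambda>\<omega>. \<Sum>s\<in>jump_times (\<lambda>u. X u \<omega>) t. \<alpha> s (left_lim (\<lambda>u. X u \<omega>) s) (X s \<omega>))
    (\<Sum>(x, y)\<in>{(x, y). x \<noteq> y}. LINT s:{0..t}|lborel. \<alpha> s x y * q s x y * pmf (marginal s) x)"
proof -
  have eq: "\<alpha> s x y * intensity x y s = \<alpha> s x y * q s x y * pmf (marginal s) x" if "s \<in> {0..t}" for s x y
    using that by (simp add: intensity_def)
  have js: "jump_sum x y t (\<lambda>s. \<alpha> s x y)" if "x \<noteq> y" for x y
  proof (rule jump_sum_integrable[OF that \<alpha>])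
    show "set_integrable lborel {0..t} (\<lambda>s. \<alpha> s x y * intensity x y s)"
      using set_integrable_mult_marginal[OF int[OF that], of x] eq
      by (subst set_integrable_cong[OF refl refl eq]) simp_all
  qed
  have hb: "has_bochner_integral M (\<lambda>\<omega>. \<Sum>s\<in>jumps x y t \<omega>. \<alpha> s x y)
      (LINT s:{0..t}|lborel. \<alpha> s x y * q s x y * pmf (marginal s) x)" if "x \<noteq> y" for x y
  proof -
    have "(LINT s:{0..t}|lborel. \<alpha> s x y * intensity x y s) =
        (LINT s:{0..t}|lborel. \<alpha> s x y * q s x y * pmf (marginal s) x)"
      by (rule set_lebesgue_integral_cong) (use eq in auto)
    then show ?thesis using js[OF that] by (simp only: jump_sum_def)
  qed
  have "has_bochner_integral M (\<lambda>\<omega>. \<Sum>p\<in>{(x, y). x \<noteq> y}. \<Sum>s\<in>jumps (fst p) (snd p) t \<omega>. \<alpha> s (fst p) (snd p))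
      (\<Sum>p\<in>{(x, y). x \<noteq> y}. LINT s:{0..t}|lborel. \<alpha> s (fst p) (snd p) * q s (fst p) (snd p) * pmf (marginal s) (fst p))"
    by (intro has_bochner_integral_sum hb) auto
  moreover have "(\<Sum>p\<in>{(x, y). x \<noteq> y}. \<Sum>s\<in>jumps (fst p) (snd p) t \<omega>. \<alpha> s (fst p) (snd p)) =
      (\<Sum>s\<in>jump_times (\<lambda>u. X u \<omega>) t. \<alpha> s (left_lim (\<lambda>u. X u \<omega>) s) (X s \<omega>))" if "\<omega> \<in> space M" for \<omega>
  proof -
    have "jump_times (\<lambda>u. X u \<omega>) t = (\<Union>p\<in>{(x, y). x \<noteq> y}. jumps (fst p) (snd p) t \<omega>)"
      by (auto simp: jump_times_def jumps_def)
    moreover have "(\<Sum>s\<in>(\<Union>p\<in>{(x, y). x \<noteq> y}. jumps (fst p) (snd p) t \<omega>). \<alpha> s (left_lim (\<lambda>u. X u \<omega>) s) (X s \<omega>)) =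
        (\<Sum>p\<in>{(x, y). x \<noteq> y}. \<Sum>s\<in>jumps (fst p) (snd p) t \<omega>. \<alpha> s (left_lim (\<lambda>u. X u \<omega>) s) (X s \<omega>))"
      using finite_jumps[OF that]
      by (intro sum.UNION_disjoint) (auto simp: jumps_def)
    moreover have "\<dots> = (\<Sum>p\<in>{(x, y). x \<noteq> y}. \<Sum>s\<in>jumps (fst p) (snd p) t \<omega>. \<alpha> s (fst p) (snd p))"
      by (intro sum.cong refl) (auto simp: jumps_def)
    ultimately show ?thesis by simp
  qed
  ultimately show ?thesis
    by (subst (asm) has_bochner_integral_cong[OF refl _ refl]) (auto simp: split_beta')
qed

section \<open>Occupation integrals\<close>

text \<open>By right continuity, \<open>X s\<close> is the limit of \<open>X\<close> at the next point of the grid of mesh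
  \<open>1 / n\<close>.\<close>

lemma X_jointly_measurable:
  "(\<lambda>(s, \<omega>). indicat_real {0..} s * of_bool (X s \<omega> = y)) \<in> borel_measurable (borel \<Otimes>\<^sub>M M)"
proof (rule borel_measurable_LIMSEQ_real)
  \<comment> \<open>\<open>\<tau> n s\<close> lies strictly to the right of \<open>s\<close>, so
    right continuity applies, and it has countably many values, which gives measurability. For
    negative \<open>s\<close>, where \<open>nat\<close> truncates, the indicator is 0.\<close>
  define \<tau> where "\<tau> = (\<lambda>n s. (real (nat \<lfloor>s * real (Suc n)\<rfloor>) + 1) / real (Suc n))"
  show "(\<lambda>(s, \<omega>). indicat_real {0..} s * of_bool (X (\<tau> n s) \<omega> = y)) \<in> borel_measurable (borel \<Otimes>\<^sub>M M)" for n
  proof -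
    have "(\<lambda>p. of_bool (X ((real i + 1) / real (Suc n)) (snd p) = y) :: real) \<in> borel_measurable (borel \<Otimes>\<^sub>M M)" for i :: nat
      by (intro measurable_compose[OF measurable_compose[OF measurable_snd X_measurable] borel_measurable_count_space]) simp
    moreover have "(\<lambda>p. nat \<lfloor>fst p * real (Suc n)\<rfloor>) \<in> measurable (borel \<Otimes>\<^sub>M M) (count_space UNIV)"
      by measurable
    ultimately have "(\<lambda>p. of_bool (X (\<tau> n (fst p)) (snd p) = y) :: real) \<in> borel_measurable (borel \<Otimes>\<^sub>M M)"
      unfolding \<tau>_def by (rule measurable_compose_countable)
    then have "(\<lambda>p. indicat_real {0..} (fst p) * of_bool (X (\<tau> n (fst p)) (snd p) = y)) \<in> borel_measurable (borel \<Otimes>\<^sub>M M)"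
      by measurable
    then show ?thesis by (simp add: split_beta')
  qed
  fix p :: "real \<times> 'w" assume p: "p \<in> space (borel \<Otimes>\<^sub>M M)"
  obtain s \<omega> where sw: "p = (s, \<omega>)" by (cases p)
  have \<omega>: "\<omega> \<in> space M" using p sw by (simp add: space_pair_measure)
  show "(\<lambda>n. case p of (s, \<omega>) \<Rightarrow> indicat_real {0..} s * of_bool (X (\<tau> n s) \<omega> = y)) \<longlonglongrightarrow>
      (case p of (s, \<omega>) \<Rightarrow> indicat_real {0..} s * of_bool (X s \<omega> = y))"
  proof (cases "s \<ge> 0")
    case True
    obtain b where b: "s < b" "\<And>u. s < u \<Longrightarrow> u < b \<Longrightarrow> X u \<omega> = X s \<omega>"
      using cadlag_right_nbhd[OF X_cadlag[OF \<omega>] True] by blast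
    have "(\<lambda>n. 1 / real (Suc n)) \<longlonglongrightarrow> 0" by (rule LIMSEQ_Suc[OF lim_const_over_n])
    then have "\<forall>\<^sub>F n in sequentially. 1 / real (Suc n) < b - s"
      using b(1) by (intro order_tendstoD) auto
    then have "\<forall>\<^sub>F n in sequentially. X (\<tau> n s) \<omega> = X s \<omega>"
    proof eventually_elim
      case (elim n)
      have "real (nat \<lfloor>s * real (Suc n)\<rfloor>) = of_int \<lfloor>s * real (Suc n)\<rfloor>"
        using True by simp
      then have "s * real (Suc n) < real (nat \<lfloor>s * real (Suc n)\<rfloor>) + 1"
        "real (nat \<lfloor>s * real (Suc n)\<rfloor>) \<le> s * real (Suc n)"
        by linarith+
      then have "s < \<tau> n s" "\<tau> n s \<le> s + 1 / real (Suc n)"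
        by (simp_all add: \<tau>_def field_simps del: of_nat_Suc)
      then show ?case using elim by (intro b(2)) auto
    qed
    then show ?thesis
      unfolding sw prod.case by (intro tendsto_eventually) (erule eventually_mono, simp)
  qed (simp add: sw)
qed

lemma has_bochner_integral_occupation:
  assumes v: "\<And>x. set_integrable lborel {0..t} (\<lambda>s. v s x)"
  shows "has_bochner_integral M (\<lambda>\<omega>. LINT s:{0..t}|lborel. v s (X s \<omega>))
    (\<Sum>x\<in>UNIV. LINT s:{0..t}|lborel. v s x * pmf (marginal s) x)"
proof -
  interpret pair_sigma_finite lborel M ..
  define F where "F = (\<lambda>s \<omega>. indicat_real {0..t} s *\<^sub>R v s (X s \<omega>))"
  have v_meas [measurable]: "(\<lambda>s. indicat_real {0..t} s *\<^sub>R v s x) \<in> borel_measurable borel" for x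
    using v[of x] by (simp add: set_integrable_def borel_measurable_integrable)
  have [measurable]: "(\<lambda>p. indicat_real {0..} (fst p) * of_bool (X (fst p) (snd p) = x)) \<in> borel_measurable (borel \<Otimes>\<^sub>M M)" for x
    using X_jointly_measurable[of x] by (simp add: split_beta')
  \<comment> \<open>Measurability of \<open>v\<close> is known for each fixed state only; the sum
    over states separates it from the jointly measurable indicators of
    \<open>X s \<omega> = x\<close>.\<close>
  have "(\<lambda>p. \<Sum>x\<in>UNIV. indicat_real {0..t} (fst p) *\<^sub>R v (fst p) x *
      (indicat_real {0..} (fst p) * of_bool (X (fst p) (snd p) = x))) \<in> borel_measurable (borel \<Otimes>\<^sub>M M)"
    by measurable
  also have "(\<lambda>p. \<Sum>x\<in>UNIV. indicat_real {0..t} (fst p) *\<^sub>R v (fst p) x *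
      (indicat_real {0..} (fst p) * of_bool (X (fst p) (snd p) = x))) = case_prod F"
  proof
    fix p
    have "(\<Sum>x\<in>UNIV. indicat_real {0..t} (fst p) *\<^sub>R v (fst p) x *
        (indicat_real {0..} (fst p) * of_bool (X (fst p) (snd p) = x))) =
      (\<Sum>x\<in>UNIV. of_bool (X (fst p) (snd p) = x) * (indicat_real {0..t} (fst p) * v (fst p) x))"
      by (intro sum.cong refl) (auto simp: indicator_def)
    then show "(\<Sum>x\<in>UNIV. indicat_real {0..t} (fst p) *\<^sub>R v (fst p) x *
        (indicat_real {0..} (fst p) * of_bool (X (fst p) (snd p) = x))) = case_prod F p"
      by (simp add: F_def split_beta')
  qed
  finally have F_meas: "case_prod F \<in> borel_measurable (lborel \<Otimes>\<^sub>M M)"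
    by (simp cong: measurable_cong_sets)
  have F_int: "has_bochner_integral M (F s) (indicat_real {0..t} s *\<^sub>R (\<Sum>x\<in>UNIV. v s x * pmf (marginal s) x))" for s
    using has_bochner_integral_X[of s "v s"]
    by (cases "s \<in> {0..t}") (auto simp: F_def has_bochner_integral_zero)
  have nF_int: "has_bochner_integral M (\<lambda>\<omega>. norm (F s \<omega>)) (indicat_real {0..t} s *\<^sub>R (\<Sum>x\<in>UNIV. \<bar>v s x\<bar> * pmf (marginal s) x))" for s
    using has_bochner_integral_X[of s "\<lambda>x. \<bar>v s x\<bar>"]
    by (cases "s \<in> {0..t}") (auto simp: F_def has_bochner_integral_zero)
  have sum_int: "set_integrable lborel {0..t} (\<lambda>s. \<Sum>x\<in>UNIV. w s x * pmf (marginal s) x)"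
    "(LINT s:{0..t}|lborel. \<Sum>x\<in>UNIV. w s x * pmf (marginal s) x) = (\<Sum>x\<in>UNIV. LINT s:{0..t}|lborel. w s x * pmf (marginal s) x)"
    if "\<And>x. set_integrable lborel {0..t} (\<lambda>s. w s x)" for w :: "real \<Rightarrow> 'x \<Rightarrow> real"
    using set_integrable_sum_mult[of UNIV lborel "{0..t}" "\<lambda>x s. w s x * pmf (marginal s) x" "\<lambda>_. 1"]
      set_integral_sum_mult[of UNIV lborel "{0..t}" "\<lambda>x s. w s x * pmf (marginal s) x" "\<lambda>_. 1"]
      set_integrable_mult_marginal[OF that] by simp_all
  have "set_integrable lborel {0..t} (\<lambda>s. \<Sum>x\<in>UNIV. \<bar>v s x\<bar> * pmf (marginal s) x)"
    by (intro sum_int set_integrable_abs v)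
  then have "integrable lborel (\<lambda>s. \<integral>\<omega>. norm (F s \<omega>) \<partial>M)"
    unfolding has_bochner_integral_integral_eq[OF nF_int] by (simp only: set_integrable_def)
  then have int: "integrable (lborel \<Otimes>\<^sub>M M) (case_prod F)"
    using F_int by (intro Fubini_integrable F_meas) (auto simp: has_bochner_integral_iff split_beta')
  have "(\<integral>\<omega>. (\<integral>s. F s \<omega> \<partial>lborel) \<partial>M) = (\<integral>s. (\<integral>\<omega>. F s \<omega> \<partial>M) \<partial>lborel)"
    using Fubini_integral[OF int] .
  also have "\<dots> = (LINT s:{0..t}|lborel. \<Sum>x\<in>UNIV. v s x * pmf (marginal s) x)"
    by (simp add: has_bochner_integral_integral_eq[OF F_int] set_lebesgue_integral_def)
  also have "\<dots> = (\<Sum>x\<in>UNIV. LINT s:{0..t}|lborel. v s x * pmf (marginal s) x)"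
    by (rule sum_int(2)[OF v])
  finally show ?thesis
    using integrable_snd[OF int] by (simp add: has_bochner_integral_iff F_def set_lebesgue_integral_def)
qed

end

section \<open>Response of observables, occupation integrals and jump sums\<close>

text \<open>The bound at \<open>l = 0\<close> itself forces \<open>F 0 = F0\<close>, so the
  unperturbed value needs no separate computation.\<close>

lemma has_real_derivative_quadratic_expansion:
  fixes F :: "real \<Rightarrow> real"
  assumes "e > 0" and q: "\<And>l. \<bar>l\<bar> \<le> e \<Longrightarrow> \<bar>F l - F0 - l * D\<bar> \<le> C * l\<^sup>2"
  shows "(F has_real_derivative D) (at 0)"
proof (rule has_real_derivative_quadratic_error[OF \<open>e > 0\<close>, of _ _ _ _ C])
  fix l :: real
  assume "\<bar>l - 0\<bar> \<le> e"
  moreover have "F 0 = F0" using q[of 0] \<open>e > 0\<close> by simp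
  ultimately show "\<bar>F l - F 0 - D * (l - 0)\<bar> \<le> C * (l - 0)\<^sup>2"
    using q[of l] by (simp add: mult.commute)
qed

text \<open>The remainder of \<open>k\<close> is uniform over \<open>S\<close>, so the integral has
  a remainder of order \<open>l^2\<close> with constant \<open>C\<close> times the integral of
  \<open>\<bar>f\<bar>\<close>, even for unbounded \<open>f\<close>.\<close>

lemma has_real_derivative_set_integral:
  fixes f base slope :: "real \<Rightarrow> real"
  assumes e: "e > 0" and f: "set_integrable lborel S f"
    and k: "\<And>l. set_integrable lborel S (\<lambda>s. f s * k l s)"
      "set_integrable lborel S (\<lambda>s. f s * base s)" "set_integrable lborel S (\<lambda>s. f s * slope s)"
    and q: "\<And>l s. \<bar>l\<bar> \<le> e \<Longrightarrow> s \<in> S \<Longrightarrow> \<bar>k l s - base s - l * slope s\<bar> \<le> C * l\<^sup>2"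
  shows "((\<lambda>l. LINT s:S|lborel. f s * k l s) has_real_derivative (LINT s:S|lborel. f s * slope s)) (at 0)"
proof (rule has_real_derivative_quadratic_expansion[OF e])
  fix l :: real
  assume l: "\<bar>l\<bar> \<le> e"
  define d where "d = (\<lambda>s. f s * k l s - f s * base s - l * (f s * slope s))"
  have d: "set_integrable lborel S d"
    unfolding d_def by (intro set_integral_diff set_integrable_mult_right k)
  have abs: "set_integrable lborel S (\<lambda>s. \<bar>f s\<bar> * (C * l\<^sup>2))"
    by (intro set_integrable_mult_left set_integrable_abs f)
  have "(LINT s:S|lborel. f s * k l s) - (LINT s:S|lborel. f s * base s) - l * (LINT s:S|lborel. f s * slope s) =
      (LINT s:S|lborel. d s)"
    unfolding d_def
    by (simp add: set_integral_diff set_integrable_mult_right k)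
  also have "\<bar>\<dots>\<bar> \<le> (LINT s:S|lborel. \<bar>f s\<bar> * (C * l\<^sup>2))"
    unfolding set_lebesgue_integral_def real_norm_def[symmetric]
  proof (rule Bochner_Integration.integral_norm_bound_integral)
    fix s
    show "norm (indicat_real S s *\<^sub>R d s) \<le> indicat_real S s *\<^sub>R (norm (f s) * (C * l\<^sup>2))"
    proof (cases "s \<in> S")
      case True
      have "\<bar>f s\<bar> * \<bar>k l s - base s - l * slope s\<bar> \<le> \<bar>f s\<bar> * (C * l\<^sup>2)"
        by (intro mult_left_mono q l True) simp
      moreover have "d s = f s * (k l s - base s - l * slope s)"
        by (simp add: d_def algebra_simps)
      ultimately show ?thesis using True by (simp add: abs_mult)
    qed simp
  qed (use d abs in \<open>simp_all add: set_integrable_def\<close>)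
  finally show "\<bar>(LINT s:S|lborel. f s * k l s) - (LINT s:S|lborel. f s * base s) - l * (LINT s:S|lborel. f s * slope s)\<bar>
      \<le> ((LINT s:S|lborel. \<bar>f s\<bar>) * C) * l\<^sup>2"
    by (simp add: mult.assoc)
qed

lemma set_integrable_complex_of_real:
  "set_integrable M A f \<Longrightarrow> set_integrable M A (\<lambda>x. complex_of_real (f x))"
  unfolding set_integrable_def
  by (drule integrable_of_real[where 'a = complex]) (simp add: scaleR_conv_of_real)

lemma sum_offdiag:
  fixes f :: "'x::finite \<Rightarrow> 'x \<Rightarrow> real"
  assumes "\<And>x. f x x = 0"
  shows "(\<Sum>(x, y)\<in>{(x, y). x \<noteq> y}. f x y) = (\<Sum>x\<in>UNIV. \<Sum>y\<in>UNIV. f x y)"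
  unfolding sum.cartesian_product UNIV_Times_UNIV
  by (rule sum.mono_neutral_left) (auto simp: assms)

section \<open>Stationary correlations as pairings with the response\<close>

locale oscillatory_steady_state = perturbed_chain r P0 \<pi> T g G P \<pi>l
  for r :: "'x::finite \<Rightarrow> 'x \<Rightarrow> real" and P0 \<pi> T g G P \<pi>l +
  fixes N :: "'v measure" and Y :: "real \<Rightarrow> 'v \<Rightarrow> 'x"
    and M :: "real \<Rightarrow> 'w measure" and X :: "real \<Rightarrow> real \<Rightarrow> 'w \<Rightarrow> 'x"
  assumes r_diag: "\<And>x. r x x = 0"
    and Y: "markov_jump_process P0 \<pi> N Y"
    and X: "\<And>l. markov_jump_process (P l) (\<pi>l l) (M l) (X l)"
begin

sublocale unperturbed: jump_process "\<lambda>_. r" P0 R \<pi> N Y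
  by unfold_locales (rule Y)

sublocale perturbed: jump_process "perturbed_rates r g l" "P l" "exp (\<bar>l\<bar> * G) * R" "\<pi>l l" "M l" "X l" for l
  by unfold_locales (rule X)

lemma marginal_eq_law: "perturbed.marginal l t = law l t"
  by (simp add: perturbed.marginal_def law_def)

lemma unperturbed_marginal: "t \<ge> 0 \<Longrightarrow> unperturbed.marginal t = \<pi>"
  using \<pi>_inv[of t] by (simp add: unperturbed.marginal_def invariant_distribution_def)

text \<open>The real function to which the correlation under \<open>N\<close> and the complex inner
  product both reduce for \<open>s \<ge> 0\<close>.\<close>

definition response_kernel :: "('x \<Rightarrow> real) \<Rightarrow> real \<Rightarrow> real \<Rightarrow> real" where
  "response_kernel f t s = (\<Sum>y\<in>UNIV. (\<Sum>x\<in>UNIV. source (t - s) x * Q s x y) * f y)"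

lemma expectation_eq_response_kernel:
  assumes "s \<ge> 0"
  shows "(\<integral>\<omega>. f (Y s \<omega>) * psi r \<pi> g (t - s) (Y 0 \<omega>) \<partial>N) = response_kernel f t s"
proof -
  have "(\<integral>\<omega>. f (Y s \<omega>) * psi r \<pi> g (t - s) (Y 0 \<omega>) \<partial>N) =
      (\<Sum>x\<in>UNIV. \<Sum>y\<in>UNIV. f y * psi r \<pi> g (t - s) x * (pmf \<pi> x * Q s x y))"
    using has_bochner_integral_integral_eq[OF unperturbed.has_bochner_integral_X_X[of 0 s "\<lambda>x y. f y * psi r \<pi> g (t - s) x"]] assms
    by (simp add: unperturbed_marginal Q_def)
  also have "\<dots> = response_kernel f t s"
    unfolding response_kernel_def source_eq_psi sum_distrib_right
    by (subst sum.swap) (simp add: mult_ac)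
  finally show ?thesis .
qed

lemma L2_inner_eq_response_kernel:
  assumes "s \<ge> 0"
  shows "L2_inner \<pi> (exp_generator r s (\<lambda>x. of_real (f x))) (\<lambda>x. of_real (psi r \<pi> g (t - s) x)) =
    of_real (response_kernel f t s)"
proof -
  have "L2_inner \<pi> (exp_generator r s (\<lambda>x. of_real (f x))) (\<lambda>x. of_real (psi r \<pi> g (t - s) x)) =
      of_real (\<Sum>x\<in>UNIV. pmf \<pi> x * (\<Sum>y\<in>UNIV. Q s x y * f y) * psi r \<pi> g (t - s) x)"
    by (simp add: L2_inner_def exp_generator_of_real sum_Q[OF assms])
  also have "(\<Sum>x\<in>UNIV. pmf \<pi> x * (\<Sum>y\<in>UNIV. Q s x y * f y) * psi r \<pi> g (t - s) x) = response_kernel f t s"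
    unfolding response_kernel_def source_eq_psi sum_distrib_right sum_distrib_left
    by (subst sum.swap) (simp add: mult_ac)
  finally show ?thesis .
qed

lemma response_kernel_integrable: "set_integrable lborel {0..} (response_kernel f t)"
  and integral_response_kernel: "(LINT s:{0..}|lborel. response_kernel f t s) = (\<Sum>y\<in>UNIV. response t y * f y)"
  unfolding response_kernel_def response_def
  by (intro set_integrable_sum_mult set_integral_sum_mult response_integrable)+

lemma response_integrals:
  shows "set_integrable lborel {0..} (\<lambda>s. \<integral>\<omega>. f (Y s \<omega>) * psi r \<pi> g (t - s) (Y 0 \<omega>) \<partial>N)"
    and "(LINT s:{0..}|lborel. (\<integral>\<omega>. f (Y s \<omega>) * psi r \<pi> g (t - s) (Y 0 \<omega>) \<partial>N)) = (\<Sum>y\<in>UNIV. response t y * f y)"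
    and "set_integrable lborel {0..}
      (\<lambda>s. L2_inner \<pi> (exp_generator r s (\<lambda>x. of_real (f x))) (\<lambda>x. of_real (psi r \<pi> g (t - s) x)))"
    and "(LINT s:{0..}|lborel.
        L2_inner \<pi> (exp_generator r s (\<lambda>x. of_real (f x))) (\<lambda>x. of_real (psi r \<pi> g (t - s) x))) =
      of_real (\<Sum>y\<in>UNIV. response t y * f y)"
proof -
  show "set_integrable lborel {0..} (\<lambda>s. \<integral>\<omega>. f (Y s \<omega>) * psi r \<pi> g (t - s) (Y 0 \<omega>) \<partial>N)"
    by (subst set_integrable_cong[OF refl refl expectation_eq_response_kernel])
      (simp_all add: response_kernel_integrable)
  show "(LINT s:{0..}|lborel. (\<integral>\<omega>. f (Y s \<omega>) * psi r \<pi> g (t - s) (Y 0 \<omega>) \<partial>N)) = (\<Sum>y\<in>UNIV. response t y * f y)"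
    unfolding integral_response_kernel[symmetric]
    by (rule set_lebesgue_integral_cong) (simp_all add: expectation_eq_response_kernel)
  show "set_integrable lborel {0..}
      (\<lambda>s. L2_inner \<pi> (exp_generator r s (\<lambda>x. of_real (f x))) (\<lambda>x. of_real (psi r \<pi> g (t - s) x)))"
    by (subst set_integrable_cong[OF refl refl L2_inner_eq_response_kernel])
      (simp_all add: response_kernel_integrable set_integrable_complex_of_real)
  have "(LINT s:{0..}|lborel.
        L2_inner \<pi> (exp_generator r s (\<lambda>x. of_real (f x))) (\<lambda>x. of_real (psi r \<pi> g (t - s) x))) =
      (LINT s:{0..}|lborel. complex_of_real (response_kernel f t s))"
    by (rule set_lebesgue_integral_cong) (simp_all add: L2_inner_eq_response_kernel)
  then show "(LINT s:{0..}|lborel.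
        L2_inner \<pi> (exp_generator r s (\<lambda>x. of_real (f x))) (\<lambda>x. of_real (psi r \<pi> g (t - s) x))) =
      of_real (\<Sum>y\<in>UNIV. response t y * f y)"
    by (simp only: set_integral_complex_of_real integral_response_kernel)
qed

section \<open>Derivatives of expectations at zero\<close>

lemma response_of_observable:
  assumes t: "t \<ge> 0"
  shows "((\<lambda>l. \<integral>\<omega>. v (X l t \<omega>) \<partial>M l) has_real_derivative (\<Sum>y\<in>UNIV. response t y * v y)) (at 0)"
proof -
  obtain e C where eC: "e > 0"
    "\<And>l t' y. \<bar>l\<bar> \<le> e \<Longrightarrow> t' \<in> {0..t} \<Longrightarrow> \<bar>pmf (law l t') y - pmf \<pi> y - l * response t' y\<bar> \<le> C * l\<^sup>2"
    using law_expansion[of t] by metis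
  have "(\<integral>\<omega>. v (X l t \<omega>) \<partial>M l) = (\<Sum>y\<in>UNIV. pmf (law l t) y * v y)" for l
    using has_bochner_integral_integral_eq[OF perturbed.has_bochner_integral_X[OF t, of l v]]
    by (simp add: marginal_eq_law mult.commute)
  moreover have "((\<lambda>l. pmf (law l t) y) has_real_derivative response t y) (at 0)" for y
    by (rule has_real_derivative_quadratic_expansion[OF eC(1), of _ "pmf \<pi> y" _ C]) (use eC(2) t in auto)
  then have "((\<lambda>l. \<Sum>y\<in>UNIV. pmf (law l t) y * v y) has_real_derivative (\<Sum>y\<in>UNIV. response t y * v y)) (at 0)"
    by (intro DERIV_sum DERIV_cmult_right)
  ultimately show ?thesis by simp
qed

lemma set_integrable_mult_response:
  assumes "set_integrable lborel S f" "S \<in> sets borel"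
  shows "set_integrable lborel S (\<lambda>s. f s * response s y)"
proof -
  obtain C where "\<And>t y. \<bar>response t y\<bar> \<le> C" using response_bounded by blast
  then show ?thesis
    by (intro set_integrable_mult_bounded[OF assms(1)]) (use assms(2) in \<open>auto simp: set_borel_measurable_def\<close>)
qed

lemma set_integrable_mult_law:
  "set_integrable lborel {0..t} f \<Longrightarrow> set_integrable lborel {0..t} (\<lambda>s. f s * pmf (law l s) x)"
  using perturbed.set_integrable_mult_marginal by (simp add: marginal_eq_law)

lemma response_of_occupation:
  assumes v: "\<And>x. set_integrable lborel {0..t} (\<lambda>s. v s x)"
  shows "integrable (M l) (\<lambda>\<omega>. LINT s:{0..t}|lborel. v s (X l s \<omega>))"
    and "set_integrable lborel {0..t} (\<lambda>u. \<Sum>y\<in>UNIV. response u y * v u y)"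
    and "((\<lambda>l. \<integral>\<omega>. (LINT s:{0..t}|lborel. v s (X l s \<omega>)) \<partial>M l) has_real_derivative
      (LINT u:{0..t}|lborel. \<Sum>y\<in>UNIV. response u y * v u y)) (at 0)"
proof -
  have hb: "has_bochner_integral (M l) (\<lambda>\<omega>. LINT s:{0..t}|lborel. v s (X l s \<omega>))
    (\<Sum>x\<in>UNIV. LINT s:{0..t}|lborel. v s x * pmf (law l s) x)" for l
    using perturbed.has_bochner_integral_occupation[OF v, of l] by (simp add: marginal_eq_law)
  then show "integrable (M l) (\<lambda>\<omega>. LINT s:{0..t}|lborel. v s (X l s \<omega>))"
    by (simp add: has_bochner_integral_iff)
  have i: "set_integrable lborel {0..t} (\<lambda>s. v s x * response s x)" for x
    by (intro set_integrable_mult_response v) simp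
  show "set_integrable lborel {0..t} (\<lambda>u. \<Sum>y\<in>UNIV. response u y * v u y)"
    using set_integrable_sum_mult[of UNIV lborel "{0..t}" "\<lambda>y u. v u y * response u y" "\<lambda>_. 1"] i
    by (simp add: mult.commute)
  have "(LINT u:{0..t}|lborel. \<Sum>y\<in>UNIV. response u y * v u y) = (\<Sum>y\<in>UNIV. LINT u:{0..t}|lborel. v u y * response u y)"
    using set_integral_sum_mult[of UNIV lborel "{0..t}" "\<lambda>y u. v u y * response u y" "\<lambda>_. 1"] i
    by (simp add: mult.commute)
  moreover obtain e C where eC: "e > 0"
    "\<And>l t' y. \<bar>l\<bar> \<le> e \<Longrightarrow> t' \<in> {0..t} \<Longrightarrow> \<bar>pmf (law l t') y - pmf \<pi> y - l * response t' y\<bar> \<le> C * l\<^sup>2"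
    using law_expansion[of t] by metis
  have "((\<lambda>l. LINT s:{0..t}|lborel. v s x * pmf (law l s) x) has_real_derivative
      (LINT s:{0..t}|lborel. v s x * response s x)) (at 0)" for x
    by (rule has_real_derivative_set_integral[OF eC(1) v[of x] set_integrable_mult_law[OF v]
          set_integrable_mult_left i, OF _ eC(2)]) (rule v)
  then have "((\<lambda>l. \<Sum>x\<in>UNIV. LINT s:{0..t}|lborel. v s x * pmf (law l s) x) has_real_derivative
      (\<Sum>y\<in>UNIV. LINT u:{0..t}|lborel. v u y * response u y)) (at 0)"
    by (intro DERIV_sum)
  ultimately show "((\<lambda>l. \<integral>\<omega>. (LINT s:{0..t}|lborel. v s (X l s \<omega>)) \<partial>M l) has_real_derivative
      (LINT u:{0..t}|lborel. \<Sum>y\<in>UNIV. response u y * v u y)) (at 0)"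
    by (simp add: has_bochner_integral_integral_eq[OF hb])
qed

text \<open>Expected jump sums involve the law multiplied by \<open>exp (l * g)\<close>; the
  first-order coefficient is that of the product rule.\<close>

lemma tilted_law_expansion:
  obtains e C where "e > 0"
    "\<And>l s x y. \<bar>l\<bar> \<le> e \<Longrightarrow> s \<in> {0..t} \<Longrightarrow>
      \<bar>exp (l * g s x y) * pmf (law l s) x - pmf \<pi> x - l * (g s x y * pmf \<pi> x + response s x)\<bar> \<le> C * l\<^sup>2"
proof -
  obtain e C where eC: "e > 0"
    "\<And>l t' y. \<bar>l\<bar> \<le> e \<Longrightarrow> t' \<in> {0..t} \<Longrightarrow> \<bar>pmf (law l t') y - pmf \<pi> y - l * response t' y\<bar> \<le> C * l\<^sup>2"
    using law_expansion[of t] by metis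
  obtain C' where C': "\<And>t y. \<bar>response t y\<bar> \<le> C'" using response_bounded by blast
  have C'0: "0 \<le> C'" by (rule order_trans[OF abs_ge_zero C'])
  define e' where "e' = min e (1 / (G + 1))"
  show ?thesis
  \<comment> \<open>The three summands bound the three terms of an exact splitting of the error: the
    remainder of the law times \<open>exp a \<le> 3\<close>, the remainder of the exponential times
    \<pi>, and the product of the two first-order changes.\<close>
  proof (rule that[of e' "3 * C + G\<^sup>2 + 2 * G * C'"])
    show "e' > 0" using eC(1) G_nonneg by (simp add: e'_def)
    fix l s x y
    assume l: "\<bar>l\<bar> \<le> e'" and s: "s \<in> {0..t}"
    define a where "a = l * g s x y"
    have a: "\<bar>a\<bar> \<le> \<bar>l\<bar> * G"
      unfolding a_def abs_mult by (intro mult_left_mono g_le) simp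
    also have "\<dots> \<le> 1 / (G + 1) * G"
      using l G_nonneg by (intro mult_right_mono) (simp_all add: e'_def)
    also have "\<dots> \<le> 1" using G_nonneg by simp
    finally have a1: "\<bar>a\<bar> \<le> 1" .
    have a2: "a\<^sup>2 \<le> G\<^sup>2 * l\<^sup>2"
      using power_mono[OF a abs_ge_zero, of 2] by (simp add: power_mult_distrib mult.commute)
    have ea: "\<bar>exp a - 1 - a\<bar> \<le> G\<^sup>2 * l\<^sup>2"
      using abs_exp_minus_one_minus_le[OF a1] a2 by linarith
    have "a\<^sup>2 \<le> \<bar>a\<bar>"
      using a1 mult_left_le[of "\<bar>a\<bar>" "\<bar>a\<bar>"] by (simp add: power2_eq_square flip: abs_mult)
    then have ea1: "\<bar>exp a - 1\<bar> \<le> 2 * (\<bar>l\<bar> * G)"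
      using abs_exp_minus_one_minus_le[OF a1] a by linarith
    have "exp a \<le> exp 1" using a1 by simp
    then have e3: "exp a \<le> 3" using exp_le by linarith
    define p where "p = pmf (law l s) x - pmf \<pi> x - l * response s x"
    have p: "\<bar>p\<bar> \<le> C * l\<^sup>2" unfolding p_def using l by (intro eC(2) s) (simp add: e'_def)
    have "exp a * pmf (law l s) x - pmf \<pi> x - l * (g s x y * pmf \<pi> x + response s x) =
        exp a * p + (exp a - 1 - a) * pmf \<pi> x + l * response s x * (exp a - 1)"
      by (simp add: p_def a_def algebra_simps)
    also have "\<bar>\<dots>\<bar> \<le> \<bar>exp a * p\<bar> + \<bar>(exp a - 1 - a) * pmf \<pi> x\<bar> + \<bar>l * response s x * (exp a - 1)\<bar>"
      by linarith
    also have "\<dots> \<le> 3 * (C * l\<^sup>2) + (G\<^sup>2 * l\<^sup>2) * 1 + (\<bar>l\<bar> * C') * (2 * (\<bar>l\<bar> * G))"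
      unfolding abs_mult
      by (intro add_mono mult_mono) (use e3 p ea ea1 C' C'0 G_nonneg in \<open>auto simp: pmf_le_1\<close>)
    also have "\<dots> = (3 * C + G\<^sup>2 + 2 * G * C') * l\<^sup>2"
    proof -
      have "l\<^sup>2 = \<bar>l\<bar> * \<bar>l\<bar>" by (simp add: power2_eq_square)
      then show ?thesis by (simp only: distrib_right) (simp only: mult_ac)
    qed
    finally show "\<bar>exp (l * g s x y) * pmf (law l s) x - pmf \<pi> x - l * (g s x y * pmf \<pi> x + response s x)\<bar>
        \<le> (3 * C + G\<^sup>2 + 2 * G * C') * l\<^sup>2"
      by (simp only: a_def)
  qed
qed

lemma set_integrable_mult_bounded_g:
  assumes "set_integrable lborel {0..t} f"
  shows "set_integrable lborel {0..t} (\<lambda>s. f s * g s x y)"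
    and "set_integrable lborel {0..t} (\<lambda>s. f s * exp (l * g s x y))"
proof -
  show "set_integrable lborel {0..t} (\<lambda>s. f s * g s x y)"
    by (rule set_integrable_mult_bounded[OF assms _ g_le])
      (use g_measurable in \<open>auto simp: set_borel_measurable_def\<close>)
  have "\<bar>exp (l * g s x y)\<bar> \<le> exp (\<bar>l\<bar> * G)" for s
  proof -
    have "\<bar>l * g s x y\<bar> \<le> \<bar>l\<bar> * G"
      unfolding abs_mult by (intro mult_left_mono g_le) simp
    then show ?thesis by (simp add: abs_le_iff)
  qed
  then show "set_integrable lborel {0..t} (\<lambda>s. f s * exp (l * g s x y))"
    by (intro set_integrable_mult_bounded[OF assms])
      (use g_measurable in \<open>auto simp: set_borel_measurable_def\<close>)
qed

text \<open>Two effects add up: the perturbed jump rate gives the term with \<open>g\<close> in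
  equilibrium, and the perturbed law of the state before the jump gives the response paired with the
  contracted \<alpha>.\<close>

lemma response_of_jump_sum:
  assumes \<alpha>: "\<And>x y. set_borel_measurable borel {0..t} (\<lambda>s. \<alpha> s x y)"
    and \<alpha>_int: "\<And>x. set_integrable lborel {0..t} (\<lambda>s. rate_contract r (\<lambda>s x y. \<bar>\<alpha> s x y\<bar>) s x)"
  shows "integrable (M l) (\<lambda>\<omega>. \<Sum>s\<in>jump_times (\<lambda>u. X l u \<omega>) t. \<alpha> s (left_lim (\<lambda>u. X l u \<omega>) s) (X l s \<omega>))"
    and "set_integrable lborel {0..t}
      (\<lambda>s. \<integral>\<omega>. rate_contract r (\<lambda>s x y. \<alpha> s x y * g s x y) s (Y s \<omega>) \<partial>N)"
    and "set_integrable lborel {0..t} (\<lambda>s. \<Sum>y\<in>UNIV. response s y * rate_contract r \<alpha> s y)"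
    and "((\<lambda>l. \<integral>\<omega>. (\<Sum>s\<in>jump_times (\<lambda>u. X l u \<omega>) t. \<alpha> s (left_lim (\<lambda>u. X l u \<omega>) s) (X l s \<omega>)) \<partial>M l)
      has_real_derivative
        (LINT s:{0..t}|lborel. (\<integral>\<omega>. rate_contract r (\<lambda>s x y. \<alpha> s x y * g s x y) s (Y s \<omega>) \<partial>N)) +
        (LINT s:{0..t}|lborel. \<Sum>y\<in>UNIV. response s y * rate_contract r \<alpha> s y)) (at 0)"
proof -
  \<comment> \<open>\<alpha> alone need not be integrable where \<open>r x y = 0\<close>, so
    everything is expressed through the product with the rate.\<close>
  define f where "f = (\<lambda>x y s. \<alpha> s x y * r x y)"
  have f: "set_integrable lborel {0..t} (f x y)" for x y
    unfolding set_integrable_def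
  proof (rule Bochner_Integration.integrable_bound[OF \<alpha>_int[of x, unfolded set_integrable_def]])
    have "(\<lambda>s. (indicat_real {0..t} s *\<^sub>R \<alpha> s x y) * r x y) \<in> borel_measurable lborel"
      using \<alpha>[of x y] by (intro borel_measurable_times) (simp_all add: set_borel_measurable_def)
    then show "(\<lambda>s. indicat_real {0..t} s *\<^sub>R f x y s) \<in> borel_measurable lborel"
      by (simp add: f_def mult.assoc)
    have "\<bar>f x y s\<bar> \<le> rate_contract r (\<lambda>s x y. \<bar>\<alpha> s x y\<bar>) s x" for s
      unfolding rate_contract_def f_def abs_mult using r_nonneg
      by (subst abs_of_nonneg[OF r_nonneg]) (rule member_le_sum, auto)
    then have "norm (indicat_real {0..t} s *\<^sub>R f x y s) \<le>
        norm (indicat_real {0..t} s *\<^sub>R rate_contract r (\<lambda>s x y. \<bar>\<alpha> s x y\<bar>) s x)" for s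
      by (auto simp: indicator_def intro: order_trans[OF _ abs_ge_self])
    then show "AE s in lborel. norm (indicat_real {0..t} s *\<^sub>R f x y s) \<le>
        norm (indicat_real {0..t} s *\<^sub>R rate_contract r (\<lambda>s x y. \<bar>\<alpha> s x y\<bar>) s x)" by simp
  qed
  have q: "\<alpha> s x y * perturbed_rates r g l s x y = f x y s * exp (l * g s x y)" for s x y l
    by (simp add: f_def perturbed_rates_def mult_ac)
  have hb: "has_bochner_integral (M l)
      (\<lambda>\<omega>. \<Sum>s\<in>jump_times (\<lambda>u. X l u \<omega>) t. \<alpha> s (left_lim (\<lambda>u. X l u \<omega>) s) (X l s \<omega>))
      (\<Sum>x\<in>UNIV. \<Sum>y\<in>UNIV. LINT s:{0..t}|lborel. f x y s * (exp (l * g s x y) * pmf (law l s) x))" for l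
  proof -
    have "has_bochner_integral (M l)
      (\<lambda>\<omega>. \<Sum>s\<in>jump_times (\<lambda>u. X l u \<omega>) t. \<alpha> s (left_lim (\<lambda>u. X l u \<omega>) s) (X l s \<omega>))
      (\<Sum>(x, y)\<in>{(x, y). x \<noteq> y}. LINT s:{0..t}|lborel. \<alpha> s x y * perturbed_rates r g l s x y * pmf (perturbed.marginal l s) x)"
      by (rule perturbed.has_bochner_integral_sum_jumps[OF \<alpha>])
        (simp only: q, intro set_integrable_mult_bounded_g f)
    \<comment> \<open>\<open>r x x = 0\<close> makes the diagonal terms vanish, so the sum over
      pairs of distinct states extends to all pairs.\<close>
    then show ?thesis
      unfolding q marginal_eq_law
      by (subst (asm) sum_offdiag) (simp_all add: f_def r_diag mult.assoc)
  qed
  then show "integrable (M l) (\<lambda>\<omega>. \<Sum>s\<in>jump_times (\<lambda>u. X l u \<omega>) t. \<alpha> s (left_lim (\<lambda>u. X l u \<omega>) s) (X l s \<omega>))"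
    by (simp add: has_bochner_integral_iff)
  have sum_int: "set_integrable lborel {0..t} (\<lambda>s. \<Sum>x\<in>UNIV. \<Sum>y\<in>UNIV. h x y s)"
    "(LINT s:{0..t}|lborel. \<Sum>x\<in>UNIV. \<Sum>y\<in>UNIV. h x y s) = (\<Sum>x\<in>UNIV. \<Sum>y\<in>UNIV. LINT s:{0..t}|lborel. h x y s)"
    if "\<And>x y. set_integrable lborel {0..t} (h x y)" for h :: "'x \<Rightarrow> 'x \<Rightarrow> real \<Rightarrow> real"
    unfolding sum.cartesian_product
    using set_integrable_sum_mult[of "UNIV \<times> UNIV" lborel "{0..t}" "\<lambda>p. h (fst p) (snd p)" "\<lambda>_. 1"]
      set_integral_sum_mult[of "UNIV \<times> UNIV" lborel "{0..t}" "\<lambda>p. h (fst p) (snd p)" "\<lambda>_. 1"] that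
    by (simp_all add: split_beta')
  have g_int: "set_integrable lborel {0..t} (\<lambda>s. f x y s * g s x y * pmf \<pi> x)" for x y
    by (intro set_integrable_mult_left set_integrable_mult_bounded_g f)
  have resp_int: "set_integrable lborel {0..t} (\<lambda>s. f x y s * response s x)" for x y
    by (intro set_integrable_mult_response f) simp
  have g_eq: "(\<integral>\<omega>. rate_contract r (\<lambda>s x y. \<alpha> s x y * g s x y) s (Y s \<omega>) \<partial>N) =
      (\<Sum>x\<in>UNIV. \<Sum>y\<in>UNIV. f x y s * g s x y * pmf \<pi> x)" if "s \<in> {0..t}" for s
    using has_bochner_integral_integral_eq[OF unperturbed.has_bochner_integral_X[of s
          "rate_contract r (\<lambda>s x y. \<alpha> s x y * g s x y) s"]] that
    by (simp add: unperturbed_marginal rate_contract_def f_def sum_distrib_left sum_distrib_right mult_ac)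
  have resp_eq: "(\<Sum>y\<in>UNIV. response s y * rate_contract r \<alpha> s y) = (\<Sum>x\<in>UNIV. \<Sum>y\<in>UNIV. f x y s * response s x)" for s
    by (simp add: rate_contract_def f_def sum_distrib_left mult_ac)
  show "set_integrable lborel {0..t}
      (\<lambda>s. \<integral>\<omega>. rate_contract r (\<lambda>s x y. \<alpha> s x y * g s x y) s (Y s \<omega>) \<partial>N)"
    by (subst set_integrable_cong[OF refl refl g_eq]) (simp_all only: sum_int(1)[OF g_int])
  show "set_integrable lborel {0..t} (\<lambda>s. \<Sum>y\<in>UNIV. response s y * rate_contract r \<alpha> s y)"
    unfolding resp_eq by (rule sum_int(1)[OF resp_int])
  have D: "(LINT s:{0..t}|lborel. (\<integral>\<omega>. rate_contract r (\<lambda>s x y. \<alpha> s x y * g s x y) s (Y s \<omega>) \<partial>N)) +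
      (LINT s:{0..t}|lborel. \<Sum>y\<in>UNIV. response s y * rate_contract r \<alpha> s y) =
    (\<Sum>x\<in>UNIV. \<Sum>y\<in>UNIV. LINT s:{0..t}|lborel. f x y s * (g s x y * pmf \<pi> x + response s x))"
  proof -
    have "(LINT s:{0..t}|lborel. (\<integral>\<omega>. rate_contract r (\<lambda>s x y. \<alpha> s x y * g s x y) s (Y s \<omega>) \<partial>N)) =
        (LINT s:{0..t}|lborel. \<Sum>x\<in>UNIV. \<Sum>y\<in>UNIV. f x y s * g s x y * pmf \<pi> x)"
      by (rule set_lebesgue_integral_cong) (use g_eq in auto)
    moreover have "(LINT s:{0..t}|lborel. f x y s * (g s x y * pmf \<pi> x + response s x)) =
        (LINT s:{0..t}|lborel. f x y s * g s x y * pmf \<pi> x) + (LINT s:{0..t}|lborel. f x y s * response s x)" for x y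
      by (simp only: distrib_left mult.assoc[symmetric] set_integral_add(2)[OF g_int resp_int])
    ultimately show ?thesis
      by (simp only: resp_eq sum_int(2)[OF resp_int] sum_int(2)[OF g_int] sum.distrib)
  qed
  obtain e C where eC: "e > 0"
    "\<And>l s x y. \<bar>l\<bar> \<le> e \<Longrightarrow> s \<in> {0..t} \<Longrightarrow>
      \<bar>exp (l * g s x y) * pmf (law l s) x - pmf \<pi> x - l * (g s x y * pmf \<pi> x + response s x)\<bar> \<le> C * l\<^sup>2"
    using tilted_law_expansion[of t] by metis
  have "((\<lambda>l. LINT s:{0..t}|lborel. f x y s * (exp (l * g s x y) * pmf (law l s) x)) has_real_derivative
      (LINT s:{0..t}|lborel. f x y s * (g s x y * pmf \<pi> x + response s x))) (at 0)" for x y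
  proof (rule has_real_derivative_set_integral[OF eC(1) f, where base = "\<lambda>_. pmf \<pi> x" and C = C])
    show "set_integrable lborel {0..t} (\<lambda>s. f x y s * (exp (l * g s x y) * pmf (law l s) x))" for l
      unfolding mult.assoc[symmetric]
      by (intro set_integrable_mult_law set_integrable_mult_bounded_g f)
    show "set_integrable lborel {0..t} (\<lambda>s. f x y s * pmf \<pi> x)"
      by (intro set_integrable_mult_left f)
    show "set_integrable lborel {0..t} (\<lambda>s. f x y s * (g s x y * pmf \<pi> x + response s x))"
      unfolding distrib_left mult.assoc[symmetric] by (intro set_integral_add g_int resp_int)
  qed (rule eC(2))
  then have "((\<lambda>l. \<Sum>x\<in>UNIV. \<Sum>y\<in>UNIV. LINT s:{0..t}|lborel. f x y s * (exp (l * g s x y) * pmf (law l s) x)) has_real_derivative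
      (\<Sum>x\<in>UNIV. \<Sum>y\<in>UNIV. LINT s:{0..t}|lborel. f x y s * (g s x y * pmf \<pi> x + response s x))) (at 0)"
    by (intro DERIV_sum)
  then show "((\<lambda>l. \<integral>\<omega>. (\<Sum>s\<in>jump_times (\<lambda>u. X l u \<omega>) t. \<alpha> s (left_lim (\<lambda>u. X l u \<omega>) s) (X l s \<omega>)) \<partial>M l)
      has_real_derivative
        (LINT s:{0..t}|lborel. (\<integral>\<omega>. rate_contract r (\<lambda>s x y. \<alpha> s x y * g s x y) s (Y s \<omega>) \<partial>N)) +
        (LINT s:{0..t}|lborel. \<Sum>y\<in>UNIV. response s y * rate_contract r \<alpha> s y)) (at 0)"
    unfolding D has_bochner_integral_integral_eq[OF hb] .
qed

end

theorem theorem4p5: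
  fixes r :: "'x::finite \<Rightarrow> 'x \<Rightarrow> real"
    and g :: "real \<Rightarrow> 'x \<Rightarrow> 'x \<Rightarrow> real"
    and T :: real
    and P0 :: "real \<Rightarrow> real \<Rightarrow> 'x \<Rightarrow> 'x pmf"
    and \<pi> :: "'x pmf"
    and N :: "'v measure"
    and Y :: "real \<Rightarrow> 'v \<Rightarrow> 'x"
    and P :: "real \<Rightarrow> real \<Rightarrow> real \<Rightarrow> 'x \<Rightarrow> 'x pmf"
    and \<pi>l :: "real \<Rightarrow> 'x pmf"
    and M :: "real \<Rightarrow> 'w measure"
    and X :: "real \<Rightarrow> real \<Rightarrow> 'w \<Rightarrow> 'x"
  assumes r_nonneg: "\<And>x y. r x y \<ge> 0"
    and r_diag: "\<And>x. r x x = 0"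
    and r_irred: "irreducible_rates r"
    and T_pos: "T > 0"
    and g_bounded: "\<exists>C. \<forall>s x y. \<bar>g s x y\<bar> \<le> C"
    and g_measurable: "\<And>x y. (\<lambda>s. g s x y) \<in> borel_measurable borel"
    and g_periodic: "\<And>s x y. g (s + T) x y = g s x y"
    \<comment> \<open>the unperturbed process \<open>Y\<close>, started from its invariant distribution \<open>\<pi>\<close>\<close>
    and P0: "transition_function (\<lambda>s. r) P0"
    and \<pi>_inv: "\<And>t. t \<ge> 0 \<Longrightarrow> invariant_distribution (P0 0 t) \<pi>"
    and Y: "markov_jump_process P0 \<pi> N Y"
    \<comment> \<open>the perturbed processes \<open>X l\<close> in their oscillatory steady states: the initial law \<open>\<pi>l l\<close> is
      invariant for the chain observed at the times \<open>n T\<close>, whose one-step kernel is \<open>P l 0 T\<close>\<close>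
    and P: "\<And>l. transition_function (perturbed_rates r g l) (P l)"
    and \<pi>l_inv: "\<And>l. invariant_distribution (P l 0 T) (\<pi>l l)"
    and X: "\<And>l. markov_jump_process (P l) (\<pi>l l) (M l) (X l)"
  shows
    "(\<forall>t\<ge>0. \<forall>v :: 'x \<Rightarrow> real.
       set_integrable lborel {0..}
         (\<lambda>s. L2_inner \<pi> (exp_generator r s (\<lambda>x. of_real (v x))) (\<lambda>x. of_real (psi r \<pi> g (t - s) x))) \<and>
       set_integrable lborel {0..} (\<lambda>s. \<integral>\<omega>. v (Y s \<omega>) * psi r \<pi> g (t - s) (Y 0 \<omega>) \<partial>N) \<and>
       ((\<lambda>l. \<integral>\<omega>. v (X l t \<omega>) \<partial>M l) has_real_derivative
          (LINT s:{0..}|lborel. (\<integral>\<omega>. v (Y s \<omega>) * psi r \<pi> g (t - s) (Y 0 \<omega>) \<partial>N))) (at 0) \<and>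
       complex_of_real (LINT s:{0..}|lborel. (\<integral>\<omega>. v (Y s \<omega>) * psi r \<pi> g (t - s) (Y 0 \<omega>) \<partial>N)) =
         (LINT s:{0..}|lborel.
            L2_inner \<pi> (exp_generator r s (\<lambda>x. of_real (v x))) (\<lambda>x. of_real (psi r \<pi> g (t - s) x)))) \<and>
     (\<forall>t>0. \<forall>v :: real \<Rightarrow> 'x \<Rightarrow> real.
       (\<forall>x. set_borel_measurable borel {0..t} (\<lambda>s. v s x)) \<longrightarrow>
       (\<forall>x. set_integrable lborel {0..t} (\<lambda>s. \<bar>v s x\<bar>)) \<longrightarrow>
       (\<forall>l. integrable (M l) (\<lambda>\<omega>. LINT s:{0..t}|lborel. v s (X l s \<omega>))) \<and>
       (\<forall>u\<in>{0..t}. set_integrable lborel {0..}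
          (\<lambda>s. L2_inner \<pi> (exp_generator r s (\<lambda>x. of_real (v u x))) (\<lambda>x. of_real (psi r \<pi> g (u - s) x)))) \<and>
       set_integrable lborel {0..t} (\<lambda>u. LINT s:{0..}|lborel.
          L2_inner \<pi> (exp_generator r s (\<lambda>x. of_real (v u x))) (\<lambda>x. of_real (psi r \<pi> g (u - s) x))) \<and>
       (\<forall>u\<in>{0..t}. set_integrable lborel {0..}
          (\<lambda>s. \<integral>\<omega>. v u (Y s \<omega>) * psi r \<pi> g (u - s) (Y 0 \<omega>) \<partial>N)) \<and>
       set_integrable lborel {0..t} (\<lambda>u. LINT s:{0..}|lborel.
          (\<integral>\<omega>. v u (Y s \<omega>) * psi r \<pi> g (u - s) (Y 0 \<omega>) \<partial>N)) \<and>
       ((\<lambda>l. \<integral>\<omega>. (LINT s:{0..t}|lborel. v s (X l s \<omega>)) \<partial>M l) has_real_derivative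
          (LINT u:{0..t}|lborel. (LINT s:{0..}|lborel.
             (\<integral>\<omega>. v u (Y s \<omega>) * psi r \<pi> g (u - s) (Y 0 \<omega>) \<partial>N)))) (at 0) \<and>
       complex_of_real (LINT u:{0..t}|lborel. (LINT s:{0..}|lborel.
             (\<integral>\<omega>. v u (Y s \<omega>) * psi r \<pi> g (u - s) (Y 0 \<omega>) \<partial>N))) =
         (LINT u:{0..t}|lborel. (LINT s:{0..}|lborel.
            L2_inner \<pi> (exp_generator r s (\<lambda>x. of_real (v u x))) (\<lambda>x. of_real (psi r \<pi> g (u - s) x))))) \<and>
     (\<forall>t>0. \<forall>\<alpha> :: real \<Rightarrow> 'x \<Rightarrow> 'x \<Rightarrow> real.
       (\<forall>x y. set_borel_measurable borel {0..t} (\<lambda>s. \<alpha> s x y)) \<longrightarrow>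
       (\<forall>x. set_integrable lborel {0..t} (\<lambda>s. rate_contract r (\<lambda>s x y. \<bar>\<alpha> s x y\<bar>) s x)) \<longrightarrow>
       (\<forall>l. integrable (M l) (\<lambda>\<omega>.
          \<Sum>s\<in>jump_times (\<lambda>u. X l u \<omega>) t. \<alpha> s (left_lim (\<lambda>u. X l u \<omega>) s) (X l s \<omega>))) \<and>
       set_integrable lborel {0..t}
          (\<lambda>s. \<integral>\<omega>. rate_contract r (\<lambda>s x y. \<alpha> s x y * g s x y) s (Y s \<omega>) \<partial>N) \<and>
       (\<forall>s\<in>{0..t}. set_integrable lborel {0..}
          (\<lambda>u. \<integral>\<omega>. rate_contract r \<alpha> s (Y u \<omega>) * psi r \<pi> g (s - u) (Y 0 \<omega>) \<partial>N)) \<and>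
       set_integrable lborel {0..t} (\<lambda>s. LINT u:{0..}|lborel.
          (\<integral>\<omega>. rate_contract r \<alpha> s (Y u \<omega>) * psi r \<pi> g (s - u) (Y 0 \<omega>) \<partial>N)) \<and>
       ((\<lambda>l. \<integral>\<omega>. (\<Sum>s\<in>jump_times (\<lambda>u. X l u \<omega>) t.
               \<alpha> s (left_lim (\<lambda>u. X l u \<omega>) s) (X l s \<omega>)) \<partial>M l) has_real_derivative
          (LINT s:{0..t}|lborel.
             (\<integral>\<omega>. rate_contract r (\<lambda>s x y. \<alpha> s x y * g s x y) s (Y s \<omega>) \<partial>N)) +
          (LINT s:{0..t}|lborel. (LINT u:{0..}|lborel.
             (\<integral>\<omega>. rate_contract r \<alpha> s (Y u \<omega>) * psi r \<pi> g (s - u) (Y 0 \<omega>) \<partial>N)))) (at 0))"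
proof -
  obtain G where G: "\<And>s x y. \<bar>g s x y\<bar> \<le> G"
    using g_bounded by blast
  interpret oscillatory_steady_state r P0 \<pi> T g G P \<pi>l N Y M X
    by unfold_locales (rule r_nonneg r_irred T_pos P0 \<pi>_inv G g_measurable g_periodic P \<pi>l_inv r_diag Y X; assumption?)+
  have v_int: "set_integrable lborel {0..t} (\<lambda>s. v s x)"
    if v: "\<forall>x. set_borel_measurable borel {0..t} (\<lambda>s. v s x)" "\<forall>x. set_integrable lborel {0..t} (\<lambda>s. \<bar>v s x\<bar>)"
    for v :: "real \<Rightarrow> 'x \<Rightarrow> real" and t x
    using v set_integrable_abs_iff[of lborel "{0..t}" "\<lambda>s. v s x"]
    by (auto simp: set_borel_measurable_def)
  show ?thesis
  \<comment> \<open>Unfolding replaces each inner integral over \<open>{0..}\<close> by its pairing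
    with the response, which gives the claims the form of the preceding lemmas. The goals not listed
    are the inner integrability claims and the real-complex equations, which have become
    reflexive.\<close>
  proof (intro conjI allI impI ballI, unfold response_integrals set_integral_complex_of_real, goal_cases)
    case (3 t v)
    then show ?case by (rule response_of_observable)
  next
    case (5 t v l)
    show ?case by (rule response_of_occupation(1)) (rule v_int[OF 5(2,3)])
  next
    case (7 t v)
    show ?case by (intro set_integrable_complex_of_real response_of_occupation(2)) (rule v_int[OF 7(2,3)])
  next
    case (9 t v)
    show ?case by (rule response_of_occupation(2)) (rule v_int[OF 9(2,3)])
  next
    case (10 t v)
    show ?case by (rule response_of_occupation(3)) (rule v_int[OF 10(2,3)])
  next
    case (12 t \<alpha> l)
    then show ?case by (intro response_of_jump_sum(1)) auto
  next
    case (13 t \<alpha>)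
    then show ?case by (intro response_of_jump_sum(2)) auto
  next
    case (15 t \<alpha>)
    then show ?case by (intro response_of_jump_sum(3)) auto
  next
    case (16 t \<alpha>)
    then show ?case by (intro response_of_jump_sum(4)) auto
  qed (rule response_integrals refl)+
qed

end
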